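(* Let $n\ge 3$ and let $(W,S)$ be a Coxeter system whose nerve is the complete graph $K_n$ (so $|S|=n$, every pair of distinct generators spans a finite special subgroup and no three do), with all edges labeled by the same integer $m\ge n-1$, i.e. $m_{st}=m$ for all $s\ne t$. Then $L^2_\mathbf{q}H_2(\Sigma(W,S))=0$ for every multiparameter $\mathbf{q}\le\mathbf{1}$.
   Context: The nerve $L$ of $(W,S)$ is the simplicial complex with vertex set $S$ whose simplices are the nonempty spherical subsets $U\subseteq S$ (those with $\langle U\rangle$ finite); the edge $\{s,t\}$ is labeled by $m_{st}$. A multiparameter is $\mathbf{q}=(q_s)_{s\in S}$, $q_s>0$, constant on conjugacy classes, and $\mathbf{q}\le\mathbf{1}$ means $q_s\le 1$ for all $s$. Weighted $L^2$-homology of the Davis complex $\Sigma(W,S)$: cell $w\sigma$ gets measure $q_u$, $u$ the shortest element of $wW_{S(\sigma)}$ ($S(\sigma)$ the type of $\sigma$); chains square-summable for $\sum f(\sigma)g(\sigma)\mu_\mathbf{q}(\sigma)$; boundary $\partial^\mathbf{q}$ the adjoint of the coboundary; $L^2_\mathbf{q}H_i=\ker\partial^\mathbf{q}_i/\overline{\operatorname{im}\partial^\mathbf{q}_{i+1}}$. *)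

theory Defs
  imports "HOL-Analysis.Analysis" "HOL-Algebra.Generated_Groups" "HOL-Algebra.Coset"
          "HOL-Library.Extended_Nat"
begin

definition prod_word :: "('a, 'b) monoid_scheme \<Rightarrow> 'a list \<Rightarrow> 'a" where
  "prod_word G ws = foldr (\<lambda>x y. x \<otimes>\<^bsub>G\<^esub> y) ws \<one>\<^bsub>G\<^esub>"

text \<open>Congruence on words over S generated by the Coxeter relators (s t)^(m_st)
  (for s = t, m_ss = 1, this is the relator s s).\<close>
inductive word_equiv :: "'a set \<Rightarrow> ('a \<Rightarrow> 'a \<Rightarrow> enat) \<Rightarrow> 'a list \<Rightarrow> 'a list \<Rightarrow> bool"
  for S M where
  weq_refl: "ws \<in> lists S \<Longrightarrow> word_equiv S M ws ws"
| weq_sym: "word_equiv S M u v \<Longrightarrow> word_equiv S M v u"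
| weq_trans: "word_equiv S M u v \<Longrightarrow> word_equiv S M v w \<Longrightarrow> word_equiv S M u w"
| weq_rel: "u \<in> lists S \<Longrightarrow> v \<in> lists S \<Longrightarrow> s \<in> S \<Longrightarrow> t \<in> S \<Longrightarrow> M s t = enat k
    \<Longrightarrow> word_equiv S M (u @ concat (replicate k [s, t]) @ v) (u @ v)"

definition coxeter_matrix :: "'a set \<Rightarrow> ('a \<Rightarrow> 'a \<Rightarrow> enat) \<Rightarrow> bool" where
  "coxeter_matrix S M \<longleftrightarrow> (\<forall>s\<in>S. M s s = 1) \<and>
     (\<forall>s\<in>S. \<forall>t\<in>S. s \<noteq> t \<longrightarrow> M s t = M t s \<and> M s t \<ge> 2)"

definition coxeter_system :: "('a, 'b) monoid_scheme \<Rightarrow> 'a set \<Rightarrow> ('a \<Rightarrow> 'a \<Rightarrow> enat) \<Rightarrow> bool" where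
  "coxeter_system G S M \<longleftrightarrow> group G \<and> S \<subseteq> carrier G \<and> coxeter_matrix S M \<and>
     generate G S = carrier G \<and>
     (\<forall>s\<in>S. \<forall>t\<in>S. \<forall>k. M s t = enat k \<longrightarrow> (s \<otimes>\<^bsub>G\<^esub> t) [^]\<^bsub>G\<^esub> k = \<one>\<^bsub>G\<^esub>) \<and>
     (\<forall>ws\<in>lists S. prod_word G ws = \<one>\<^bsub>G\<^esub> \<longrightarrow> word_equiv S M ws [])"

definition spherical :: "('a, 'b) monoid_scheme \<Rightarrow> 'a set \<Rightarrow> bool" where
  "spherical G T \<longleftrightarrow> finite (generate G T)"

definition wlen :: "('a, 'b) monoid_scheme \<Rightarrow> 'a set \<Rightarrow> 'a \<Rightarrow> nat" where
  "wlen G S w = (LEAST k. \<exists>ws\<in>lists S. length ws = k \<and> prod_word G ws = w)"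

definition reduced_word :: "('a, 'b) monoid_scheme \<Rightarrow> 'a set \<Rightarrow> 'a \<Rightarrow> 'a list \<Rightarrow> bool" where
  "reduced_word G S w ws \<longleftrightarrow> ws \<in> lists S \<and> prod_word G ws = w \<and> length ws = wlen G S w"

definition qw :: "('a, 'b) monoid_scheme \<Rightarrow> 'a set \<Rightarrow> ('a \<Rightarrow> real) \<Rightarrow> 'a \<Rightarrow> real" where
  "qw G S q w = prod_list (map q (SOME ws. reduced_word G S w ws))"

definition multiparameter :: "('a, 'b) monoid_scheme \<Rightarrow> 'a set \<Rightarrow> ('a \<Rightarrow> real) \<Rightarrow> bool" where
  "multiparameter G S q \<longleftrightarrow> (\<forall>s\<in>S. q s > 0) \<and>
     (\<forall>s\<in>S. \<forall>t\<in>S. (\<exists>w\<in>carrier G. t = w \<otimes>\<^bsub>G\<^esub> s \<otimes>\<^bsub>G\<^esub> inv\<^bsub>G\<^esub> w) \<longrightarrow> q s = q t)"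

text \<open>k-cells of Sigma: cosets w W_T with T spherical, |T| = k, recorded with their type T.\<close>
definition cells :: "('a, 'b) monoid_scheme \<Rightarrow> 'a set \<Rightarrow> nat \<Rightarrow> ('a set \<times> 'a set) set" where
  "cells G S k = {(w <#\<^bsub>G\<^esub> generate G T, T) | w T.
      w \<in> carrier G \<and> T \<subseteq> S \<and> card T = k \<and> spherical G T}"

definition min_elt :: "('a, 'b) monoid_scheme \<Rightarrow> 'a set \<Rightarrow> 'a set \<Rightarrow> 'a" where
  "min_elt G S C = (SOME u. u \<in> C \<and> (\<forall>x\<in>C. wlen G S u \<le> wlen G S x))"

definition cell_measure :: "('a, 'b) monoid_scheme \<Rightarrow> 'a set \<Rightarrow> ('a \<Rightarrow> real) \<Rightarrow> 'a set \<times> 'a set \<Rightarrow> real" where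
  "cell_measure G S q \<sigma> = qw G S q (min_elt G S (fst \<sigma>))"

definition alt_word :: "'a \<Rightarrow> 'a \<Rightarrow> nat \<Rightarrow> 'a list" where
  "alt_word s t k = map (\<lambda>i. if even i then s else t) [0..<k]"

text \<open>Incidence number [sigma : e] of an edge e = x W_{r} in a 2-cell sigma = u W_{s,t}
  (u shortest in the coset).  Edges are oriented from the shorter to the longer vertex;
  the polygon is oriented so that its boundary runs u, us, ust, ... (s a fixed choice in T).\<close>
definition incidence :: "('a, 'b) monoid_scheme \<Rightarrow> 'a set \<Rightarrow> ('a \<Rightarrow> 'a \<Rightarrow> enat)
     \<Rightarrow> 'a set \<times> 'a set \<Rightarrow> 'a set \<times> 'a set \<Rightarrow> real" where
  "incidence G S M \<sigma> e =
     (let C = fst \<sigma>; T = snd \<sigma>; E = fst e;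
          s = (SOME s. s \<in> T); t = (SOME t. t \<in> T \<and> t \<noteq> s);
          u = min_elt G S C; m = the_enat (M s t)
      in if E \<subseteq> C then
           (if \<exists>k<m. E = {u \<otimes>\<^bsub>G\<^esub> prod_word G (alt_word s t k),
                             u \<otimes>\<^bsub>G\<^esub> prod_word G (alt_word s t (Suc k))}
            then 1 else -1)
         else 0)"

text \<open>Weighted boundary on 2-chains: the adjoint of the coboundary with respect to
  the inner products weighted by the cell measures.\<close>
definition bdry2 :: "('a, 'b) monoid_scheme \<Rightarrow> 'a set \<Rightarrow> ('a \<Rightarrow> 'a \<Rightarrow> enat) \<Rightarrow> ('a \<Rightarrow> real)
     \<Rightarrow> ('a set \<times> 'a set \<Rightarrow> real) \<Rightarrow> 'a set \<times> 'a set \<Rightarrow> real" where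
  "bdry2 G S M q f e =
     (\<Sum>\<sigma>\<in>{\<sigma>\<in>cells G S 2. fst e \<subseteq> fst \<sigma>}.
         incidence G S M \<sigma> e * f \<sigma> * cell_measure G S q \<sigma>) / cell_measure G S q e"

definition l2_chains2 :: "('a, 'b) monoid_scheme \<Rightarrow> 'a set \<Rightarrow> ('a \<Rightarrow> real)
     \<Rightarrow> ('a set \<times> 'a set \<Rightarrow> real) set" where
  "l2_chains2 G S q = {f. (\<lambda>\<sigma>. (f \<sigma>)\<^sup>2 * cell_measure G S q \<sigma>) summable_on cells G S 2}"

end

theory Submission
  imports Defs
begin

text \<open>
  Multiplying a weighted cycle by the cell measure turns it into an ordinary locally finite cycle,
  and since the measure is at most 1 its unweighted \<open>L\<^sup>2\<close>-norm is finite; so it suffices to treat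
  square-summable ordinary 2-cycles.  At each vertex the coefficients form a circulation on the link
  \<open>K\<^sub>n\<close>.

  If \<open>n = 3\<close>, the coefficients are constant up to sign on an infinite complex.  If
  \<open>n - 1 \<le> 2 (m - 2)\<close>, order the vertices by word length: the cells with lowest vertex \<open>x\<close> must
  compensate the divergence caused at \<open>x\<close> by the earlier cells, and each cell is an earlier cell at
  \<open>2 (m - 2)\<close> vertices with exactly one descent, each of which returns at least the fraction
  \<open>1 / (n - 1)\<close> of its energy.  So the cells away from the identity carry all the energy,
  the cells at the identity carry none, and one translates.

  The remaining case \<open>n = 4\<close>, \<open>m = 3\<close> is the reflection group of the regular ideal tetrahedron in
  hyperbolic 3-space.  A cycle is the gradient of a function on the cusps, a 2-cell corresponding to a
  pair of adjacent cusps.  Around the geodesic between two adjacent cusps, the equidistant tube of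
  radius about \<open>k\<close> carries \<open>32\<^sup>k\<close> well-separated curves joining the two horoballs, each of length
  of order \<open>k 32\<^sup>k\<close>.  Hence a difference \<open>\<delta>\<close> of the function between the two cusps costs energy of
  order \<open>\<delta>\<^sup>2 / k\<close> in each tube, and the harmonic series diverges.
\<close>

section \<open>Words\<close>

text \<open>The weights have to go first because only the unweighted norm is invariant under left
  translation; after that, vanishing at the identity is enough. The energy comparison gains the
  factor \<open>2 (m - 2) / (n - 1)\<close>. A factor of exactly 1 still suffices, since the
  identity has no descents and its cells drop out of one side of the estimate. For
  \<open>n \<ge> 4\<close> and \<open>m \<ge> n - 1\<close> the factor falls below 1 only for
  \<open>n = 4\<close>, \<open>m = 3\<close>, where it is 2/3; there a global family of paths
  replaces the comparison at single vertices. On the tube with \<open>R = 32^k\<close> the perimeter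
  and the stretching of lengths parallel to the axis are both of order \<open>R\<close>, so there
  are about \<open>R\<close> separated curves, each of length about \<open>R log R\<close>.
  Cauchy-Schwarz then gives a cost of order \<open>1 / log R\<close>, that is \<open>1 / k\<close>.
  The base 32 keeps the tubes so far apart that steps of different tubes never use the same ordered
  pair of cusps, so that their energies add up.\<close>

locale uniform_coxeter = group G for G :: "('a, 'b) monoid_scheme" (structure) +
  fixes S :: "'a set" and m :: nat
  assumes coxeter: "coxeter_system G S (\<lambda>s t. if s = t then 1 else enat m)"
    and finite_S: "finite S"
    and m_ge_2: "m \<ge> 2"
begin

declare in_lists_conv_set [simp]

abbreviation pw :: "'a list \<Rightarrow> 'a" where "pw \<equiv> prod_word G"
abbreviation weq :: "'a list \<Rightarrow> 'a list \<Rightarrow> bool" where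
  "weq \<equiv> word_equiv S (\<lambda>s t. if s = t then 1 else enat m)"
abbreviation len :: "'a \<Rightarrow> nat" where "len \<equiv> wlen G S"

lemma S_carrier: "S \<subseteq> carrier G"
  and generate_S: "generate G S = carrier G"
  and weq_Nil: "ws \<in> lists S \<Longrightarrow> pw ws = \<one> \<Longrightarrow> weq ws []"
  using coxeter by (auto simp: coxeter_system_def)

lemma in_carrier [simp]: "s \<in> S \<Longrightarrow> s \<in> carrier G"
  using S_carrier by auto

lemma invol [simp]: assumes "s \<in> S" shows "s \<otimes> s = \<one>"
proof -
  have "(s \<otimes> s) [^] (1::nat) = \<one>"
    using coxeter assms unfolding coxeter_system_def by (metis one_enat_def)
  then show ?thesis using assms by simp
qed

lemma mult_inv_cancel [simp]:
  "x \<in> carrier G \<Longrightarrow> y \<in> carrier G \<Longrightarrow> x \<otimes> (inv x \<otimes> y) = y"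
  "x \<in> carrier G \<Longrightarrow> y \<in> carrier G \<Longrightarrow> inv x \<otimes> (x \<otimes> y) = y"
  by (simp_all add: m_assoc[symmetric])

lemma invol_left [simp]: "s \<in> S \<Longrightarrow> x \<in> carrier G \<Longrightarrow> s \<otimes> (s \<otimes> x) = x"
  by (simp add: m_assoc[symmetric])

lemma invol_right [simp]: "s \<in> S \<Longrightarrow> x \<in> carrier G \<Longrightarrow> x \<otimes> s \<otimes> s = x"
  by (simp add: m_assoc)

lemma inv_S [simp]: "s \<in> S \<Longrightarrow> inv s = s"
  by (simp add: inv_equality)

lemma pow_m: "s \<in> S \<Longrightarrow> t \<in> S \<Longrightarrow> s \<noteq> t \<Longrightarrow> (s \<otimes> t) [^] m = \<one>"
  using coxeter unfolding coxeter_system_def by auto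

lemma pw_Nil [simp]: "pw [] = \<one>"
  and pw_Cons [simp]: "pw (s # ws) = s \<otimes> pw ws"
  by (auto simp: prod_word_def)

lemma pw_closed [simp]: "ws \<in> lists S \<Longrightarrow> pw ws \<in> carrier G"
  by (induction ws) auto

lemma pw_append: "u \<in> lists S \<Longrightarrow> v \<in> lists S \<Longrightarrow> pw (u @ v) = pw u \<otimes> pw v"
  by (induction u) (auto simp: m_assoc)

lemma pw_rev: "ws \<in> lists S \<Longrightarrow> pw (rev ws) = inv (pw ws)"
  by (induction ws) (auto simp: pw_append inv_mult_group)

lemma pw_replicate: "s \<in> S \<Longrightarrow> t \<in> S \<Longrightarrow> pw (concat (replicate k [s, t])) = (s \<otimes> t) [^] k"
proof (induction k)
  case (Suc k)
  moreover have "(s \<otimes> t) [^] Suc k = (s \<otimes> t) \<otimes> (s \<otimes> t) [^] k"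
    using Suc by (intro nat_pow_Suc2) simp
  ultimately show ?case by (simp add: m_assoc del: nat_pow_Suc)
qed auto

lemma ex_word: assumes "x \<in> carrier G" shows "\<exists>ws\<in>lists S. pw ws = x"
proof -
  have "x \<in> generate G S" using assms generate_S by simp
  then show ?thesis
  proof (induction rule: generate.induct)
    case one then show ?case by (intro bexI[of _ "[]"]) auto
  next
    case (incl h) then show ?case by (intro bexI[of _ "[h]"]) auto
  next
    case (inv h) then show ?case by (intro bexI[of _ "[h]"]) auto
  next
    case (eng h1 h2)
    then obtain u v where "u \<in> lists S" "v \<in> lists S" "pw u = h1" "pw v = h2" by auto
    then show ?case by (intro bexI[of _ "u @ v"]) (auto simp: pw_append)
  qed
qed

lemma weq_append: assumes "weq u v" "a \<in> lists S" "b \<in> lists S" shows "weq (a @ u @ b) (a @ v @ b)"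
  using assms(1)
proof (induction rule: word_equiv.induct)
  case (weq_refl ws) then show ?case using assms by (intro word_equiv.weq_refl) auto
next
  case (weq_sym u v) then show ?case by (rule_tac word_equiv.weq_sym)
next
  case (weq_trans u v w) then show ?case by (rule_tac word_equiv.weq_trans)
next
  case (weq_rel u v s t k)
  then show ?case
    using assms word_equiv.weq_rel[of "a @ u" S "v @ b" s t "\<lambda>s t. if s = t then 1 else enat m" k]
    by (simp del: if_split) blast
qed

lemma weq_square: "u \<in> lists S \<Longrightarrow> v \<in> lists S \<Longrightarrow> s \<in> S \<Longrightarrow> weq (u @ [s, s] @ v) (u @ v)"
  using word_equiv.weq_rel[of u S v s s "\<lambda>s t. if s = t then 1 else enat m" 1]
  by (simp add: one_enat_def)

lemma weq_rev: "ws \<in> lists S \<Longrightarrow> weq (rev ws @ ws) []"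
proof (induction ws)
  case (Cons s ws)
  have "weq (rev ws @ [s, s] @ ws) (rev ws @ ws)" using Cons by (intro weq_square) auto
  then show ?case using Cons word_equiv.weq_trans by fastforce
qed (auto intro: word_equiv.weq_refl)

lemma weq_if_pw_eq:
  assumes "u \<in> lists S" "v \<in> lists S" "pw u = pw v" shows "weq u v"
proof -
  have "weq (u @ rev v) []"
    using assms by (intro weq_Nil) (auto simp: pw_append pw_rev)
  then have 1: "weq (u @ rev v @ v) v" using weq_append[of "u @ rev v" "[]" "[]" v] assms by simp
  have 2: "weq (u @ rev v @ v) u" using weq_append[OF weq_rev[OF assms(2)], of u "[]"] assms by simp
  show ?thesis using word_equiv.weq_trans[OF word_equiv.weq_sym[OF 2] 1] .
qed

text \<open>This is how functions of words descend to the group: the congruence is generated by the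
  relators, so only squares and braid words need checking. It serves \<open>altsum\<close>,
  \<open>nrefl\<close>, \<open>act_word\<close> and \<open>pot\<close> in turn.\<close>

lemma word_function_eqI:
  assumes "u \<in> lists S" "v \<in> lists S" "pw u = pw v"
    and sq: "\<And>a b s. a \<in> lists S \<Longrightarrow> b \<in> lists S \<Longrightarrow> s \<in> S \<Longrightarrow> F (a @ [s, s] @ b) = F (a @ b)"
    and br: "\<And>a b s t. a \<in> lists S \<Longrightarrow> b \<in> lists S \<Longrightarrow> s \<in> S \<Longrightarrow> t \<in> S \<Longrightarrow> s \<noteq> t \<Longrightarrow>
               F (a @ concat (replicate m [s, t]) @ b) = F (a @ b)"
  shows "F u = F v"
  using weq_if_pw_eq[OF assms(1-3)]
proof (induction rule: word_equiv.induct)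
  case (weq_rel u v s t k)
  show ?case
  proof (cases "s = t")
    case True
    then have "k = 1" using weq_rel by (simp add: one_enat_def)
    then show ?thesis using sq[of u v s] weq_rel True by simp
  next
    case False
    then show ?thesis using br[of u v s t] weq_rel by simp
  qed
qed auto

section \<open>The order of a product of two generators\<close>

primrec altsum :: "('a \<Rightarrow> int) \<Rightarrow> 'a list \<Rightarrow> int" where
  "altsum e [] = 0"
| "altsum e (s # ws) = e s - altsum e ws"

lemma altsum_append: "altsum e (u @ v) = altsum e u + (-1) ^ length u * altsum e v"
  by (induction u) (auto simp: algebra_simps)

lemma altsum_replicate: "altsum e (concat (replicate k [s, t])) = int k * (e s - e t)"
  by (induction k) (auto simp: algebra_simps)

lemma length_concat_replicate: "length (concat (replicate k [s, t])) = 2 * k"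
  by (induction k) auto

text \<open>Modulo \<open>m\<close> the alternating sum is a homomorphism to the dihedral group of order \<open>2 m\<close>;
  with \<open>e\<close> the indicator of \<open>t\<close> it shows that no smaller power vanishes.\<close>
lemma pow_neq_one:
  assumes "s \<in> S" "t \<in> S" "s \<noteq> t" "0 < k" "k < m"
  shows "(s \<otimes> t) [^] k \<noteq> \<one>"
proof
  assume one: "(s \<otimes> t) [^] k = \<one>"
  define e where "e = (\<lambda>r. if r = t then 1 else 0 :: int)"
  have "altsum e (concat (replicate k [s, t])) mod int m = altsum e [] mod int m"
  proof (rule word_function_eqI[where F = "\<lambda>ws. altsum e ws mod int m"])
    show "pw (concat (replicate k [s, t])) = pw []" using assms one by (simp add: pw_replicate)
    show "concat (replicate k [s, t]) \<in> lists S" using assms by (auto split: if_splits)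
    fix a b x y assume "x \<in> S" "y \<in> S" "x \<noteq> y" "a \<in> lists S" "b \<in> lists S"
    \<comment> \<open>The relator has even length, so the sign of what follows it is unchanged, and
      its own alternating sum is a multiple of \<open>m\<close>.\<close>
    have "altsum e (a @ concat (replicate m [x, y]) @ b) =
       altsum e (a @ b) + int m * ((-1) ^ length a * (e x - e y))"
      by (simp add: altsum_append altsum_replicate length_concat_replicate algebra_simps)
    then show "altsum e (a @ concat (replicate m [x, y]) @ b) mod int m = altsum e (a @ b) mod int m"
      by simp
  qed (auto simp: altsum_append)
  then have "int m dvd int k * (e s - e t)" by (simp add: altsum_replicate mod_eq_0_iff_dvd)
  then have "int m dvd int k" using assms by (simp add: e_def)
  then show False using assms by (simp add: nat_dvd_not_less)
qed

section \<open>Inversions and the exchange condition\<close>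

text \<open>Each letter is attached to its conjugate by the part of the word behind it: multiplying
  by this reflection on the right deletes the letter. The count depends on the word, but its parity
  only on the product.\<close>

primrec nrefl :: "'a list \<Rightarrow> 'a \<Rightarrow> nat" where
  "nrefl [] r = 0"
| "nrefl (s # ws) r = (if r = inv (pw ws) \<otimes> s \<otimes> pw ws then 1 else 0) + nrefl ws r"

lemma conj_eq_iff:
  "x \<in> carrier G \<Longrightarrow> y \<in> carrier G \<Longrightarrow> r \<in> carrier G \<Longrightarrow>
    r = inv x \<otimes> y \<otimes> x \<longleftrightarrow> x \<otimes> r \<otimes> inv x = y"
  by (metis inv_closed inv_solve_left inv_solve_right m_assoc m_closed)

lemma nrefl_append:
  assumes "u \<in> lists S" "v \<in> lists S" "r \<in> carrier G"
  shows "nrefl (u @ v) r = nrefl u (pw v \<otimes> r \<otimes> inv (pw v)) + nrefl v r"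
  using assms(1)
proof (induction u)
  case (Cons s u)
  have "(r = inv (pw u \<otimes> pw v) \<otimes> s \<otimes> (pw u \<otimes> pw v)) \<longleftrightarrow>
        pw v \<otimes> r \<otimes> inv (pw v) = inv (pw u) \<otimes> s \<otimes> pw u"
    using Cons assms conj_eq_iff[of "pw u \<otimes> pw v" s r] conj_eq_iff[of "pw u" s "pw v \<otimes> r \<otimes> inv (pw v)"]
    by (simp only: inv_mult_group) (simp add: inv_mult_group m_assoc)
  then show ?case using Cons assms by (simp add: pw_append)
qed auto

lemma pow_flip: "s \<in> S \<Longrightarrow> t \<in> S \<Longrightarrow> inv ((s \<otimes> t) [^] (j::nat)) \<otimes> t = t \<otimes> (s \<otimes> t) [^] j"
proof (induction j)
  case (Suc j)
  have "inv ((s \<otimes> t) [^] Suc j) \<otimes> t = t \<otimes> s \<otimes> (inv ((s \<otimes> t) [^] j) \<otimes> t)"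
    using Suc by (simp add: inv_mult_group m_assoc)
  also have "\<dots> = t \<otimes> ((s \<otimes> t) \<otimes> (s \<otimes> t) [^] j)" using Suc by (simp add: m_assoc)
  also have "\<dots> = t \<otimes> (s \<otimes> t) [^] Suc j" using Suc.prems nat_pow_Suc2[of "s \<otimes> t" j] by simp
  finally show ?case .
qed auto

lemma nrefl_replicate:
  assumes "s \<in> S" "t \<in> S"
  shows "nrefl (concat (replicate j [s, t])) r = (\<Sum>i<2*j. of_bool (r = t \<otimes> (s \<otimes> t) [^] i))"
proof (induction j)
  case (Suc j)
  let ?p = "(s \<otimes> t) [^] j"
  have c: "?p \<in> carrier G" using assms by simp
  have e1: "inv ?p \<otimes> t \<otimes> ?p = t \<otimes> (s \<otimes> t) [^] (2 * j)"
    using assms by (simp add: pow_flip m_assoc nat_pow_mult mult_2)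
  have "inv (t \<otimes> ?p) \<otimes> s \<otimes> (t \<otimes> ?p) = (inv ?p \<otimes> t) \<otimes> ((s \<otimes> t) \<otimes> ?p)"
    using assms c by (simp add: inv_mult_group m_assoc)
  also have "\<dots> = t \<otimes> (?p \<otimes> (s \<otimes> t) [^] Suc j)"
    using assms c nat_pow_Suc2[of "s \<otimes> t" j] by (simp add: pow_flip m_assoc)
  also have "?p \<otimes> (s \<otimes> t) [^] Suc j = (s \<otimes> t) [^] Suc (2 * j)"
    using assms nat_pow_mult[of "s \<otimes> t" j "Suc j"] by (simp add: mult_2)
  finally have e2: "inv (t \<otimes> ?p) \<otimes> s \<otimes> (t \<otimes> ?p) = t \<otimes> (s \<otimes> t) [^] Suc (2 * j)" .
  show ?case using Suc assms e1 e2 by (simp add: pw_replicate)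
qed auto

text \<open>The \<open>2 m\<close> reflections attached to the relator are
  \<open>t \<otimes> (s \<otimes> t) [^] i\<close>, which has period \<open>m\<close> in
  \<open>i\<close>; hence each of them is listed an even number of times.\<close>

lemma even_nrefl_braid:
  assumes "s \<in> S" "t \<in> S" "s \<noteq> t"
  shows "even (nrefl (concat (replicate m [s, t])) r)"
proof -
  let ?f = "\<lambda>i. of_bool (r = t \<otimes> (s \<otimes> t) [^] i) :: nat"
  have "?f (i + m) = ?f i" for i
    using assms pow_m[OF assms] nat_pow_mult[of "s \<otimes> t" i m, symmetric] by simp
  then have "(\<Sum>i<2*m. ?f i) = 2 * (\<Sum>i<m. ?f i)"
    using sum.shift_bounds_nat_ivl[of ?f 0 m m] sum.atLeastLessThan_concat[of 0 m "m+m" ?f]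
    by (simp only: mult_2 lessThan_atLeast0) simp
  then show ?thesis using assms by (simp add: nrefl_replicate)
qed

text \<open>For a generator this will mean being a right descent. Parity is used instead of length
  because it obeys the cocycle rule \<open>inversion_mult\<close>.\<close>

definition inversion :: "'a \<Rightarrow> 'a \<Rightarrow> bool" where
  "inversion x r = odd (nrefl (SOME ws. ws \<in> lists S \<and> pw ws = x) r)"

lemma nrefl_parity:
  assumes "u \<in> lists S" "v \<in> lists S" "pw u = pw v" "r \<in> carrier G"
  shows "even (nrefl u r) = even (nrefl v r)"
proof (rule word_function_eqI[where F = "\<lambda>ws. even (nrefl ws r)", OF assms(1-3)])
  fix a b s assume *: "a \<in> lists S" "b \<in> lists S" "s \<in> S"
  have "inv (s \<otimes> pw b) \<otimes> s \<otimes> (s \<otimes> pw b) = inv (pw b) \<otimes> s \<otimes> pw b"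
    using * by (simp add: inv_mult_group m_assoc)
  then show "even (nrefl (a @ [s, s] @ b) r) = even (nrefl (a @ b) r)"
    using * assms by (simp add: nrefl_append)
next
  fix a b s t assume *: "a \<in> lists S" "b \<in> lists S" "s \<in> S" "t \<in> S" "s \<noteq> t"
  then have X: "concat (replicate m [s, t]) \<in> lists S" by (auto split: if_splits)
  have "pw (concat (replicate m [s, t])) = \<one>" using * by (simp add: pw_replicate pow_m)
  then show "even (nrefl (a @ concat (replicate m [s, t]) @ b) r) = even (nrefl (a @ b) r)"
    using * assms X even_nrefl_braid[OF *(3-5)] by (simp add: nrefl_append pw_append)
qed

lemma inversion_word:
  assumes "ws \<in> lists S" "r \<in> carrier G"
  shows "inversion (pw ws) r = odd (nrefl ws r)"
proof -
  define vs where "vs = (SOME vs. vs \<in> lists S \<and> pw vs = pw ws)"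
  have "vs \<in> lists S \<and> pw vs = pw ws" unfolding vs_def by (rule someI[of _ ws]) (use assms in auto)
  then show ?thesis using nrefl_parity[of vs ws r] assms unfolding inversion_def vs_def[symmetric] by simp
qed

lemma inversion_mult:
  assumes "x \<in> carrier G" "y \<in> carrier G" "r \<in> carrier G"
  shows "inversion (x \<otimes> y) r = (inversion x (y \<otimes> r \<otimes> inv y) \<noteq> inversion y r)"
proof -
  obtain u v where "u \<in> lists S" "v \<in> lists S" "pw u = x" "pw v = y"
    using ex_word assms by metis
  then show ?thesis
    using inversion_word[of "u @ v" r] inversion_word[of u "y \<otimes> r \<otimes> inv y"] inversion_word[of v r] assms
    by (auto simp: pw_append nrefl_append)
qed

lemma inversion_one [simp]: "r \<in> carrier G \<Longrightarrow> \<not> inversion \<one> r"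
  using inversion_word[of "[]" r] by simp

lemma inversion_gen: "s \<in> S \<Longrightarrow> r \<in> carrier G \<Longrightarrow> inversion s r \<longleftrightarrow> r = s"
  using inversion_word[of "[s]" r] by simp

lemma inversion_mult_gen:
  "x \<in> carrier G \<Longrightarrow> s \<in> S \<Longrightarrow> inversion (x \<otimes> s) s \<longleftrightarrow> \<not> inversion x s"
  by (simp add: inversion_mult inversion_gen)

section \<open>Length, strong exchange and descents\<close>

lemma len_le: "ws \<in> lists S \<Longrightarrow> len (pw ws) \<le> length ws"
  unfolding wlen_def by (rule Least_le) auto

lemma ex_reduced: assumes "x \<in> carrier G" shows "\<exists>ws. reduced_word G S x ws"
proof -
  have "\<exists>k. \<exists>ws\<in>lists S. length ws = k \<and> pw ws = x" using ex_word[OF assms] by auto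
  then have "\<exists>ws\<in>lists S. length ws = len x \<and> pw ws = x" unfolding wlen_def by (rule LeastI_ex)
  then show ?thesis by (auto simp: reduced_word_def)
qed

text \<open>The strong exchange condition: a letter whose attached reflection is \<open>r\<close>
  can be deleted, and this multiplies the product by \<open>r\<close>.\<close>

lemma nrefl_delete:
  assumes "ws \<in> lists S" "r \<in> carrier G" "nrefl ws r > 0"
  shows "\<exists>vs\<in>lists S. length vs < length ws \<and> pw vs = pw ws \<otimes> r"
  using assms
proof (induction ws rule: list.induct)
  case (Cons s ws)
  show ?case
  proof (cases "r = inv (pw ws) \<otimes> s \<otimes> pw ws")
    case True
    have c: "s \<in> S" "pw ws \<in> carrier G" using Cons.prems by auto
    then have "pw (s # ws) \<otimes> r = pw ws" unfolding True by (simp add: m_assoc)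
    then show ?thesis using Cons.prems by (intro bexI[of _ ws]) auto
  next
    case False
    then obtain vs where "vs\<in>lists S" "length vs < length ws" "pw vs = pw ws \<otimes> r"
      using Cons by auto
    then show ?thesis using Cons.prems by (intro bexI[of _ "s # vs"]) (auto simp: m_assoc)
  qed
qed auto

lemma inversion_len_less:
  assumes "x \<in> carrier G" "r \<in> carrier G" "inversion x r"
  shows "len (x \<otimes> r) < len x"
proof -
  obtain ws where ws: "reduced_word G S x ws" using ex_reduced assms by blast
  then have "odd (nrefl ws r)" using inversion_word[of ws r] assms by (auto simp: reduced_word_def)
  then obtain vs where "vs\<in>lists S" "length vs < length ws" "pw vs = x \<otimes> r"
    using nrefl_delete[of ws r] ws assms by (auto simp: reduced_word_def odd_pos)
  then show ?thesis using len_le[of vs] ws by (auto simp: reduced_word_def)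
qed

lemma len_mult_gen_le: assumes "x \<in> carrier G" "s \<in> S" shows "len (x \<otimes> s) \<le> Suc (len x)"
proof -
  obtain ws where ws: "reduced_word G S x ws" using ex_reduced assms by blast
  then show ?thesis using len_le[of "ws @ [s]"] assms by (auto simp: reduced_word_def pw_append)
qed

text \<open>Exactly one of \<open>x\<close> and \<open>x \<otimes> s\<close> has \<open>s\<close> as
  an inversion, and strong exchange applied to that one shows that it is the longer of the
  two.\<close>

lemma len_mult_gen:
  assumes "x \<in> carrier G" "s \<in> S"
  shows "len (x \<otimes> s) = (if inversion x s then len x - 1 else Suc (len x))"
    and "inversion x s \<Longrightarrow> len x > 0"
proof -
  have 1: "len (x \<otimes> s) = Suc (len x)" if "\<not> inversion x s" "x \<in> carrier G" for x
  proof -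
    have "inversion (x \<otimes> s) s" using that assms inversion_mult_gen by blast
    then have "len (x \<otimes> s \<otimes> s) < len (x \<otimes> s)" using that assms by (intro inversion_len_less) auto
    then show ?thesis using len_mult_gen_le[of x s] that assms by simp
  qed
  have 2: "len x = Suc (len (x \<otimes> s))" if "inversion x s"
    using 1[of "x \<otimes> s"] that assms by (simp add: inversion_mult_gen)
  show "len (x \<otimes> s) = (if inversion x s then len x - 1 else Suc (len x))"
    using 1[OF _ assms(1)] 2 by auto
  show "inversion x s \<Longrightarrow> len x > 0" using 2 by simp
qed

lemma len_one [simp]: "len \<one> = 0"
  using len_le[of "[]"] by simp

lemma ex_descent: assumes "x \<in> carrier G" "x \<noteq> \<one>" shows "\<exists>s\<in>S. inversion x s"
proof (rule ccontr)
  assume no: "\<not> ?thesis"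
  obtain ws where ws: "reduced_word G S x ws" using ex_reduced assms by blast
  then have "ws \<noteq> []" using assms by (auto simp: reduced_word_def)
  then obtain vs s where vs: "ws = vs @ [s]" by (metis rev_exhaust)
  then have "pw vs = x \<otimes> s" "s \<in> S" "vs \<in> lists S" using ws
    by (auto simp: reduced_word_def pw_append)
  then have "len (x \<otimes> s) \<le> length vs" using len_le by metis
  moreover have "len (x \<otimes> s) = Suc (len x)" using no \<open>s \<in> S\<close> assms by (simp add: len_mult_gen)
  ultimately show False using ws vs by (auto simp: reduced_word_def)
qed

section \<open>Cosets of rank two\<close>

definition alt :: "'a \<Rightarrow> 'a \<Rightarrow> nat \<Rightarrow> 'a" where
  "alt s t k = pw (alt_word s t k)"

text \<open>Indices start at 0: the last letter of \<open>alt s t (Suc k)\<close> is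
  \<open>letter s t k\<close>, and by parity \<open>letter s t (Suc k)\<close> is the other
  generator.\<close>

definition letter :: "'a \<Rightarrow> 'a \<Rightarrow> nat \<Rightarrow> 'a" where
  "letter s t k = (if even k then s else t)"

lemma letter_Suc: "letter s t (Suc k) = letter t s k"
  by (simp add: letter_def)

lemma letter_in [simp]: "s \<in> S \<Longrightarrow> t \<in> S \<Longrightarrow> letter s t k \<in> S"
  by (simp add: letter_def)

lemma alt_word_lists [simp]: "s \<in> S \<Longrightarrow> t \<in> S \<Longrightarrow> alt_word s t k \<in> lists S"
  by (auto simp: alt_word_def)

lemma alt_closed [simp]: "s \<in> S \<Longrightarrow> t \<in> S \<Longrightarrow> alt s t k \<in> carrier G"
  unfolding alt_def by (intro pw_closed alt_word_lists)

lemma alt_0 [simp]: "alt s t 0 = \<one>"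
  by (simp add: alt_def alt_word_def)

lemma alt_Suc:
  assumes "s \<in> S" "t \<in> S" shows "alt s t (Suc k) = alt s t k \<otimes> letter s t k"
proof -
  have "alt_word s t (Suc k) = alt_word s t k @ [letter s t k]" by (simp add: alt_word_def letter_def)
  then show ?thesis using assms pw_append[of "alt_word s t k" "[letter s t k]"]
    by (simp add: alt_def del: in_lists_conv_set)
qed

lemma alt_Suc_left: "alt s t (Suc k) = s \<otimes> alt t s k"
proof -
  have "alt_word s t (Suc k) = s # alt_word t s k"
    by (auto simp: alt_word_def map_upt_Suc simp del: upt_Suc)
  then show ?thesis by (simp add: alt_def)
qed

text \<open>The inverse of \<open>alt t s k\<close> is its word read backwards, which continues the
  alternation of \<open>alt s t k\<close> up to length \<open>2 k\<close>.\<close>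

lemma alt_div_alt:
  assumes "s \<in> S" "t \<in> S" shows "alt s t k \<otimes> inv (alt t s k) = (s \<otimes> t) [^] k"
  using assms
proof (induction k arbitrary: s t)
  case (Suc k)
  have "alt s t (Suc k) \<otimes> inv (alt t s (Suc k)) = s \<otimes> (alt t s k \<otimes> inv (alt s t k)) \<otimes> t"
    using Suc.prems by (simp add: alt_Suc_left inv_mult_group m_assoc)
  also have "\<dots> = s \<otimes> (t \<otimes> s) [^] k \<otimes> t" using Suc by simp
  also have "\<dots> = (s \<otimes> t) [^] Suc k"
  proof (induction k)
    case (Suc k)
    have "s \<otimes> (t \<otimes> s) [^] Suc k \<otimes> t = (s \<otimes> t) \<otimes> (s \<otimes> (t \<otimes> s) [^] k \<otimes> t)"
      using \<open>s \<in> S\<close> \<open>t \<in> S\<close> nat_pow_Suc2[of "t \<otimes> s" k] by (simp add: m_assoc del: nat_pow_Suc)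
    also have "\<dots> = (s \<otimes> t) [^] Suc (Suc k)"
      using Suc \<open>s \<in> S\<close> \<open>t \<in> S\<close> nat_pow_Suc2[of "s \<otimes> t" "Suc k"] by simp
    finally show ?case .
  qed (use Suc.prems in auto)
  finally show ?case .
qed auto

lemma braid:
  assumes "s \<in> S" "t \<in> S" "s \<noteq> t" shows "alt s t m = alt t s m"
proof -
  have "alt s t m \<otimes> inv (alt t s m) = \<one>" using assms by (simp add: alt_div_alt pow_m)
  then show ?thesis using assms by (metis alt_closed inv_closed inv_equality inv_inv)
qed

lemma dihedral_elements:
  assumes "s \<in> S" "t \<in> S" "s \<noteq> t"
  shows "generate G {s, t} = {alt s t k |k. k \<le> m} \<union> {alt t s k |k. k \<le> m}" (is "_ = ?A")
proof
  have step: "a \<otimes> v \<in> ?A" if "v \<in> ?A" "a \<in> {s, t}" for a v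
  proof -
    have *: "a \<otimes> alt b c k \<in> ?A" if "k \<le> m" "{b, c} = {s, t}" "a \<in> {b, c}" for b c k
    proof -
      have bc: "b \<in> S" "c \<in> S" "b \<noteq> c" using that assms by (auto simp: doubleton_eq_iff)
      have A: "alt b c j \<in> ?A" "alt c b j \<in> ?A" if "j \<le> m" for j
        using that \<open>{b, c} = {s, t}\<close> by (auto simp: doubleton_eq_iff)
      show ?thesis
      proof (cases "a = b")
        case True
        show ?thesis
        proof (cases k)
          case 0
          then have "a \<otimes> alt b c k = alt b c 1" using True by (simp add: alt_Suc_left)
          then show ?thesis using A[of 1] m_ge_2 by simp
        next
          case (Suc j)
          then have "a \<otimes> alt b c k = alt c b j" using True bc by (simp add: alt_Suc_left)
          then show ?thesis using A[of j] Suc that by simp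
        qed
      next
        case False
        then have ac: "a = c" using that by auto
        then have e: "a \<otimes> alt b c k = alt c b (Suc k)" by (simp add: alt_Suc_left)
        show ?thesis
        proof (cases "k = m")
          \<comment> \<open>An alternating word of full length is rewritten by the braid relation so
            that it starts with the new letter, which then cancels.\<close>
          case True
          obtain j where j: "m = Suc j" using m_ge_2 by (cases m) auto
          have "a \<otimes> alt b c k = c \<otimes> alt c b m" using True ac braid[of b c] bc by simp
          also have "\<dots> = alt b c j" using j bc by (simp add: alt_Suc_left)
          finally show ?thesis using A[of j] j by simp
        next
          case False
          then show ?thesis using e A[of "Suc k"] that by simp
        qed
      qed
    qed
    from that show ?thesis using *[of _ s t] *[of _ t s] by auto
  qed
  show "generate G {s, t} \<subseteq> ?A"
  proof
    fix x assume "x \<in> generate G {s, t}"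
    \<comment> \<open>\<open>generate\<close> builds products in any bracketing, so the induction is
      over left multiplication by \<open>x\<close> preserving the whole set
      \<open>?A\<close>.\<close>
    then have "\<forall>v\<in>?A. x \<otimes> v \<in> ?A \<and> x \<in> carrier G"
    proof (induction rule: generate.induct)
      case one
      have "?A \<subseteq> carrier G" using assms by auto
      then have "\<one> \<otimes> v = v" if "v \<in> ?A" for v using that by (intro l_one) blast
      then show ?case by simp
    next
      case (incl h)
      then have "h \<in> carrier G" using assms by auto
      then show ?case using step[of _ h] incl by blast
    next
      case (inv h)
      then have "inv h \<in> carrier G" "inv h = h" using assms by auto
      then show ?case using step[of _ h] inv by (simp only:) blast
    next
      case (eng h1 h2)
      show ?case
      proof (intro ballI conjI)
        fix v assume v: "v \<in> ?A"
        have "v \<in> carrier G" using v assms by auto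
        moreover have h: "h1 \<in> carrier G" "h2 \<in> carrier G" using eng v by blast+
        ultimately have "h1 \<otimes> h2 \<otimes> v = h1 \<otimes> (h2 \<otimes> v)" by (simp add: m_assoc)
        moreover have "h2 \<otimes> v \<in> ?A" using bspec[OF eng.IH(2) v] by (rule conjunct1)
        ultimately show "h1 \<otimes> h2 \<otimes> v \<in> ?A" using bspec[OF eng.IH(1)] by simp
        show "h1 \<otimes> h2 \<in> carrier G" using h by simp
      qed
    qed
    moreover have "\<one> \<in> ?A"
    proof (intro UnI1 CollectI exI conjI)
      show "\<one> = alt s t 0" "0 \<le> m" by auto
    qed
    ultimately have *: "x \<otimes> \<one> \<in> ?A \<and> x \<in> carrier G" by (rule bspec)
    have "x \<otimes> \<one> = x" using conjunct2[OF *] by simp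
    then show "x \<in> ?A" using conjunct1[OF *] by simp
  qed
  have "alt a b k \<in> generate G {s, t}" if "{a, b} = {s, t}" for a b k
    using that
  proof (induction k arbitrary: a b)
    case (Suc k)
    then have "alt b a k \<in> generate G {s, t}" "a \<in> generate G {s, t}"
      by (auto intro: generate.incl)
    then show ?case by (simp add: alt_Suc_left generate.eng)
  qed (auto intro: generate.one)
  then show "?A \<subseteq> generate G {s, t}" by auto
qed

text \<open>This is the reflection attached to the first letter of an alternating word, written as a
  palindrome around the last letter. The last letter is common to all suffixes, so the reflections
  of the whole word become comparable.\<close>

lemma alt_reflection:
  assumes "s \<in> S" "t \<in> S"
  shows "inv (alt t s k) \<otimes> alt s t (Suc k) =
    letter s t k \<otimes> (letter s t (Suc k) \<otimes> letter s t k) [^] k"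
proof (induction k)
  case 0
  then show ?case using assms by (simp add: alt_Suc letter_def)
next
  case (Suc k)
  let ?l = "letter s t k" and ?o = "letter s t (Suc k)"
  have [simp]: "?l \<in> S" "?o \<in> S" using assms by auto
  have e: "letter t s k = ?o" "letter s t (Suc (Suc k)) = ?l" by (auto simp: letter_def)
  have "inv (alt t s (Suc k)) \<otimes> alt s t (Suc (Suc k)) = ?o \<otimes> (inv (alt t s k) \<otimes> alt s t (Suc k)) \<otimes> ?o"
    using assms by (simp add: alt_Suc[of t s k] alt_Suc[of s t "Suc k"] e inv_mult_group m_assoc)
  also have "\<dots> = ?o \<otimes> (?l \<otimes> (?o \<otimes> ?l) [^] k) \<otimes> ?o" using Suc by simp
  also have "\<dots> = ((?o \<otimes> ?l) \<otimes> (?o \<otimes> ?l) [^] k) \<otimes> ?o" by (simp add: m_assoc)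
  also have "(?o \<otimes> ?l) \<otimes> (?o \<otimes> ?l) [^] k = (?o \<otimes> ?l) [^] Suc k"
    by (rule nat_pow_Suc2[symmetric]) simp
  also have "(?o \<otimes> ?l) [^] Suc k = inv ((?l \<otimes> ?o) [^] Suc k)"
  proof -
    have "?o \<otimes> ?l = inv (?l \<otimes> ?o)" by (simp add: inv_mult_group)
    then show ?thesis by (simp only:) (rule nat_pow_inv, simp)
  qed
  also have "inv ((?l \<otimes> ?o) [^] Suc k) \<otimes> ?o = ?o \<otimes> (?l \<otimes> ?o) [^] Suc k" by (rule pow_flip) auto
  finally show ?case by (simp add: e)
qed

lemma nrefl_alt:
  assumes "s \<in> S" "t \<in> S"
  shows "nrefl (alt_word s t k) r =
    (\<Sum>i<k. of_bool (r = letter s t (Suc k) \<otimes> (letter s t k \<otimes> letter s t (Suc k)) [^] i))"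
  using assms
proof (induction k arbitrary: s t)
  case (Suc k)
  have w: "alt_word s t (Suc k) = s # alt_word t s k"
    by (auto simp: alt_word_def map_upt_Suc simp del: upt_Suc)
  have "inv (alt t s k) \<otimes> s \<otimes> alt t s k = inv (alt t s k) \<otimes> alt s t (Suc k)"
    using Suc.prems by (simp add: alt_Suc_left m_assoc)
  then show ?case using Suc.IH[of t s] Suc.prems alt_reflection[of s t k]
    by (simp add: w alt_def[symmetric] letter_Suc)
qed (auto simp: alt_word_def)

lemma pow_eq_one_iff:
  assumes "s \<in> S" "t \<in> S" "s \<noteq> t" "k \<le> m"
  shows "(s \<otimes> t) [^] k = \<one> \<longleftrightarrow> k = 0 \<or> k = m"
  using pow_neq_one[of s t k] pow_m[of s t] assms by (cases "k = 0"; cases "k = m") auto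

text \<open>With \<open>l\<close> the last letter and \<open>r\<close> the other one, the
  reflections of the word are \<open>l \<otimes> (r \<otimes> l) [^] i\<close> for
  \<open>i \<le> k\<close>. By the order of \<open>r \<otimes> l\<close>, the generator
  \<open>l\<close> occurs only for \<open>i = 0\<close>, and \<open>r\<close> only for
  \<open>Suc i = m\<close>.\<close>

lemma inversion_alt:
  assumes "s \<in> S" "t \<in> S" "s \<noteq> t" "Suc k \<le> m"
  shows "inversion (alt s t (Suc k)) (letter s t k)"
    and "inversion (alt s t (Suc k)) (letter s t (Suc k)) \<longleftrightarrow> Suc k = m"
proof -
  define l where "l = letter s t k"
  define r where "r = letter s t (Suc k)"
  have lr: "l \<in> S" "r \<in> S" "r \<noteq> l" using assms by (auto simp: l_def r_def letter_def)
  have e: "letter s t (Suc (Suc k)) = l" by (simp add: l_def letter_def)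
  have i: "inversion (alt s t (Suc k)) x \<longleftrightarrow> odd (\<Sum>i<Suc k. of_bool (x = l \<otimes> (r \<otimes> l) [^] i) :: nat)"
    if "x \<in> S" for x
    using inversion_word[of "alt_word s t (Suc k)" x] nrefl_alt[of s t "Suc k" x] assms that
      alt_word_lists[of s t "Suc k"]
    unfolding alt_def[symmetric] e r_def[symmetric] by simp
  have "(l = l \<otimes> (r \<otimes> l) [^] i) \<longleftrightarrow> i = 0" if "i < Suc k" for i
    using pow_eq_one_iff[of r l i] that lr assms by auto
  then have "(\<Sum>i<Suc k. of_bool (l = l \<otimes> (r \<otimes> l) [^] i) :: nat) = (\<Sum>i<Suc k. of_bool (i = 0))"
    by (intro sum.cong) auto
  also have "\<dots> = 1" by (simp add: sum.lessThan_Suc_shift)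
  finally have odd1: "odd (\<Sum>i<Suc k. of_bool (l = l \<otimes> (r \<otimes> l) [^] i) :: nat)" by presburger
  show "inversion (alt s t (Suc k)) (letter s t k)"
    unfolding l_def[symmetric] i[OF lr(1)] by (rule odd1)
  have "(r = l \<otimes> (r \<otimes> l) [^] i) \<longleftrightarrow> Suc i = m" if "i < Suc k" for i
  proof -
    have "r = l \<otimes> (r \<otimes> l) [^] i" if "\<one> = r \<otimes> (l \<otimes> (r \<otimes> l) [^] i)"
    proof -
      have "r = r \<otimes> (r \<otimes> (l \<otimes> (r \<otimes> l) [^] i))" using lr by (subst that[symmetric]) simp
      then show ?thesis using lr by simp
    qed
    then have "(r = l \<otimes> (r \<otimes> l) [^] i) \<longleftrightarrow> \<one> = r \<otimes> (l \<otimes> (r \<otimes> l) [^] i)"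
      using lr invol[of r] by metis
    then have "(r = l \<otimes> (r \<otimes> l) [^] i) \<longleftrightarrow> (r \<otimes> l) [^] Suc i = \<one>"
      using lr nat_pow_Suc2[of "r \<otimes> l" i] m_assoc[of r l "(r \<otimes> l) [^] i"] eq_commute[of \<one>]
      by (simp del: nat_pow_Suc)
    then show ?thesis using pow_eq_one_iff[of r l "Suc i"] that lr assms by auto
  qed
  then have "(\<Sum>i<Suc k. of_bool (r = l \<otimes> (r \<otimes> l) [^] i) :: nat) = (\<Sum>i<Suc k. of_bool (Suc i = m))"
    by (intro sum.cong) auto
  also have "\<dots> = (if Suc k = m then 1 else 0)"
    using assms by auto
  finally have "odd (\<Sum>i<Suc k. of_bool (r = l \<otimes> (r \<otimes> l) [^] i) :: nat) \<longleftrightarrow> Suc k = m" by presburger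
  then show "inversion (alt s t (Suc k)) (letter s t (Suc k)) \<longleftrightarrow> Suc k = m"
    unfolding r_def[symmetric] i[OF lr(2)] .
qed

text \<open>\<open>u\<close> is the shortest element of its coset modulo \<open>\<langle>s, t\<rangle>\<close>.\<close>
definition min_rep :: "'a \<Rightarrow> 'a \<Rightarrow> 'a \<Rightarrow> bool" where
  "min_rep s t u \<longleftrightarrow> u \<in> carrier G \<and> (\<forall>v\<in>generate G {s, t}. \<forall>r\<in>{s, t}. inversion (u \<otimes> v) r = inversion v r)"

lemma dihedral_subset: "s \<in> S \<Longrightarrow> t \<in> S \<Longrightarrow> generate G {s, t} \<subseteq> carrier G"
  by (intro generate_incl) auto

lemma alt_in_dihedral: 
  "s \<in> S \<Longrightarrow> t \<in> S \<Longrightarrow> s \<noteq> t \<Longrightarrow> k \<le> m \<Longrightarrow> alt s t k \<in> generate G {s, t} \<and> alt t s k \<in> generate G {s, t}"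
  using dihedral_elements by blast

lemma min_rep_sym: "min_rep s t u \<longleftrightarrow> min_rep t s u"
  by (auto simp: min_rep_def insert_commute)

lemma min_rep_cong: "{a, b} = {s, t} \<Longrightarrow> min_rep s t u \<Longrightarrow> min_rep a b u"
  by (simp add: min_rep_def)

lemma pair_mem: "{a, b} = {s, t} \<Longrightarrow> s \<in> S \<Longrightarrow> t \<in> S \<Longrightarrow> s \<noteq> t \<Longrightarrow> a \<in> S \<and> b \<in> S \<and> a \<noteq> b"
  by (metis doubleton_eq_iff)

text \<open>Take a shortest element of the coset. A deviation from the inversions of the dihedral
  factor \<open>w\<close> would make the conjugate of \<open>r\<close> by \<open>w\<close> an
  inversion of it, and strong exchange would give a shorter element of the same coset.\<close>

lemma ex_min_rep:
  assumes "s \<in> S" "t \<in> S" "x \<in> carrier G"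
  shows "\<exists>u v. min_rep s t u \<and> v \<in> generate G {s, t} \<and> x = u \<otimes> v"
proof -
  let ?H = "generate G {s, t}"
  have H: "subgroup ?H G" using assms by (intro generate_is_subgroup) auto
  obtain v where v: "v \<in> ?H" "\<forall>w\<in>?H. len (x \<otimes> v) \<le> len (x \<otimes> w)"
    using ex_has_least_nat[of "\<lambda>v. v \<in> ?H" \<one> "\<lambda>v. len (x \<otimes> v)"] generate.one by blast
  let ?u = "x \<otimes> v"
  have vc: "v \<in> carrier G" using v dihedral_subset assms by blast
  have "inversion (?u \<otimes> w) r = inversion w r" if w: "w \<in> ?H" and r: "r \<in> {s, t}" for w r
  proof -
    have wc: "w \<in> carrier G" using w dihedral_subset assms by blast
    have rS: "r \<in> S" using r assms by auto
    have "r \<in> ?H" using r generate.incl by metis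
    then have rH: "w \<otimes> r \<otimes> inv w \<in> ?H" using w subgroup.m_inv_closed[OF H w] by (intro generate.eng)
    have "\<not> inversion ?u (w \<otimes> r \<otimes> inv w)"
    proof
      assume "inversion ?u (w \<otimes> r \<otimes> inv w)"
      then have "len (?u \<otimes> (w \<otimes> r \<otimes> inv w)) < len ?u"
        using assms vc wc rS by (intro inversion_len_less) auto
      moreover have "?u \<otimes> (w \<otimes> r \<otimes> inv w) = x \<otimes> (v \<otimes> (w \<otimes> r \<otimes> inv w))"
        using assms vc wc rS by (simp add: m_assoc)
      moreover have "v \<otimes> (w \<otimes> r \<otimes> inv w) \<in> ?H" by (rule generate.eng[OF v(1) rH])
      ultimately show False using v(2) by (simp add: linorder_not_le[symmetric])
    qed
    then show ?thesis using inversion_mult[of ?u w r] assms vc wc rS by simp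
  qed
  then have "min_rep s t ?u" using assms vc by (auto simp: min_rep_def)
  moreover have "inv v \<in> ?H" using H v by (simp add: subgroup.m_inv_closed)
  moreover have "x = ?u \<otimes> inv v" using assms vc by (simp add: m_assoc)
  ultimately show ?thesis by blast
qed

lemma min_rep_cases:
  assumes "s \<in> S" "t \<in> S" "s \<noteq> t" "x \<in> carrier G"
  obtains u a b k where "min_rep s t u" "{a, b} = {s, t}" "k \<le> m" "x = u \<otimes> alt a b k"
  using ex_min_rep[OF assms(1,2,4)] dihedral_elements[OF assms(1-3)] by auto

context
  fixes s t u
  assumes st: "s \<in> S" "t \<in> S" "s \<noteq> t" and u: "min_rep s t u"
begin

lemma min_rep_carrier: "u \<in> carrier G"
  using u by (simp add: min_rep_def)

lemma min_rep_inversion: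
  "k \<le> m \<Longrightarrow> r \<in> {s, t} \<Longrightarrow> inversion (u \<otimes> alt s t k) r = inversion (alt s t k) r"
  using u alt_in_dihedral[OF st] by (auto simp: min_rep_def)

lemma min_rep_not_inversion: "\<not> inversion u s" "\<not> inversion u t"
  using min_rep_inversion[of 0 s] min_rep_inversion[of 0 t] min_rep_carrier st by auto

lemma min_rep_last:
  assumes "Suc k \<le> m"
  shows "inversion (u \<otimes> alt s t (Suc k)) (letter s t k)"
    and "inversion (u \<otimes> alt s t (Suc k)) (letter s t (Suc k)) \<longleftrightarrow> Suc k = m"
  using inversion_alt[OF st assms] min_rep_inversion[OF assms] by (auto simp: letter_def)

lemma min_rep_len: "k \<le> m \<Longrightarrow> len (u \<otimes> alt s t k) = len u + k"
proof (induction k)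
  case 0
  then show ?case using min_rep_carrier by simp
next
  case (Suc k)
  have "\<not> inversion (u \<otimes> alt s t k) (letter s t k)"
  proof (cases k)
    case 0
    then show ?thesis using min_rep_carrier min_rep_not_inversion by (simp add: letter_def)
  next
    case (Suc j)
    then show ?thesis using min_rep_last(2)[of j] \<open>Suc k \<le> m\<close> by simp
  qed
  moreover have "u \<otimes> alt s t (Suc k) = u \<otimes> alt s t k \<otimes> letter s t k"
    using st min_rep_carrier by (simp add: alt_Suc m_assoc)
  ultimately show ?case using Suc st min_rep_carrier by (simp add: len_mult_gen)
qed

end

lemma min_repI:
  assumes "s \<in> S" "t \<in> S" "s \<noteq> t" "x \<in> carrier G" "\<not> inversion x s" "\<not> inversion x t"
  shows "min_rep s t x"
proof -
  obtain u a b k where *: "min_rep s t u" "{a, b} = {s, t}" "k \<le> m" "x = u \<otimes> alt a b k"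
    using min_rep_cases[OF assms(1-4)] by metis
  then have ab: "a \<in> S" "b \<in> S" "a \<noteq> b" "min_rep a b u"
    using pair_mem[OF *(2) assms(1-3)] min_rep_cong[OF *(2,1)] by auto
  have "k = 0"
  proof (cases k)
    case (Suc j)
    then have "inversion x (letter a b j)" using min_rep_last[OF ab, of j] * by auto
    moreover have "letter a b j \<in> {s, t}" using *(2) by (auto simp: letter_def)
    ultimately show ?thesis using assms by auto
  qed auto
  then show ?thesis using * min_rep_carrier[OF ab] by simp
qed

text \<open>Two descents force the dihedral factor of \<open>x\<close> to be its longest element. By
  \<open>braid\<close> this has an alternating word ending in \<open>s\<close>, so the letters
  \<open>s\<close>, \<open>t\<close>, \<open>s\<close> can be peeled off one after another.\<close>

lemma descent_pair:
  assumes "s \<in> S" "t \<in> S" "s \<noteq> t" "x \<in> carrier G" "inversion x s" "inversion x t"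
  shows "inversion (x \<otimes> s) t" and "m \<ge> 3 \<Longrightarrow> inversion (x \<otimes> s \<otimes> t) s"
proof -
  obtain u a0 b0 k where *: "min_rep s t u" "{a0, b0} = {s, t}" "k \<le> m" "x = u \<otimes> alt a0 b0 k"
    using min_rep_cases[OF assms(1-4)] by metis
  have ab0: "a0 \<in> S" "b0 \<in> S" "a0 \<noteq> b0" "min_rep a0 b0 u"
    using pair_mem[OF *(2) assms(1-3)] min_rep_cong[OF *(2,1)] by auto
  have "k = m"
  proof (cases k)
    case 0
    then show ?thesis using * min_rep_not_inversion[OF assms(1-3) *(1)] assms min_rep_carrier[OF ab0] by auto
  next
    case (Suc j)
    have "letter a0 b0 (Suc j) \<in> {s, t}" using *(2) by (auto simp: letter_def)
    then show ?thesis using min_rep_last(2)[OF ab0, of j] * assms Suc by auto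
  qed
  then have "x = u \<otimes> alt s t m" using * braid[OF assms(1-3)] by (auto simp: doubleton_eq_iff)
  moreover obtain j where j: "m = Suc (Suc j)" using m_ge_2 by (metis add_2_eq_Suc le_Suc_ex)
  ultimately obtain a b where ab: "{a, b} = {s, t}" "x = u \<otimes> alt a b m" "letter a b (Suc j) = s"
    using braid[OF assms(1-3)] by (cases "even j") (auto simp: letter_def insert_commute)
  have abS: "a \<in> S" "b \<in> S" "a \<noteq> b" "min_rep a b u"
    using pair_mem[OF ab(1) assms(1-3)] min_rep_cong[OF ab(1) *(1)] by auto
  have l: "letter a b j = t" using ab by (auto simp: letter_def doubleton_eq_iff split: if_splits)
  have uc: "u \<in> carrier G" using min_rep_carrier[OF abS] .
  have 1: "x \<otimes> s = u \<otimes> alt a b (Suc j)"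
    using ab abS uc assms alt_Suc[of a b "Suc j"] by (simp add: j m_assoc)
  then show "inversion (x \<otimes> s) t" using min_rep_last(1)[OF abS, of j] l j by simp
  assume "m \<ge> 3"
  then obtain i where i: "j = Suc i" using j by (cases j) auto
  have "x \<otimes> s \<otimes> t = u \<otimes> alt a b j"
    using 1 l abS uc assms alt_Suc[of a b j] by (simp add: m_assoc)
  moreover have "letter a b i = s" using ab i by (simp add: letter_def)
  ultimately show "inversion (x \<otimes> s \<otimes> t) s" using min_rep_last(1)[OF abS, of i] i j by simp
qed

text \<open>By the previous lemma, the configuration assumed here reproduces itself one step further down.\<close>
lemma no_descent_triple:
  assumes "m \<ge> 3" "r \<in> S" "s \<in> S" "t \<in> S" "r \<noteq> s" "s \<noteq> t" "r \<noteq> t" "x \<in> carrier G"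
    "inversion x s" "inversion x t" "inversion (x \<otimes> s) r"
  shows False
  using assms
proof (induction "len x" arbitrary: x r s t rule: less_induct)
  case less
  have 1: "inversion (x \<otimes> s) t" "inversion (x \<otimes> s \<otimes> t) s"
    using descent_pair[of s t x] less.prems by auto
  have 2: "len (x \<otimes> s) < len x" using len_mult_gen[of x s] less.prems by simp
  show False using less.hyps[OF 2, of s t r] less.prems 1 by auto
qed

text \<open>A third generator cannot be a descent by \<open>no_descent_triple\<close>: once the last
  letter is removed, the other letter of the pair is a descent. This needs two letters, and the top
  vertex has two descents, whence \<open>2 \<le> k < m\<close>.\<close>

lemma unique_descent:
  assumes "m \<ge> 3" "s \<in> S" "t \<in> S" "s \<noteq> t" "min_rep s t u" "2 \<le> k" "k < m" "r \<in> S"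
  shows "inversion (u \<otimes> alt s t k) r \<longleftrightarrow> r = letter s t (k - 1)"
proof -
  obtain j where j: "k = Suc (Suc j)" using assms by (metis add_2_eq_Suc le_Suc_ex)
  let ?l = "letter s t (Suc j)" and ?o = "letter s t j"
  have uc: "u \<in> carrier G" using min_rep_carrier[OF assms(2-5)] .
  have lS: "?l \<in> S" "?o \<in> S" "?l \<noteq> ?o" using assms by (auto simp: letter_def)
  have 1: "inversion (u \<otimes> alt s t k) ?l" using min_rep_last(1)[OF assms(2-5), of "Suc j"] j assms by simp
  have 2: "\<not> inversion (u \<otimes> alt s t k) ?o"
    using min_rep_last(2)[OF assms(2-5), of "Suc j"] j assms by (simp add: letter_def)
  have "u \<otimes> alt s t k \<otimes> ?l = u \<otimes> alt s t (Suc j)"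
    using j uc assms lS alt_Suc[of s t "Suc j"] by (simp add: m_assoc)
  then have 3: "inversion (u \<otimes> alt s t k \<otimes> ?l) ?o" using min_rep_last(1)[OF assms(2-5), of j] j assms by simp
  show ?thesis
  proof (cases "r = ?l \<or> r = ?o")
    case True
    then show ?thesis using 1 2 lS j by auto
  next
    case False
    then have "\<not> inversion (u \<otimes> alt s t k) r"
      using no_descent_triple[of ?o ?l r "u \<otimes> alt s t k"] assms(1-4,8) lS uc 1 3 by auto
    then show ?thesis using False j by auto
  qed
qed

end

section \<open>Circulations and the energy estimate\<close>

lemma summable_on_finite_sum:
  fixes f :: "'i \<Rightarrow> 'c \<Rightarrow> real"
  assumes "finite I" "\<And>i. i \<in> I \<Longrightarrow> f i summable_on A"
  shows "(\<lambda>x. \<Sum>i\<in>I. f i x) summable_on A"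
  using assms by (induction I rule: finite_induct) (auto intro!: summable_on_add)

lemma const_summable_imp_zero:
  fixes c :: real
  assumes "(\<lambda>x. c) summable_on A" "infinite A" "c \<ge> 0" shows "c = 0"
proof (rule ccontr)
  assume "c \<noteq> 0"
  then obtain k where k: "infsum (\<lambda>x. c) A < real k * c"
    using assms(3) reals_Archimedean3[of c] by auto
  obtain F where F: "F \<subseteq> A" "finite F" "card F = k"
    using infinite_arbitrarily_large[OF assms(2)] by blast
  have "sum (\<lambda>x. c) F \<le> infsum (\<lambda>x. c) A"
    using assms F by (intro finite_sum_le_infsum) auto
  then show False using k F by simp
qed

text \<open>Compare \<open>N a\<close> with the gradient \<open>b r - b s\<close> of its row sums:
  the sum of the squared differences is nonnegative, and it expands to the claim because the row
  sums of an antisymmetric matrix add up to 0.\<close>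

lemma antisymmetric_energy:
  fixes a :: "'c \<Rightarrow> 'c \<Rightarrow> real"
  assumes "finite A" and anti: "\<And>r s. r \<in> A \<Longrightarrow> s \<in> A \<Longrightarrow> a r s = - a s r"
  shows "2 * (\<Sum>r\<in>A. (\<Sum>s\<in>A. a r s)\<^sup>2) \<le> card A * (\<Sum>r\<in>A. \<Sum>s\<in>A. (a r s)\<^sup>2)"
proof (cases "A = {}")
  case False
  define N where "N = real (card A)"
  have N: "N > 0" using False assms by (simp add: N_def card_gt_0_iff)
  define b where "b = (\<lambda>r. \<Sum>s\<in>A. a r s)"
  have b0: "(\<Sum>r\<in>A. b r) = 0"
  proof -
    have "(\<Sum>r\<in>A. b r) = (\<Sum>r\<in>A. \<Sum>s\<in>A. - a s r)"
      unfolding b_def by (intro sum.cong refl anti)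
    also have "\<dots> = - (\<Sum>s\<in>A. \<Sum>r\<in>A. a s r)" by (subst sum.swap) (simp add: sum_negf)
    also have "\<dots> = - (\<Sum>r\<in>A. b r)" by (simp add: b_def)
    finally show ?thesis by simp
  qed
  have ab1: "(\<Sum>r\<in>A. \<Sum>s\<in>A. a r s * b r) = (\<Sum>r\<in>A. (b r)\<^sup>2)"
    by (simp add: sum_distrib_right[symmetric] b_def power2_eq_square)
  have ab2: "(\<Sum>r\<in>A. \<Sum>s\<in>A. a r s * b s) = - (\<Sum>r\<in>A. (b r)\<^sup>2)"
  proof -
    have "(\<Sum>r\<in>A. \<Sum>s\<in>A. a r s * b s) = (\<Sum>s\<in>A. \<Sum>r\<in>A. - (a s r * b s))"
    proof (subst sum.swap, intro sum.cong refl)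
      fix s r assume "s \<in> A" "r \<in> A"
      then show "a r s * b s = - (a s r * b s)" by (subst anti) auto
    qed
    then show ?thesis using ab1 by (simp add: sum_negf)
  qed
  have bb: "(\<Sum>r\<in>A. \<Sum>s\<in>A. (b r - b s)\<^sup>2) = 2 * N * (\<Sum>r\<in>A. (b r)\<^sup>2)"
  proof -
    have "(\<Sum>r\<in>A. \<Sum>s\<in>A. (b r - b s)\<^sup>2) =
        (\<Sum>r\<in>A. N * (b r)\<^sup>2 + (\<Sum>s\<in>A. (b s)\<^sup>2) - 2 * b r * (\<Sum>s\<in>A. b s))"
      by (simp add: power2_diff sum.distrib sum_subtractf N_def sum_distrib_left mult.assoc)
    then show ?thesis using b0 by (simp add: sum.distrib sum_distrib_left[symmetric] N_def)
  qed
  have "0 \<le> (\<Sum>r\<in>A. \<Sum>s\<in>A. (N * a r s - (b r - b s))\<^sup>2)" by (intro sum_nonneg) auto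
  also have "\<dots> = (\<Sum>r\<in>A. \<Sum>s\<in>A. N\<^sup>2 * (a r s)\<^sup>2 - 2 * N * (a r s * b r) + 2 * N * (a r s * b s) + (b r - b s)\<^sup>2)"
    by (intro sum.cong refl) (simp add: power2_eq_square algebra_simps)
  also have "\<dots> = N\<^sup>2 * (\<Sum>r\<in>A. \<Sum>s\<in>A. (a r s)\<^sup>2) - 2 * N * (\<Sum>r\<in>A. \<Sum>s\<in>A. a r s * b r)
      + 2 * N * (\<Sum>r\<in>A. \<Sum>s\<in>A. a r s * b s) + (\<Sum>r\<in>A. \<Sum>s\<in>A. (b r - b s)\<^sup>2)"
    by (simp add: sum.distrib sum_subtractf sum_distrib_left)
  also have "\<dots> = N * (N * (\<Sum>r\<in>A. \<Sum>s\<in>A. (a r s)\<^sup>2) - 2 * (\<Sum>r\<in>A. (b r)\<^sup>2))"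
    unfolding ab1 ab2 bb by (simp add: power2_eq_square algebra_simps)
  finally have "0 \<le> N * (\<Sum>r\<in>A. \<Sum>s\<in>A. (a r s)\<^sup>2) - 2 * (\<Sum>r\<in>A. (b r)\<^sup>2)"
    using N by (simp add: zero_le_mult_iff)
  then show ?thesis by (simp add: N_def b_def)
qed auto

context uniform_coxeter
begin

text \<open>A circulation records the coefficients of a 2-cycle: \<open>B x s t\<close> belongs to the 2-cell
  \<open>x\<langle>s, t\<rangle>\<close>, with the sign normalised so that it does not change along the coset.\<close>
definition l2_circulation :: "('a \<Rightarrow> 'a \<Rightarrow> 'a \<Rightarrow> real) \<Rightarrow> bool" where
  "l2_circulation B \<longleftrightarrow>
     (\<forall>x\<in>carrier G. \<forall>s\<in>S. \<forall>t\<in>S. B x s t = - B x t s) \<and>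
     (\<forall>x\<in>carrier G. \<forall>s\<in>S. \<forall>t\<in>S. s \<noteq> t \<longrightarrow> B (x \<otimes> s) s t = B x s t) \<and>
     (\<forall>x\<in>carrier G. \<forall>s\<in>S. (\<Sum>t\<in>S. B x s t) = 0) \<and>
     (\<forall>s\<in>S. \<forall>t\<in>S. (\<lambda>x. (B x s t)\<^sup>2) summable_on carrier G)"

lemma
  assumes "l2_circulation B"
  shows circ_anti: "x \<in> carrier G \<Longrightarrow> s \<in> S \<Longrightarrow> t \<in> S \<Longrightarrow> B x s t = - B x t s"
    and circ_inv: "x \<in> carrier G \<Longrightarrow> s \<in> S \<Longrightarrow> t \<in> S \<Longrightarrow> s \<noteq> t \<Longrightarrow> B (x \<otimes> s) s t = B x s t"
    and circ_row: "x \<in> carrier G \<Longrightarrow> s \<in> S \<Longrightarrow> (\<Sum>t\<in>S. B x s t) = 0"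
    and circ_summable: "s \<in> S \<Longrightarrow> t \<in> S \<Longrightarrow> (\<lambda>x. (B x s t)\<^sup>2) summable_on carrier G"
proof -
  note conj = assms[unfolded l2_circulation_def]
  show "x \<in> carrier G \<Longrightarrow> s \<in> S \<Longrightarrow> t \<in> S \<Longrightarrow> B x s t = - B x t s"
    by (rule conj[THEN conjunct1, rule_format])
  show "x \<in> carrier G \<Longrightarrow> s \<in> S \<Longrightarrow> t \<in> S \<Longrightarrow> s \<noteq> t \<Longrightarrow> B (x \<otimes> s) s t = B x s t"
    by (rule conj[THEN conjunct2, THEN conjunct1, rule_format])
  show "x \<in> carrier G \<Longrightarrow> s \<in> S \<Longrightarrow> (\<Sum>t\<in>S. B x s t) = 0"
    by (rule conj[THEN conjunct2, THEN conjunct2, THEN conjunct1, rule_format])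
  show "s \<in> S \<Longrightarrow> t \<in> S \<Longrightarrow> (\<lambda>x. (B x s t)\<^sup>2) summable_on carrier G"
    by (rule conj[THEN conjunct2, THEN conjunct2, THEN conjunct2, rule_format])
qed

text \<open>Reduces vanishing everywhere to vanishing at the identity; the weights are not invariant
  under this translation.\<close>

lemma l2_circulation_translate:
  assumes "l2_circulation B" "g \<in> carrier G"
  shows "l2_circulation (\<lambda>x. B (g \<otimes> x))"
proof -
  have bij: "bij_betw (\<lambda>x. g \<otimes> x) (carrier G) (carrier G)"
    using assms by (intro bij_betwI[of _ _ _ "\<lambda>x. inv g \<otimes> x"]) auto
  show ?thesis unfolding l2_circulation_def
  proof (intro conjI ballI impI)
    fix x s t assume x: "x \<in> carrier G" and st: "s \<in> S" "t \<in> S"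
    show "B (g \<otimes> x) s t = - B (g \<otimes> x) t s"
      using circ_anti[OF assms(1) _ st] x assms(2) by simp
    show "B (g \<otimes> (x \<otimes> s)) s t = B (g \<otimes> x) s t" if "s \<noteq> t"
      using circ_inv[OF assms(1) _ st that, of "g \<otimes> x"] x assms(2) st by (simp add: m_assoc)
  next
    fix x s assume "x \<in> carrier G" "s \<in> S"
    then show "(\<Sum>t\<in>S. B (g \<otimes> x) s t) = 0" using circ_row[OF assms(1)] assms(2) by simp
  next
    fix s t assume "s \<in> S" "t \<in> S"
    then show "(\<lambda>x. (B (g \<otimes> x) s t)\<^sup>2) summable_on carrier G"
      using summable_on_reindex_bij_betw[OF bij, of "\<lambda>x. (B x s t)\<^sup>2"] circ_summable[OF assms(1)] by simp
  qed
qed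

context
  fixes B
  assumes B: "l2_circulation B"
begin

lemma circ_diag: "x \<in> carrier G \<Longrightarrow> s \<in> S \<Longrightarrow> B x s s = 0"
  using circ_anti[OF B, of x s s] by simp

lemma circ_step: "x \<in> carrier G \<Longrightarrow> s \<in> S \<Longrightarrow> t \<in> S \<Longrightarrow> r \<in> {s, t} \<Longrightarrow> B (x \<otimes> r) s t = B x s t"
proof -
  assume *: "x \<in> carrier G" "s \<in> S" "t \<in> S" "r \<in> {s, t}"
  have "s \<noteq> t \<longrightarrow> B (x \<otimes> s) s t = B x s t \<and> B (x \<otimes> t) t s = B x t s"
    using circ_inv[OF B] * by auto
  then show ?thesis
    using * circ_anti[OF B, of x s t] circ_anti[OF B, of "x \<otimes> t" s t] circ_diag[of x s] circ_diag[of "x \<otimes> s" s]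
    by (cases "s = t") auto
qed

lemma circ_alt:
  assumes "x \<in> carrier G" "s \<in> S" "t \<in> S" "a \<in> {s, t}" "b \<in> {s, t}"
  shows "B (x \<otimes> alt a b k) s t = B x s t"
proof (induction k)
  case (Suc k)
  have ab: "a \<in> S" "b \<in> S" using assms by auto
  have "x \<otimes> alt a b (Suc k) = x \<otimes> alt a b k \<otimes> letter a b k" using ab assms by (simp add: alt_Suc m_assoc)
  moreover have "letter a b k \<in> {s, t}" using assms by (simp add: letter_def)
  ultimately show ?case using circ_step[of "x \<otimes> alt a b k" s t "letter a b k"] Suc assms ab by simp
qed (use assms in auto)

lemma circulation_zero_rank3:
  assumes S3: "S = {a, b, c}" "a \<noteq> b" "b \<noteq> c" "a \<noteq> c" and inf: "infinite (carrier G)"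
  shows "B \<one> a b = 0"
proof -
  have eq: "B x a b = B x b c" "B x b c = B x c a" if "x \<in> carrier G" for x
    using circ_row[OF B, of x a] circ_row[OF B, of x b] circ_row[OF B, of x c] S3 that
      circ_anti[OF B, of x a b] circ_anti[OF B, of x b c] circ_anti[OF B, of x a c] circ_diag[of x a] circ_diag[of x b] circ_diag[of x c]
    by auto
  \<comment> \<open>For \<open>s = c\<close> the cell of type \<open>{a, b}\<close> is left, but the
    cell of type \<open>{b, c}\<close> carries the same number and is not.\<close>
  have step: "B (x \<otimes> s) a b = B x a b" if "x \<in> carrier G" "s \<in> S" for x s
    using that circ_step[of x a b s] circ_step[of x b c s] eq[of x] eq[of "x \<otimes> s"] S3 by auto
  have const_word: "B (pw (rev ws)) a b = B \<one> a b" if "ws \<in> lists S" for ws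
    using that
  proof (induction ws rule: list.induct)
    case (Cons s ws)
    then show ?case using step[of "pw (rev ws)" s] pw_append[of "rev ws" "[s]"] by simp
  qed auto
  have const: "B x a b = B \<one> a b" if x: "x \<in> carrier G" for x
  proof -
    have "\<exists>ws\<in>lists S. pw ws = x" using x by (rule ex_word)
    then obtain ws where ws: "ws \<in> lists S" "pw ws = x" by (elim bexE)
    have "B (pw (rev (rev ws))) a b = B \<one> a b" using ws(1) by (intro const_word) simp
    then show ?thesis using ws(2) by (simp only: rev_rev_ident)
  qed
  have "(\<lambda>x. (B x a b)\<^sup>2) summable_on carrier G" using circ_summable[OF B] S3 by auto
  also have "?this \<longleftrightarrow> (\<lambda>x. (B \<one> a b)\<^sup>2) summable_on carrier G"
    by (intro summable_on_cong arg_cong[where f = "\<lambda>y. y\<^sup>2"] const)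
  finally have "(\<lambda>x. (B \<one> a b)\<^sup>2) summable_on carrier G" .
  then show ?thesis using const_summable_imp_zero[OF _ inf, of "(B \<one> a b)\<^sup>2"] by simp
qed

end

text \<open>A nontrivial alternating factor would leave its last letter as a descent of
  \<open>u'\<close>.\<close>

lemma min_rep_unique:
  assumes "s \<in> S" "t \<in> S" "s \<noteq> t" "min_rep s t u" "min_rep s t u'" "v \<in> generate G {s, t}" "u' = u \<otimes> v"
  shows "u' = u"
proof -
  obtain a b k where k: "{a, b} = {s, t}" "k \<le> m" "v = alt a b k"
    using assms dihedral_elements[of s t] by blast
  have ab: "a \<in> S" "b \<in> S" "a \<noteq> b" "min_rep a b u"
    using pair_mem[OF k(1) assms(1-3)] min_rep_cong[OF k(1) assms(4)] by auto
  show ?thesis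
  proof (cases k)
    case 0
    then show ?thesis using k assms min_rep_carrier[OF ab] by simp
  next
    case (Suc j)
    then have "inversion u' (letter a b j)" using min_rep_last(1)[OF ab, of j] k assms by simp
    moreover have "letter a b j \<in> {s, t}" using k by (auto simp: letter_def)
    ultimately show ?thesis using min_rep_not_inversion[OF assms(1-3,5)] by auto
  qed
qed

lemma alt_quotient_in_dihedral:
  assumes "s \<in> S" "t \<in> S" "s \<noteq> t" "{a, b} = {s, t}" "{a', b'} = {s, t}" "k \<le> m" "k' \<le> m"
  shows "alt a b k \<otimes> inv (alt a' b' k') \<in> generate G {s, t}"
proof -
  have "subgroup (generate G {s, t}) G" using assms by (intro generate_is_subgroup) auto
  moreover have "alt a b k \<in> generate G {s, t}" "alt a' b' k' \<in> generate G {s, t}"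
    using assms alt_in_dihedral[of s t] by (auto simp: doubleton_eq_iff)
  ultimately show ?thesis by (simp add: subgroup.m_closed subgroup.m_inv_closed)
qed

section \<open>Energy going up and energy coming from below\<close>

definition ascents :: "'a \<Rightarrow> 'a set" where "ascents x = {s \<in> S. \<not> inversion x s}"
definition descents :: "'a \<Rightarrow> 'a set" where "descents x = {s \<in> S. inversion x s}"

context
  fixes B
  assumes B: "l2_circulation B" and m3: "m \<ge> 3"
begin

text \<open>By \<open>min_repI\<close> two ascents span a cell whose lowest vertex is
  \<open>x\<close>. The pairs are ordered, so each such cell counts twice.\<close>

definition up_energy :: "'a \<Rightarrow> real" where
  "up_energy x = (\<Sum>s\<in>ascents x. \<Sum>t\<in>ascents x. (B x s t)\<^sup>2)"

text \<open>The index set is empty unless \<open>x\<close> has exactly one descent \<open>t\<close>.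
  Then these are the cells at \<open>x\<close> that \<open>up_energy\<close> leaves out, each
  counted once.\<close>

definition down_energy :: "'a \<Rightarrow> real" where
  "down_energy x = (\<Sum>(r, t)\<in>{(r, t). r \<in> S \<and> r \<noteq> t \<and> descents x = {t}}. (B x r t)\<^sup>2)"

text \<open>If \<open>t\<close> is the only descent, the row equation at \<open>r\<close> writes
  \<open>B x r t\<close> as minus a row sum over the ascents, and
  \<open>antisymmetric_energy\<close> applies with \<open>card S - 1\<close> ascents.\<close>

lemma down_energy_le:
  assumes x: "x \<in> carrier G"
  shows "2 * down_energy x \<le> (card S - 1) * up_energy x"
proof (cases "\<exists>t. descents x = {t}")
  case True
  then obtain t where t: "descents x = {t}" by blast
  have tS: "t \<in> S" using t by (auto simp: descents_def)
  have anti: "B x r s = - B x s r" if "r \<in> S - {t}" "s \<in> S - {t}" for r s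
    using that by (intro circ_anti[OF B x]) auto
  have asc: "ascents x = S - {t}" using t by (auto simp: descents_def ascents_def)
  have "{(r, t). r \<in> S \<and> r \<noteq> t \<and> descents x = {t}} = (\<lambda>r. (r, t)) ` (S - {t})" using t by auto
  then have "down_energy x = (\<Sum>r\<in>S-{t}. (B x r t)\<^sup>2)"
    unfolding down_energy_def by (simp add: sum.reindex inj_on_def)
  also have "\<dots> = (\<Sum>r\<in>S-{t}. (\<Sum>s\<in>S-{t}. B x r s)\<^sup>2)"
  proof (intro sum.cong refl)
    fix r assume "r \<in> S - {t}"
    then have "B x r t + (\<Sum>s\<in>S-{t}. B x r s) = 0"
      using circ_row[OF B x, of r] sum.remove[OF finite_S tS, of "B x r"] by simp
    then have "B x r t = - (\<Sum>s\<in>S-{t}. B x r s)" by simp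
    then show "(B x r t)\<^sup>2 = (\<Sum>s\<in>S-{t}. B x r s)\<^sup>2" by simp
  qed
  finally have "2 * down_energy x \<le> card (S - {t}) * up_energy x"
    using antisymmetric_energy[of "S - {t}" "B x", OF _ anti] finite_S
    by (simp add: up_energy_def asc)
  then show ?thesis using tS finite_S by simp
next
  case False
  then have "{(r, t). r \<in> S \<and> r \<noteq> t \<and> descents x = {t}} = {}" by auto
  then have "down_energy x = 0" unfolding down_energy_def by (simp only: sum.empty)
  moreover have "up_energy x \<ge> 0" by (auto simp: up_energy_def intro!: sum_nonneg)
  ultimately show ?thesis by simp
qed

lemma up_energy_summable: "up_energy summable_on carrier G"
proof (rule summable_on_comparison_test)
  show "(\<lambda>x. \<Sum>s\<in>S. \<Sum>t\<in>S. (B x s t)\<^sup>2) summable_on carrier G"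
    using circ_summable[OF B] finite_S by (intro summable_on_finite_sum) auto
  show "up_energy x \<le> (\<Sum>s\<in>S. \<Sum>t\<in>S. (B x s t)\<^sup>2)" for x
  proof -
    have "up_energy x \<le> (\<Sum>s\<in>ascents x. \<Sum>t\<in>S. (B x s t)\<^sup>2)"
      unfolding up_energy_def using finite_S by (intro sum_mono sum_mono2) (auto simp: ascents_def)
    also have "\<dots> \<le> (\<Sum>s\<in>S. \<Sum>t\<in>S. (B x s t)\<^sup>2)"
      using finite_S by (intro sum_mono2) (auto simp: ascents_def intro!: sum_nonneg)
    finally show ?thesis .
  qed
qed (auto simp: up_energy_def intro!: sum_nonneg)

lemma down_energy_nonneg: "down_energy x \<ge> 0"
  unfolding down_energy_def by (intro sum_nonneg) (simp add: split_def)

lemma down_energy_summable: "down_energy summable_on carrier G"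
proof (rule summable_on_comparison_test)
  show "(\<lambda>x. (card S - 1) * up_energy x) summable_on carrier G"
    using up_energy_summable by (rule summable_on_cmult_right)
  show "down_energy x \<le> (card S - 1) * up_energy x" if "x \<in> carrier G" for x
    using down_energy_le[OF that] down_energy_nonneg[of x] by simp
qed (rule down_energy_nonneg)

text \<open>The two letters determine the pair of generators, hence the coset and its shortest
  element; the length then determines \<open>k\<close>, and the parity of \<open>k\<close> tells
  \<open>s\<close> from \<open>t\<close>.\<close>

lemma corner_inj:
  assumes "s \<in> S" "t \<in> S" "s \<noteq> t" "min_rep s t u" "s' \<in> S" "t' \<in> S" "s' \<noteq> t'" "min_rep s' t' u'"
    and k: "2 \<le> k" "k < m" "2 \<le> k'" "k' < m"
    and eq: "u \<otimes> alt s t k = u' \<otimes> alt s' t' k'" "letter s t k = letter s' t' k'" "letter s t (k - 1) = letter s' t' (k' - 1)"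
  shows "u = u' \<and> s = s' \<and> t = t' \<and> k = k'"
proof -
  have "{letter s t k, letter s t (k - 1)} = {s, t}" "{letter s' t' k', letter s' t' (k' - 1)} = {s', t'}"
    using k by (auto simp: letter_def)
  then have st: "{s', t'} = {s, t}" using eq by simp
  have mu': "min_rep s t u'" using min_rep_cong[OF st[symmetric] assms(8)] .
  have uc: "u \<in> carrier G" "u' \<in> carrier G" using min_rep_carrier assms by blast+
  have "u' = u' \<otimes> alt s' t' k' \<otimes> inv (alt s' t' k')" using uc assms by (simp add: m_assoc)
  also have "\<dots> = u \<otimes> (alt s t k \<otimes> inv (alt s' t' k'))" using uc assms by (simp add: eq(1)[symmetric]) (simp add: m_assoc)
  finally have "u' = u"
    using min_rep_unique[OF assms(1-4) mu'] alt_quotient_in_dihedral[OF assms(1-3) refl st, of k k'] k by auto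
  moreover have "len u + k = len u' + k'"
    using eq(1) min_rep_len[OF assms(1-4), of k] min_rep_len[OF assms(5-8), of k'] k by simp
  ultimately have "k = k'" by simp
  then show ?thesis using \<open>u' = u\<close> eq k by (cases "even k") (auto simp: letter_def)
qed

text \<open>Each ordered pair \<open>(s, t)\<close> stands for one side of the polygon above
  \<open>u\<close>. The \<open>m - 2\<close> vertices on it with \<open>2 \<le> k < m\<close> have a
  unique descent and see the same coefficient up to sign, so each contributes the energy of the cell
  once more, now as \<open>down_energy\<close>.\<close>

lemma up_energy_finite_le:
  assumes U: "finite U" "U \<subseteq> carrier G"
  shows "(m - 2) * (\<Sum>u\<in>U. up_energy u) \<le> infsum down_energy (carrier G)"
proof -
  define A where "A = {(u, s, t, k). u \<in> U \<and> s \<in> ascents u \<and> t \<in> ascents u \<and> s \<noteq> t \<and> k \<in> {2..<m}}"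
  \<comment> \<open>A vertex of the polygon, followed by the generator that is an ascent there and
    the one that is its unique descent.\<close>
  define f where "f = (\<lambda>(u, s, t, k). (u \<otimes> alt s t k, letter s t k, letter s t (k - 1)))"
  have fa: "finite (ascents u)" for u using finite_S by (simp add: ascents_def)
  have A_sub: "A \<subseteq> U \<times> S \<times> S \<times> {2..<m}" by (auto simp: A_def ascents_def)
  then have finA: "finite A" using U finite_S by (meson finite_SigmaI finite_atLeastLessThan finite_subset)
  have mr: "s \<in> S" "t \<in> S" "s \<noteq> t" "min_rep s t u" "u \<in> carrier G" "2 \<le> k" "k < m" if "(u, s, t, k) \<in> A" for u s t k
    using that U by (auto simp: A_def ascents_def intro!: min_repI)
  have inj: "inj_on f A"
  proof (rule inj_onI)
    fix p p' assume p: "p \<in> A" "p' \<in> A" and eq: "f p = f p'"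
    obtain u s t k u' s' t' k' where pp: "p = (u, s, t, k)" "p' = (u', s', t', k')" by (metis prod_cases4)
    note A = p[unfolded pp]
    have "u = u' \<and> s = s' \<and> t = t' \<and> k = k'"
      using eq corner_inj[OF mr(1-4)[OF A(1)] mr(1-4)[OF A(2)] mr(6,7)[OF A(1)] mr(6,7)[OF A(2)]] by (simp add: f_def pp)
    then show "p = p'" using pp by simp
  qed
  define X where "X = fst ` f ` A"
  have X: "finite X" "X \<subseteq> carrier G" using finA mr by (auto simp: X_def f_def)
  have "(m - 2) * (\<Sum>u\<in>U. up_energy u) = (\<Sum>u\<in>U. \<Sum>s\<in>ascents u. \<Sum>t\<in>ascents u. (m - 2) * (B u s t)\<^sup>2)"
    by (simp add: up_energy_def sum_distrib_left)
  also have "\<dots> = (\<Sum>u\<in>U. \<Sum>s\<in>ascents u. \<Sum>t\<in>ascents u - {s}. (m - 2) * (B u s t)\<^sup>2)"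
  proof (rule sum.cong[OF refl], rule sum.cong[OF refl])
    fix u s assume "u \<in> U" "s \<in> ascents u"
    then have "B u s s = 0" using circ_diag[OF B] U by (auto simp: ascents_def)
    then show "(\<Sum>t\<in>ascents u. (m - 2) * (B u s t)\<^sup>2) = (\<Sum>t\<in>ascents u - {s}. (m - 2) * (B u s t)\<^sup>2)"
      using fa \<open>s \<in> ascents u\<close> by (subst sum.remove) auto
  qed
  also have "\<dots> = (\<Sum>u\<in>U. \<Sum>s\<in>ascents u. \<Sum>t\<in>ascents u - {s}. \<Sum>k\<in>{2..<m}. (B u s t)\<^sup>2)"
    by simp
  also have "\<dots> = (\<Sum>(u, s, t, k)\<in>A. (B u s t)\<^sup>2)"
  proof -
    have "A = (SIGMA u:U. SIGMA s:ascents u. SIGMA t:ascents u - {s}. {2..<m})" by (auto simp: A_def)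
    then show ?thesis using U fa by (simp add: sum.Sigma split_def del: sum_constant)
  qed
  also have "\<dots> = (\<Sum>(u, s, t, k)\<in>A. (\<lambda>(x, r, t). (B x r t)\<^sup>2) (f (u, s, t, k)))"
  proof (intro sum.cong refl, clarify)
    fix u s t k assume *: "(u, s, t, k) \<in> A"
    note mr = mr[OF *]
    have "B (u \<otimes> alt s t k) s t = B u s t" using mr by (intro circ_alt[OF B]) auto
    moreover have "B (u \<otimes> alt s t k) t s = - B (u \<otimes> alt s t k) s t"
      using mr by (intro circ_anti[OF B]) auto
    ultimately show "(B u s t)\<^sup>2 = (\<lambda>(x, r, t). (B x r t)\<^sup>2) (f (u, s, t, k))"
      using mr(6) by (simp add: f_def letter_def)
  qed
  also have "\<dots> = (\<Sum>p\<in>f ` A. (\<lambda>(x, r, t). (B x r t)\<^sup>2) p)"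
    using inj by (simp add: sum.reindex split_def)
  also have "\<dots> \<le> (\<Sum>p\<in>(SIGMA x:X. {(r, t). r \<in> S \<and> r \<noteq> t \<and> descents x = {t}}). (\<lambda>(x, r, t). (B x r t)\<^sup>2) p)"
  proof (rule sum_mono2)
    have "(SIGMA x:X. {(r, t). r \<in> S \<and> r \<noteq> t \<and> descents x = {t}}) \<subseteq> X \<times> S \<times> S"
      by (auto simp: descents_def)
    then show "finite (SIGMA x:X. {(r, t). r \<in> S \<and> r \<noteq> t \<and> descents x = {t}})"
      using X finite_S by (meson finite_SigmaI finite_subset)
    show "f ` A \<subseteq> (SIGMA x:X. {(r, t). r \<in> S \<and> r \<noteq> t \<and> descents x = {t}})"
    proof
      fix p assume p: "p \<in> f ` A"
      then obtain u s t k where *: "(u, s, t, k) \<in> A" and f: "p = f (u, s, t, k)" by fastforce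
      note mr = mr[OF *]
      have "fst p \<in> X" using p by (simp add: X_def)
      moreover have "letter s t k \<noteq> letter s t (k - 1)" using mr by (auto simp: letter_def)
      moreover have "descents (u \<otimes> alt s t k) = {letter s t (k - 1)}"
        using unique_descent[OF m3 mr(1-4,6,7)] mr(1-3) by (auto simp: descents_def)
      ultimately show "p \<in> (SIGMA x:X. {(r, t). r \<in> S \<and> r \<noteq> t \<and> descents x = {t}})"
        using mr(1-3) by (simp add: f f_def)
    qed
  qed auto
  also have "\<dots> = (\<Sum>x\<in>X. down_energy x)"
  proof -
    have "{(r, t). r \<in> S \<and> r \<noteq> t \<and> descents x = {t}} \<subseteq> S \<times> S" for x by (auto simp: descents_def)
    then have "finite {(r, t). r \<in> S \<and> r \<noteq> t \<and> descents x = {t}}" for x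
      using finite_S by (meson finite_SigmaI finite_subset)
    then show ?thesis using X unfolding down_energy_def by (subst sum.Sigma) (auto simp: split_def)
  qed
  also have "\<dots> \<le> infsum down_energy (carrier G)"
    using X down_energy_nonneg by (intro finite_sum_le_infsum down_energy_summable) auto
  finally show ?thesis .
qed

text \<open>The total up-energy \<open>E\<close> and down-energy \<open>H\<close> satisfy
  \<open>(m - 2) E \<le> H\<close>. Conversely \<open>2 H\<close> is at most
  \<open>card S - 1\<close> times \<open>E\<close> without its term at the identity, as the identity
  has no descents. Both together leave no room for that term.\<close>

lemma circulation_zero_energy:
  assumes big: "card S - 1 \<le> 2 * (m - 2)" and st: "s \<in> S" "t \<in> S"
  shows "B \<one> s t = 0"
proof -
  let ?E = "infsum up_energy (carrier G)" and ?H = "infsum down_energy (carrier G)"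
  have up0: "up_energy x \<ge> 0" for x by (auto simp: up_energy_def intro!: sum_nonneg)
  have 1: "(m - 2) * ?E \<le> ?H"
  proof -
    have "infsum (\<lambda>x. (m - 2) * up_energy x) (carrier G) \<le> ?H"
      using up_energy_finite_le up_energy_summable
      by (intro infsum_le_finite_sums summable_on_cmult_right) (auto simp: sum_distrib_left[symmetric])
    then show ?thesis using up_energy_summable by (simp add: infsum_cmult_right)
  qed
  have d1: "descents \<one> = {}" by (auto simp: descents_def)
  then have dn1: "down_energy \<one> = 0" by (simp add: down_energy_def)
  have asc1: "ascents \<one> = S" by (auto simp: ascents_def)
  define e where "e = (\<lambda>x. if x = \<one> then 0 else up_energy x)"
  have es: "e summable_on carrier G"
    by (rule summable_on_comparison_test[OF up_energy_summable]) (auto simp: e_def up0)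
  have E: "?E = up_energy \<one> + infsum e (carrier G)"
  proof -
    have "infsum e (carrier G) = infsum up_energy (carrier G - {\<one>})"
      by (rule infsum_cong_neutral) (auto simp: e_def)
    then show ?thesis
      using infsum_Un_disjoint[of up_energy "{\<one>}" "carrier G - {\<one>}"] up_energy_summable
        summable_on_subset_banach[OF up_energy_summable, of "carrier G - {\<one>}"]
      by (simp add: insert_absorb)
  qed
  have "2 * ?H \<le> (card S - 1) * infsum e (carrier G)"
  proof -
    have "infsum (\<lambda>x. 2 * down_energy x) (carrier G) \<le> infsum (\<lambda>x. (card S - 1) * e x) (carrier G)"
      using down_energy_le dn1
      by (intro infsum_mono summable_on_cmult_right down_energy_summable es) (auto simp: e_def)
    then show ?thesis using es down_energy_summable by (simp add: infsum_cmult_right)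
  qed
  moreover have "infsum e (carrier G) \<ge> 0" by (intro infsum_nonneg) (auto simp: e_def up0)
  ultimately have "2 * ?H \<le> 2 * (m - 2) * infsum e (carrier G)"
    using big by (smt (verit, best) mult_right_mono of_nat_mono)
  then have "(m - 2) * ?E \<le> (m - 2) * infsum e (carrier G)" using 1 by simp
  then have "up_energy \<one> \<le> 0" using E m3 by simp
  then have "up_energy \<one> = 0" using up0[of \<one>] by simp
  then have "\<forall>s\<in>S. (\<Sum>t\<in>S. (B \<one> s t)\<^sup>2) = 0"
    unfolding up_energy_def asc1 using finite_S by (subst (asm) sum_nonneg_eq_0_iff) (auto intro: sum_nonneg)
  then have "\<forall>t\<in>S. (B \<one> s t)\<^sup>2 = 0" using finite_S st by (subst (asm) sum_nonneg_eq_0_iff) auto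
  then show ?thesis using st by simp
qed

end
end

section \<open>Lorentzian geometry of the ideal tetrahedron\<close>

text \<open>In coordinates with respect to the four isotropic vectors spanning the ideal vertices,
  the invariant form is \<open>\<Sum>\<^bsub>i \<noteq> j\<^esub> x\<^sub>i y\<^sub>j\<close>.\<close>

definition tau :: "'a set \<Rightarrow> ('a \<Rightarrow> real) \<Rightarrow> real" where "tau S x = (\<Sum>i\<in>S. x i)"

definition lor :: "'a set \<Rightarrow> ('a \<Rightarrow> real) \<Rightarrow> ('a \<Rightarrow> real) \<Rightarrow> real" where
  "lor S x y = tau S x * tau S y - (\<Sum>i\<in>S. x i * y i)"

definition future :: "'a set \<Rightarrow> ('a \<Rightarrow> real) \<Rightarrow> bool" where
  "future S x \<longleftrightarrow> tau S x \<ge> 0 \<and> lor S x x \<ge> 0"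

lemma lor_commute: "lor S x y = lor S y x"
  by (simp add: lor_def mult.commute)

lemma tau_lin: "tau S (\<lambda>i. p * x i + q * y i) = p * tau S x + q * tau S y"
  by (simp add: tau_def sum.distrib sum_distrib_left)

lemma lor_lin1: "lor S (\<lambda>i. p * x i + q * y i) z = p * lor S x z + q * lor S y z"
  by (simp add: lor_def tau_lin algebra_simps sum.distrib sum_distrib_left)

lemma lor_lin2: "lor S z (\<lambda>i. p * x i + q * y i) = p * lor S z x + q * lor S z y"
  by (simp add: lor_commute[of S z] lor_lin1)

lemma cauchy_lor: "(\<Sum>i\<in>S. x i * y i)\<^sup>2 \<le> (\<Sum>i\<in>S. x i * x i) * (\<Sum>i\<in>S. y i * y i)" for x y :: "'a \<Rightarrow> real"
  using Cauchy_Schwarz_ineq_sum[of x y S] by (simp add: power2_eq_square)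

text \<open>On the cone the Euclidean norm is at most \<open>tau\<close>, so this is the
  Cauchy-Schwarz inequality of the coordinates.\<close>

lemma lor_nonneg:
  assumes "future S x" "future S y" shows "lor S x y \<ge> 0"
proof -
  have "(\<Sum>i\<in>S. x i * x i) \<le> (tau S x)\<^sup>2" "(\<Sum>i\<in>S. y i * y i) \<le> (tau S y)\<^sup>2"
    using assms by (simp_all add: future_def lor_def power2_eq_square)
  then have "(\<Sum>i\<in>S. x i * x i) * (\<Sum>i\<in>S. y i * y i) \<le> (tau S x)\<^sup>2 * (tau S y)\<^sup>2"
    by (intro mult_mono) (simp_all add: sum_nonneg)
  then have "(\<Sum>i\<in>S. x i * y i)\<^sup>2 \<le> (tau S x * tau S y)\<^sup>2"
    using cauchy_lor[where S=S and x=x and y=y] by (simp add: power_mult_distrib)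
  then have "(\<Sum>i\<in>S. x i * y i) \<le> tau S x * tau S y"
    using assms by (elim power2_le_imp_le) (simp_all add: future_def)
  then show ?thesis by (simp add: lor_def)
qed

lemma lor_orthogonal_timelike:
  assumes "lor S z t = 0" "lor S t t > 0" shows "lor S z z \<le> 0"
proof (rule ccontr)
  assume "\<not> ?thesis"
  then have 1: "(\<Sum>i\<in>S. z i * z i) < (tau S z)\<^sup>2" by (simp add: lor_def power2_eq_square)
  have 2: "(\<Sum>i\<in>S. t i * t i) < (tau S t)\<^sup>2" using assms by (simp add: lor_def power2_eq_square)
  have 0: "(\<Sum>i\<in>S. z i * z i) \<ge> 0" "(\<Sum>i\<in>S. t i * t i) \<ge> 0" by (auto intro: sum_nonneg)
  have "(tau S z)\<^sup>2 * (tau S t)\<^sup>2 = (\<Sum>i\<in>S. z i * t i)\<^sup>2"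
    using assms(1) by (simp add: lor_def power_mult_distrib[symmetric])
  also have "\<dots> \<le> (\<Sum>i\<in>S. z i * z i) * (\<Sum>i\<in>S. t i * t i)" by (rule cauchy_lor)
  also have "\<dots> \<le> (\<Sum>i\<in>S. z i * z i) * (tau S t)\<^sup>2" using 0 2 by (intro mult_left_mono) auto
  also have "\<dots> < (tau S z)\<^sup>2 * (tau S t)\<^sup>2" using 1 2 0 by (intro mult_strict_right_mono) auto
  finally show False by simp
qed

lemma futureI:
  assumes "lor S y y \<ge> 0" "future S x" "lor S y x > 0" shows "future S y"
proof (rule ccontr)
  assume "\<not> ?thesis"
  then have "tau S y < 0" using assms by (simp add: future_def)
  then have "future S (\<lambda>i. (-1) * y i + 0 * y i)"
    unfolding future_def tau_lin lor_lin1 lor_lin2 using assms by simp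
  from lor_nonneg[OF this assms(2)] show False using assms(3) unfolding lor_lin1 by simp
qed

text \<open>Subtract from \<open>x\<close> its projection to the plane of \<open>v\<close> and
  \<open>w\<close>. The rest \<open>z\<close> is orthogonal to the timelike vector
  \<open>v + w\<close>, so its square is at most 0.\<close>

lemma lor_null_pair:
  assumes "lor S v v = 0" "lor S w w = 0" "lor S v w > 0"
  shows "lor S v w * lor S x x \<le> 2 * lor S x v * lor S x w"
proof -
  define l where "l = lor S v w"
  have l: "l > 0" "lor S w v = l" "lor S v w = l" using assms by (auto simp: l_def lor_commute)
  define z where "z = (\<lambda>i. 1 * x i + (-1) * ((lor S x w / l) * v i + (lor S x v / l) * w i))"
  define t where "t = (\<lambda>i. 1 * v i + 1 * w i)"
  have "lor S z t = 0"
    unfolding z_def t_def lor_lin1 lor_lin2 using assms l by (simp add: field_simps)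
  moreover have "lor S t t > 0" unfolding t_def lor_lin1 lor_lin2 using assms l by simp
  ultimately have "lor S z z \<le> 0" by (rule lor_orthogonal_timelike)
  also have "lor S z z = lor S x x - 2 * lor S x v * lor S x w / l"
    unfolding z_def lor_lin1 lor_lin2 using assms l
    by (simp add: field_simps lor_commute[of S v x] lor_commute[of S w x])
  finally show ?thesis using l by (simp add: field_simps)
qed

text \<open>The projection argument of \<open>lor_null_pair\<close> for \<open>x + y\<close>. It
  bounds the distance of two points (the form is its cosh) when both lie near the geodesic from
  \<open>v\<close> to \<open>w\<close> and at comparable heights.\<close>

lemma lor_near_pair:
  assumes "lor S v v = 0" "lor S w w = 0" "lor S v w = 1" "lor S x x = 1" "lor S y y = 1"
  shows "lor S x y \<le> lor S x v * lor S y w + lor S x w * lor S y v + lor S x v * lor S x w + lor S y v * lor S y w - 1"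
proof -
  have wv: "lor S w v = 1" using assms by (simp add: lor_commute)
  define s where "s = (\<lambda>i. 1 * x i + 1 * y i)"
  define z where "z = (\<lambda>i. 1 * s i + (-1) * (lor S s w * v i + lor S s v * w i))"
  define t where "t = (\<lambda>i. 1 * v i + 1 * w i)"
  have "lor S z t = 0" unfolding z_def t_def lor_lin1 lor_lin2 using assms wv by simp
  moreover have "lor S t t > 0" unfolding t_def lor_lin1 lor_lin2 using assms wv by simp
  ultimately have "lor S z z \<le> 0" by (rule lor_orthogonal_timelike)
  also have "lor S z z = lor S s s - 2 * lor S s v * lor S s w"
    unfolding z_def lor_lin1 lor_lin2 using assms wv
    by (simp add: field_simps lor_commute[of S v s] lor_commute[of S w s])
  also have "lor S s s = 2 + 2 * lor S x y"
    unfolding s_def lor_lin1 lor_lin2 using assms by (simp add: lor_commute[of S y x])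
  also have "lor S s v = lor S x v + lor S y v" unfolding s_def lor_lin1 by simp
  also have "lor S s w = lor S x w + lor S y w" unfolding s_def lor_lin1 by simp
  finally show ?thesis by (simp add: algebra_simps)
qed

text \<open>Moving by a distance \<open>d\<close> changes the product with a null vector by at most
  the factor \<open>exp d\<close>, and 41/40 is the cosh of \<open>ln (5/4)\<close>. In the proof,
  \<open>5/4 x - y\<close> stays in the future cone.\<close>

lemma lor_step:
  assumes "lor S x x = 1" "lor S y y = 1" "future S x" "future S v" "lor S x y \<le> 41/40"
  shows "lor S y v \<le> 5/4 * lor S x v"
proof -
  define z where "z = (\<lambda>i. (5/4) * x i + (-1) * y i)"
  have "lor S z z = 41/16 - 5/2 * lor S x y" unfolding z_def lor_lin1 lor_lin2
    using assms by (simp add: lor_commute[of S y x] field_simps)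
  then have "lor S z z \<ge> 0" using assms(5) by simp
  moreover have "lor S z x > 0" unfolding z_def lor_lin1
    using assms by (simp add: lor_commute[of S y x])
  ultimately have "lor S z v \<ge> 0" using futureI[of S z x] lor_nonneg[of S z v] assms by simp
  then show ?thesis unfolding z_def lor_lin1 by simp
qed

definition unit_vec :: "'a \<Rightarrow> 'a \<Rightarrow> real" where "unit_vec k i = (if i = k then 1 else 0)"

lemma lor_unit: "finite S \<Longrightarrow> k \<in> S \<Longrightarrow> lor S x (unit_vec k) = tau S x - x k"
  by (simp add: lor_def tau_def unit_vec_def if_distrib[of "\<lambda>y. _ * y"] cong: if_cong)

lemma future_unit: "finite S \<Longrightarrow> k \<in> S \<Longrightarrow> future S (unit_vec k)"
  and null_unit: "finite S \<Longrightarrow> k \<in> S \<Longrightarrow> lor S (unit_vec k) (unit_vec k) = 0"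
  by (simp_all add: future_def lor_unit) (simp_all add: tau_def unit_vec_def)

text \<open>Reflection in the face opposite to the ideal vertex \<open>s\<close>: the vectors with
  coordinate \<open>y s = 0\<close> are fixed. It preserves the form because there are three other
  coordinates.\<close>

definition reflect :: "'a set \<Rightarrow> 'a \<Rightarrow> ('a \<Rightarrow> real) \<Rightarrow> 'a \<Rightarrow> real" where
  "reflect S s y i = (if i = s then - y s else if i \<in> S then y i + y s else y i)"

lemma reflect_reflect: "reflect S s (reflect S s y) = y"
  by (auto simp: reflect_def fun_eq_iff)

lemma reflect_lin: "reflect S s (\<lambda>i. p * x i + q * y i) = (\<lambda>i. p * reflect S s x i + q * reflect S s y i)"
  by (auto simp: reflect_def fun_eq_iff algebra_simps)

lemma reflect_braid:
  assumes "s \<in> S" "t \<in> S" "s \<noteq> t"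
  shows "reflect S s (reflect S t (reflect S s (reflect S t (reflect S s (reflect S t y))))) = y"
proof
  fix i
  show "reflect S s (reflect S t (reflect S s (reflect S t (reflect S s (reflect S t y))))) i = y i"
    using assms by (cases "i = s"; cases "i = t"; cases "i \<in> S") (simp_all add: reflect_def)
qed

lemma tau_reflect:
  assumes "card S = 4" "s \<in> S" shows "tau S (reflect S s x) = tau S x + x s"
proof -
  have fin: "finite S" using assms card.infinite by fastforce
  have "tau S (reflect S s x) = - x s + (\<Sum>i\<in>S-{s}. x i + x s)"
    unfolding tau_def using fin assms
    by (subst sum.remove[of S s]) (auto simp: reflect_def intro!: sum.cong)
  also have "\<dots> = (\<Sum>i\<in>S-{s}. x i) + 2 * x s" using assms fin by (simp add: sum.distrib)
  also have "(\<Sum>i\<in>S-{s}. x i) = tau S x - x s" unfolding tau_def using fin assms by (simp add: sum.remove[of S s])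
  finally show ?thesis by simp
qed

lemma lor_reflect:
  assumes "card S = 4" "s \<in> S" shows "lor S (reflect S s x) (reflect S s y) = lor S x y"
proof -
  have fin: "finite S" using assms card.infinite by fastforce
  have r: "(\<Sum>i\<in>S-{s}. z i) = tau S z - z s" for z
    unfolding tau_def using fin assms by (simp add: sum.remove[of S s])
  have p: "(\<Sum>i\<in>S-{s}. x i * y i) = (\<Sum>i\<in>S. x i * y i) - x s * y s"
    using fin assms by (simp add: sum.remove[of S s])
  have "(\<Sum>i\<in>S. reflect S s x i * reflect S s y i) = x s * y s + (\<Sum>i\<in>S-{s}. (x i + x s) * (y i + y s))"
    using fin assms by (subst sum.remove[of S s]) (auto simp: reflect_def intro!: sum.cong)
  also have "(\<Sum>i\<in>S-{s}. (x i + x s) * (y i + y s)) =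
      (\<Sum>i\<in>S-{s}. x i * y i) + (\<Sum>i\<in>S-{s}. x i) * y s + x s * (\<Sum>i\<in>S-{s}. y i) + 3 * (x s * y s)"
    using assms fin by (simp add: algebra_simps sum.distrib sum_distrib_left)
  finally have "(\<Sum>i\<in>S. reflect S s x i * reflect S s y i) =
      (\<Sum>i\<in>S. x i * y i) + tau S x * y s + x s * tau S y + x s * y s"
    unfolding p r[of x] r[of y] by (simp add: algebra_simps)
  then show ?thesis using assms by (simp add: lor_def tau_reflect algebra_simps)
qed

lemma future_reflect:
  assumes "card S = 4" "s \<in> S" "future S x" shows "future S (reflect S s x)"
proof -
  have fin: "finite S" using assms card.infinite by fastforce
  have "x s * x s \<le> (\<Sum>i\<in>S. x i * x i)" using fin assms by (intro member_le_sum) auto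
  also have "\<dots> \<le> tau S x * tau S x" using assms by (simp add: future_def lor_def)
  finally have "\<bar>x s\<bar> \<le> tau S x" using assms abs_le_square_iff[of "x s" "tau S x"]
    by (simp add: power2_eq_square future_def)
  then show ?thesis using assms by (simp add: future_def tau_reflect lor_reflect)
qed

text \<open>Pairing with a timelike vector controls \<open>tau\<close> on the future cone, so only
  finitely many integral future vectors lie below a given level; \<open>chamber_covering\<close>
  minimises over such a set.\<close>

lemma lor_timelike_bound:
  assumes "lor S x x > 0" "future S x" "future S w"
  shows "tau S w * (tau S x - sqrt (\<Sum>i\<in>S. x i * x i)) \<le> lor S x w" "sqrt (\<Sum>i\<in>S. x i * x i) < tau S x"
proof -
  have t: "tau S x \<ge> 0" "tau S w \<ge> 0" using assms by (auto simp: future_def)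
  show "sqrt (\<Sum>i\<in>S. x i * x i) < tau S x"
    using assms(1) t by (intro real_less_lsqrt) (auto simp: lor_def power2_eq_square intro: sum_nonneg)
  have "(\<Sum>i\<in>S. w i * w i) \<le> (tau S w)\<^sup>2" using assms by (simp add: future_def lor_def power2_eq_square)
  then have "(\<Sum>i\<in>S. x i * w i)\<^sup>2 \<le> (\<Sum>i\<in>S. x i * x i) * (tau S w)\<^sup>2"
    using cauchy_lor[where S=S and x=x and y=w] mult_left_mono[of "\<Sum>i\<in>S. w i * w i" "(tau S w)\<^sup>2" "\<Sum>i\<in>S. x i * x i"]
    by (simp add: sum_nonneg)
  also have "\<dots> = (sqrt (\<Sum>i\<in>S. x i * x i) * tau S w)\<^sup>2" by (simp add: power_mult_distrib sum_nonneg)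
  finally have "(\<Sum>i\<in>S. x i * w i) \<le> sqrt (\<Sum>i\<in>S. x i * x i) * tau S w"
    using t by (elim power2_le_imp_le) (simp add: sum_nonneg)
  then show "tau S w * (tau S x - sqrt (\<Sum>i\<in>S. x i * x i)) \<le> lor S x w"
    by (simp add: lor_def algebra_simps)
qed

section \<open>The reflection group acting on Minkowski space\<close>

locale ideal_tetrahedron = uniform_coxeter G S 3 for G :: "('a, 'b) monoid_scheme" (structure) and S +
  assumes card_S: "card S = 4"
begin

definition act_word :: "'a list \<Rightarrow> ('a \<Rightarrow> real) \<Rightarrow> 'a \<Rightarrow> real" where
  "act_word ws y = foldr (reflect S) ws y"

definition act :: "'a \<Rightarrow> ('a \<Rightarrow> real) \<Rightarrow> 'a \<Rightarrow> real" where
  "act g = act_word (SOME ws. ws \<in> lists S \<and> pw ws = g)"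

lemma act_word_eq:
  assumes "u \<in> lists S" "v \<in> lists S" "pw u = pw v" shows "act_word u = act_word v"
proof (rule word_function_eqI[where F = act_word, OF assms])
  fix a b s t assume "s \<in> S" "t \<in> S" "s \<noteq> t"
  then show "act_word (a @ concat (replicate 3 [s, t]) @ b) = act_word (a @ b)"
    by (simp add: act_word_def fun_eq_iff numeral_3_eq_3 reflect_braid)
qed (simp add: act_word_def fun_eq_iff reflect_reflect)

lemma act_pw: assumes "ws \<in> lists S" shows "act (pw ws) = act_word ws"
proof -
  have "(SOME vs. vs \<in> lists S \<and> pw vs = pw ws) \<in> lists S \<and> pw (SOME vs. vs \<in> lists S \<and> pw vs = pw ws) = pw ws"
    by (rule someI[of _ ws]) (use assms in auto)
  then show ?thesis unfolding act_def using act_word_eq assms by blast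
qed

lemma act_one [simp]: "act \<one> y = y"
  using act_pw[of "[]"] by (simp add: act_word_def)

lemma act_mult: assumes "g \<in> carrier G" "h \<in> carrier G" shows "act (g \<otimes> h) y = act g (act h y)"
proof -
  obtain u where u: "u \<in> lists S" "pw u = g" using ex_word[OF assms(1)] by (elim bexE)
  obtain v where v: "v \<in> lists S" "pw v = h" using ex_word[OF assms(2)] by (elim bexE)
  have "act (pw (u @ v)) = act_word (u @ v)" using u v by (intro act_pw) auto
  then show ?thesis using u v act_pw[of u] act_pw[of v] by (simp add: pw_append act_word_def)
qed

lemma act_gen: "s \<in> S \<Longrightarrow> act s = reflect S s"
  using act_pw[of "[s]"] by (simp add: act_word_def fun_eq_iff)

lemma act_inv [simp]: "g \<in> carrier G \<Longrightarrow> act (inv g) (act g y) = y" "g \<in> carrier G \<Longrightarrow> act g (act (inv g) y) = y"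
  by (simp_all add: act_mult[symmetric])

lemma act_induct:
  assumes g: "g \<in> carrier G" and "P y" "\<And>s z. s \<in> S \<Longrightarrow> P z \<Longrightarrow> P (reflect S s z)"
  shows "P (act g y)"
proof -
  obtain ws where ws: "ws \<in> lists S" "pw ws = g" using ex_word[OF g] by (elim bexE)
  have "P (act_word ws y)" using ws(1)
    by (induction ws rule: list.induct) (auto simp: act_word_def assms)
  then show ?thesis using act_pw[OF ws(1)] ws(2) by simp
qed

lemma act_lin:
  assumes g: "g \<in> carrier G"
  shows "act g (\<lambda>i. p * x i + q * y i) = (\<lambda>i. p * act g x i + q * act g y i)"
proof -
  obtain ws where ws: "ws \<in> lists S" "pw ws = g" using ex_word[OF g] by (elim bexE)
  have "act_word ws (\<lambda>i. p * x i + q * y i) = (\<lambda>i. p * act_word ws x i + q * act_word ws y i)" for ws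
    by (induction ws) (auto simp: act_word_def reflect_lin)
  then show ?thesis using act_pw[OF ws(1)] ws(2) by simp
qed

lemma lor_act:
  assumes g: "g \<in> carrier G" shows "lor S (act g x) (act g y) = lor S x y"
proof -
  obtain ws where ws: "ws \<in> lists S" "pw ws = g" using ex_word[OF g] by (elim bexE)
  have "lor S (act_word ws x) (act_word ws y) = lor S x y" using ws(1)
    by (induction ws rule: list.induct) (auto simp: act_word_def lor_reflect card_S)
  then show ?thesis using act_pw[OF ws(1)] ws(2) by simp
qed

lemma lor_act_left: "g \<in> carrier G \<Longrightarrow> lor S x (act g y) = lor S (act (inv g) x) y"
  using lor_act[of g "act (inv g) x" y] by simp

lemma future_act: "g \<in> carrier G \<Longrightarrow> future S y \<Longrightarrow> future S (act g y)"
  by (rule act_induct[where P = "future S"]) (auto intro: future_reflect simp: card_S)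

lemma integral_act:
  "g \<in> carrier G \<Longrightarrow> (\<And>i. y i \<in> \<int>) \<Longrightarrow> act g y i \<in> \<int>"
proof -
  assume "g \<in> carrier G" "\<And>i. y i \<in> \<int>"
  then have "\<forall>i. act g y i \<in> \<int>" by (intro act_induct[where P = "\<lambda>y. \<forall>i. y i \<in> \<int>"]) (auto simp: reflect_def)
  then show ?thesis by blast
qed

lemma support_act:
  "g \<in> carrier G \<Longrightarrow> (\<And>i. i \<notin> S \<Longrightarrow> y i = 0) \<Longrightarrow> i \<notin> S \<Longrightarrow> act g y i = 0"
proof -
  assume *: "g \<in> carrier G" "\<And>i. i \<notin> S \<Longrightarrow> y i = 0" "i \<notin> S"
  then have "\<forall>i. i \<notin> S \<longrightarrow> act g y i = 0"
    by (intro act_induct[where P = "\<lambda>y. \<forall>i. i \<notin> S \<longrightarrow> y i = 0"]) (auto simp: reflect_def)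
  then show ?thesis using * by blast
qed

text \<open>Tits' positivity theorem, in dual form.\<close>
lemma act_inv_nonneg:
  assumes "g \<in> carrier G" "s \<in> S" "\<not> inversion g s" "\<forall>i\<in>S. y i \<ge> 0"
  shows "act (inv g) y s \<ge> 0"
  using assms
proof (induction "len g" arbitrary: g s rule: less_induct)
  case less
  show ?case
  proof (cases "g = \<one>")
    case True
    then show ?thesis using less.prems by simp
  next
    case False
    then obtain t where t: "t \<in> S" "inversion g t" using ex_descent less.prems by blast
    have st: "s \<noteq> t" using t less.prems by auto
    obtain u a b k where *: "min_rep s t u" "{a, b} = {s, t}" "k \<le> 3" "g = u \<otimes> alt a b k"
      using min_rep_cases[OF less.prems(2) t(1) st less.prems(1)] by metis
    have ab: "a \<in> S" "b \<in> S" "a \<noteq> b" "min_rep a b u"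
      using pair_mem[OF *(2) less.prems(2) t(1) st] min_rep_cong[OF *(2,1)] by auto
    have uc: "u \<in> carrier G" using min_rep_carrier[OF ab] .
    have nu: "\<not> inversion u s" "\<not> inversion u t"
      using min_rep_not_inversion[OF less.prems(2) t(1) st *(1)] by auto
    define z where "z = act (inv u) y"
    have zpos: "z s \<ge> 0" "z t \<ge> 0" if "k \<noteq> 0"
    proof -
      have "len u < len g" using min_rep_len[OF ab, of k] * that by simp
      then show "z s \<ge> 0" "z t \<ge> 0"
        unfolding z_def using less.hyps[of u] uc nu less.prems(2,4) t(1) by auto
    qed
    obtain j where j: "k = Suc j" using nu(2) t(2) * uc by (cases k) auto
    have last: "inversion g (letter a b j)" using min_rep_last(1)[OF ab, of j] * j by simp
    have "letter a b j \<in> {s, t}" using *(2) by (auto simp: letter_def)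
    then have lt: "letter a b j = t" using last less.prems(3) by auto
    have ls: "letter a b (Suc j) = s" using lt *(2) st by (auto simp: letter_def doubleton_eq_iff split: if_splits)
    have "k \<noteq> 3" using min_rep_last(2)[OF ab, of j] * j ls less.prems(3) by auto
    \<comment> \<open>In both remaining cases the coordinate is nonnegative: it is
      \<open>z s + z t\<close> for \<open>k = 1\<close> and \<open>z t\<close> for
      \<open>k = 2\<close>.\<close>
    then consider "k = 1" | "k = 2" using j * by linarith
    then show ?thesis
    proof cases
      case 1
      then have "g = u \<otimes> t" using * j lt ab uc by (simp add: alt_Suc)
      then have "act (inv g) y = reflect S t z"
        using uc t by (simp add: inv_mult_group act_mult act_gen z_def)
      then show ?thesis using zpos 1 st less.prems by (simp add: reflect_def)
    next
      case 2
      then have "letter a b 0 = s" "letter a b (Suc 0) = t" using lt ls j by (simp_all add: letter_def numeral_2_eq_2)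
      then have "g = u \<otimes> s \<otimes> t" using * 2 ab uc less.prems(2) t(1) by (simp add: alt_Suc numeral_2_eq_2 m_assoc)
      then have "act (inv g) y = reflect S t (reflect S s z)"
        using uc t less.prems(2) by (simp add: inv_mult_group act_mult act_gen z_def)
      then show ?thesis using zpos 2 st less.prems t by (simp add: reflect_def)
    qed
  qed
qed

lemma unit_vec_eq_iff: "unit_vec k = unit_vec l \<longleftrightarrow> k = l"
  by (auto simp: unit_vec_def fun_eq_iff)

text \<open>Makes functions on cusps well defined. A descent \<open>s\<close> of \<open>h\<close> is
  never \<open>k\<close>: coordinate \<open>s\<close> of the inverse of \<open>h \<otimes> s\<close>
  applied to \<open>unit_vec l\<close> is nonnegative by Tits' theorem and equals
  \<open>- unit_vec k s\<close>. So \<open>h\<close> can be shortened through generators fixing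
  \<open>unit_vec k\<close>.\<close>

lemma cusp_stabilizer:
  assumes "h \<in> carrier G" "k \<in> S" "l \<in> S" "act h (unit_vec k) = unit_vec l" "g \<in> carrier G"
    and Phi: "\<And>g s k. g \<in> carrier G \<Longrightarrow> s \<in> S \<Longrightarrow> k \<in> S \<Longrightarrow> s \<noteq> k \<Longrightarrow> Phi (g \<otimes> s) k = Phi g k"
  shows "Phi (g \<otimes> h) k = Phi g l"
  using assms(1,4)
proof (induction "len h" arbitrary: h rule: less_induct)
  case less
  show ?case
  proof (cases "h = \<one>")
    case True
    then show ?thesis using less.prems assms by (simp add: unit_vec_eq_iff)
  next
    case False
    then obtain s where s: "s \<in> S" "inversion h s" using ex_descent less.prems by blast
    have hs: "len (h \<otimes> s) < len h" using len_mult_gen[OF less.prems(1) s(1)] s by simp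
    have e: "act (inv h) (unit_vec l) = unit_vec k" using act_inv(1)[OF less.prems(1), of "unit_vec k"] less.prems(2) by simp
    have "act (inv (h \<otimes> s)) (unit_vec l) s \<ge> 0"
      using s less.prems(1) by (intro act_inv_nonneg) (auto simp: inversion_mult_gen unit_vec_def)
    then have "- unit_vec k s \<ge> 0"
      using s less.prems(1) e by (simp add: inv_mult_group act_mult act_gen reflect_def)
    then have "s \<noteq> k" by (auto simp: unit_vec_def)
    moreover have "reflect S s (unit_vec k) = unit_vec k"
      using \<open>s \<noteq> k\<close> by (auto simp: reflect_def unit_vec_def fun_eq_iff)
    then have "act (h \<otimes> s) (unit_vec k) = unit_vec l"
      using s less.prems by (simp add: act_mult act_gen)
    then have "Phi (g \<otimes> (h \<otimes> s)) k = Phi g l" using less.hyps[OF hs] s less.prems by simp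
    moreover have "g \<otimes> (h \<otimes> s) = g \<otimes> h \<otimes> s" using s less.prems assms by (simp add: m_assoc)
    ultimately show ?thesis using Phi[of "g \<otimes> h" s k] s assms less.prems by simp
  qed
qed

section \<open>Cusps, the fundamental chamber and adjacency\<close>

definition cusps :: "('a \<Rightarrow> real) set" where
  "cusps = {act g (unit_vec k) |g k. g \<in> carrier G \<and> k \<in> S}"

lemma cuspE: assumes "v \<in> cusps" obtains g k where "g \<in> carrier G" "k \<in> S" "v = act g (unit_vec k)"
  using assms by (auto simp: cusps_def)

lemma unit_cusp: "k \<in> S \<Longrightarrow> unit_vec k \<in> cusps"
  unfolding cusps_def using act_one one_closed by (metis (mono_tags, lifting) mem_Collect_eq)

lemma act_cusp: assumes "g \<in> carrier G" "v \<in> cusps" shows "act g v \<in> cusps"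
proof -
  obtain h k where "h \<in> carrier G" "k \<in> S" "v = act h (unit_vec k)" using assms cuspE by metis
  then have "act g v = act (g \<otimes> h) (unit_vec k)" using assms by (simp add: act_mult)
  then show ?thesis unfolding cusps_def using assms \<open>h \<in> carrier G\<close> \<open>k \<in> S\<close> m_closed by blast
qed

lemma cusp_future: "v \<in> cusps \<Longrightarrow> future S v"
  by (erule cuspE) (simp add: future_act future_unit finite_S)

lemma cusp_null: "v \<in> cusps \<Longrightarrow> lor S v v = 0"
  by (erule cuspE) (simp add: lor_act null_unit finite_S)

lemma cusp_integral: "v \<in> cusps \<Longrightarrow> v i \<in> \<int>"
  by (erule cuspE) (simp add: integral_act unit_vec_def)

lemma cusp_support: "v \<in> cusps \<Longrightarrow> i \<notin> S \<Longrightarrow> v i = 0"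
  by (erule cuspE, simp, rule support_act) (auto simp: unit_vec_def)

lemma lor_integral: "(\<And>i. v i \<in> \<int>) \<Longrightarrow> (\<And>i. w i \<in> \<int>) \<Longrightarrow> lor S v w \<in> \<int>"
  by (auto simp: lor_def tau_def intro!: Ints_diff Ints_mult Ints_sum)

text \<open>A null vector orthogonal to \<open>unit_vec k\<close> is a multiple of it. The factor is
  integral and, by applying \<open>inv h\<close>, divides 1 in the integers; being nonnegative it is
  1.\<close>

lemma cusp_eq_unit:
  assumes "w \<in> cusps" "k \<in> S" "lor S w (unit_vec k) = 0" shows "w = unit_vec k"
proof -
  have t: "tau S w = w k" using assms by (simp add: lor_unit finite_S)
  have "(\<Sum>i\<in>S. w i * w i) = w k * w k" using cusp_null[OF assms(1)] t by (simp add: lor_def)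
  then have "(\<Sum>i\<in>S-{k}. w i * w i) = 0" using finite_S assms by (simp add: sum.remove[of S k])
  then have "\<forall>i\<in>S-{k}. w i * w i = 0" using finite_S by (subst (asm) sum_nonneg_eq_0_iff) auto
  then have w0: "w i = 0" if "i \<noteq> k" for i using that cusp_support[OF assms(1), of i] by (cases "i \<in> S") auto
  define c where "c = w k"
  have wc: "w = (\<lambda>i. c * unit_vec k i + 0 * unit_vec k i)" using w0 by (auto simp: fun_eq_iff unit_vec_def c_def)
  obtain h l where h: "h \<in> carrier G" "l \<in> S" "w = act h (unit_vec l)" using assms cuspE by metis
  have "unit_vec l = act (inv h) w" using h by simp
  also have "\<dots> = (\<lambda>i. c * act (inv h) (unit_vec k) i)" unfolding wc using h by (subst act_lin) auto
  finally have "1 = c * act (inv h) (unit_vec k) l" by (metis unit_vec_def)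
  moreover have "act (inv h) (unit_vec k) l \<in> \<int>" using h by (intro integral_act) (auto simp: unit_vec_def)
  moreover have "c \<in> \<int>" using cusp_integral[OF assms(1)] by (simp add: c_def)
  moreover have "c \<ge> 0" using cusp_future[OF assms(1)] t by (simp add: future_def c_def)
  ultimately have "c = 1" by (auto elim!: Ints_cases simp flip: of_int_mult simp: pos_zmult_eq_1_iff zmult_eq_1_iff)
  then show ?thesis using wc by (simp add: fun_eq_iff)
qed

lemma cusp_eqI:
  assumes "v \<in> cusps" "w \<in> cusps" "lor S v w = 0" shows "v = w"
proof -
  obtain g k where g: "g \<in> carrier G" "k \<in> S" "v = act g (unit_vec k)" using assms cuspE by metis
  have "lor S (act (inv g) w) (unit_vec k) = 0"
    using assms(3) g lor_commute[of S v w] lor_act_left[of g w "unit_vec k"] by simp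
  then have "act (inv g) w = unit_vec k" using g assms act_cusp by (intro cusp_eq_unit) auto
  then show ?thesis using g act_inv(2)[of g w] by simp
qed

text \<open>The Dirichlet domain argument: choose the translate of \<open>rho\<close>, the sum of
  the four vertices, that minimises the product with \<open>x\<close>. Replacing \<open>g\<close> by
  \<open>g \<otimes> s\<close> changes this product by three times coordinate \<open>s\<close> of
  \<open>act (inv g) x\<close>, which is therefore nonnegative.\<close>

lemma chamber_covering:
  assumes x: "future S x" "lor S x x > 0"
  shows "\<exists>g\<in>carrier G. \<forall>s\<in>S. act (inv g) x s \<ge> 0"
proof -
  define rho where "rho = (\<lambda>i. if i \<in> S then 1 else 0 :: real)"
  have tr: "tau S rho = 4" by (simp add: tau_def rho_def card_S)
  have lr: "lor S y rho = 3 * tau S y" for y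
    by (simp add: lor_def tr) (simp add: rho_def tau_def)
  have fr: "future S rho" by (simp add: future_def lr tr)
  define f where "f = (\<lambda>w. lor S x w)"
  define Orb where "Orb = {act g rho |g. g \<in> carrier G \<and> f (act g rho) \<le> f rho}"
  define C where "C = f rho / (tau S x - sqrt (\<Sum>i\<in>S. x i * x i))"
  have "Orb \<subseteq> {w. \<forall>i. (i \<in> S \<longrightarrow> w i \<in> {k. k \<in> \<int> \<and> \<bar>k\<bar> \<le> C}) \<and> (i \<notin> S \<longrightarrow> w i = 0)}"
  proof (clarsimp simp: Orb_def)
    fix g i assume g: "g \<in> carrier G" "f (act g rho) \<le> f rho"
    let ?w = "act g rho"
    have fw: "future S ?w" using g fr future_act by blast
    have d: "tau S x - sqrt (\<Sum>i\<in>S. x i * x i) > 0" using lor_timelike_bound(2)[OF x(2,1) fw] by simp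
    have "tau S ?w * (tau S x - sqrt (\<Sum>i\<in>S. x i * x i)) \<le> f rho"
      using lor_timelike_bound(1)[OF x(2,1) fw] g by (simp add: f_def)
    then have tC: "tau S ?w \<le> C" using d by (simp add: C_def pos_le_divide_eq)
    show "(i \<in> S \<longrightarrow> ?w i \<in> \<int> \<and> \<bar>?w i\<bar> \<le> C) \<and> (i \<notin> S \<longrightarrow> ?w i = 0)"
    proof (intro conjI impI)
      show "?w i \<in> \<int>" using g by (intro integral_act) (auto simp: rho_def)
      show "?w i = 0" if "i \<notin> S" using g that by (intro support_act) (auto simp: rho_def)
      assume "i \<in> S"
      then have "?w i * ?w i \<le> (\<Sum>i\<in>S. ?w i * ?w i)" using finite_S by (intro member_le_sum) auto
      also have "\<dots> \<le> tau S ?w * tau S ?w" using fw by (simp add: future_def lor_def)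
      finally have "\<bar>?w i\<bar> \<le> tau S ?w"
        using fw abs_le_square_iff[of "?w i" "tau S ?w"] by (simp add: power2_eq_square future_def)
      then show "\<bar>?w i\<bar> \<le> C" using tC by simp
    qed
  qed
  moreover have "finite \<dots>" using finite_S finite_abs_int_segment by (intro finite_set_of_finite_funs) auto
  ultimately have finO: "finite Orb" by (rule finite_subset)
  have "rho \<in> Orb" unfolding Orb_def using act_one[of rho] by force
  then obtain w where w: "w \<in> Orb" "\<forall>w'\<in>Orb. f w \<le> f w'"
    using finO by (metis arg_min_if_finite(1) arg_min_least empty_iff)
  then obtain g where g: "g \<in> carrier G" "w = act g rho" "f w \<le> f rho" by (auto simp: Orb_def)
  have min: "f w \<le> f (act h rho)" if "h \<in> carrier G" for h
    using w(2) g(3) that unfolding Orb_def by (smt (verit, best) mem_Collect_eq)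
  have "act (inv g) x s \<ge> 0" if s: "s \<in> S" for s
  proof -
    let ?y = "act (inv g) x"
    have "f (act (g \<otimes> s) rho) = lor S ?y (reflect S s rho)"
      using g s by (simp add: f_def act_mult act_gen lor_act_left)
    also have "\<dots> = 3 * tau S ?y + 3 * ?y s"
    proof -
      have "(\<Sum>i\<in>S. ?y i * reflect S s rho i) = - ?y s + (\<Sum>i\<in>S-{s}. 2 * ?y i)"
        using finite_S s by (subst sum.remove[of S s]) (auto simp: reflect_def rho_def intro!: sum.cong)
      also have "\<dots> = 2 * tau S ?y - 3 * ?y s"
        using finite_S s by (simp add: tau_def sum.remove[of S s] sum_distrib_left[symmetric])
      finally show ?thesis using s by (simp add: lor_def tau_reflect card_S tr) (simp add: rho_def)
    qed
    finally show ?thesis using min[of "g \<otimes> s"] g s by (simp add: f_def lor_act_left lr)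
  qed
  then show ?thesis using g by blast
qed

text \<open>Every point lies in the horoball of some cusp at level \<open>sqrt 3 / 2\<close>: move
  the point into the chamber and take the vertex with the largest coordinate. The centre of the
  tetrahedron shows that the level is sharp.\<close>

lemma cusp_near:
  assumes x: "future S x" "lor S x x = 1"
  shows "\<exists>v\<in>cusps. 4 * (lor S x v)\<^sup>2 \<le> 3"
proof -
  obtain g where g: "g \<in> carrier G" "\<forall>s\<in>S. act (inv g) x s \<ge> 0" using chamber_covering[of x] x by auto
  let ?y = "act (inv g) x"
  have "S \<noteq> {}" using card_S by auto
  then have "Max (?y ` S) \<in> ?y ` S" using finite_S by (intro Max_in) auto
  then obtain k where k: "k \<in> S" "?y k = Max (?y ` S)" by auto
  then have kmax: "\<forall>i\<in>S. ?y i \<le> ?y k" using finite_S by simp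
  have "card (S - {k}) = 3" using k card_S finite_S by simp
  then obtain p q r where pqr: "S - {k} = {p, q, r}" "p \<noteq> q" "q \<noteq> r" "p \<noteq> r" by (auto simp: card_3_iff)
  then have mem: "p \<in> S" "q \<in> S" "r \<in> S" by auto
  have S: "S = {k, p, q, r}" "k \<notin> {p, q, r}" using pqr k by auto
  have sumS: "(\<Sum>i\<in>S. f i) = f k + f p + f q + f r" for f :: "'a \<Rightarrow> real"
    using S(2) pqr by (subst S(1)) simp
  define M a b c where "M = ?y k" and "a = ?y p" and "b = ?y q" and "c = ?y r"
  have pos: "a \<ge> 0" "b \<ge> 0" "c \<ge> 0" "a \<le> M" "b \<le> M" "c \<le> M" using g kmax mem by (auto simp: M_def a_def b_def c_def)
  have t: "tau S ?y = M + a + b + c" by (simp add: tau_def sumS M_def a_def b_def c_def)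
  have "1 = lor S ?y ?y" using lor_act[of "inv g" x x] g x by simp
  also have "\<dots> = (M + a + b + c)\<^sup>2 - (M\<^sup>2 + a\<^sup>2 + b\<^sup>2 + c\<^sup>2)"
    by (simp add: lor_def t sumS M_def a_def b_def c_def power2_eq_square)
  finally have one: "1 = 2 * (M * a + M * b + M * c + (a * b + b * c + a * c))" by (simp add: power2_eq_square algebra_simps)
  have "a * a \<le> M * a" "b * b \<le> M * b" "c * c \<le> M * c" using pos by (auto intro: mult_right_mono)
  moreover have "a * b + b * c + a * c \<le> a * a + b * b + c * c"
    using sum_squares_ge_zero[of "a - b" "b - c"] zero_le_square[of "a - c"] by (simp add: algebra_simps)
  ultimately have "4 * (a + b + c)\<^sup>2 \<le> 3"
    using one by (simp add: power2_eq_square algebra_simps)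
  moreover have "lor S x (act g (unit_vec k)) = a + b + c"
    using g k t by (simp add: lor_act_left lor_unit finite_S M_def)
  ultimately show ?thesis using g k unfolding cusps_def by (metis (mono_tags, lifting) mem_Collect_eq)
qed

text \<open>Move \<open>v + w\<close>, of square 2, to \<open>y\<close> in the chamber. The image of
  each cusp has product 1 with \<open>y\<close>; if its products with all four vertices were at
  least 1, then \<open>tau S y \<le> 1\<close>, against square 2. So some product is 0 and the image
  is a vertex.\<close>

lemma cusp_edge:
  assumes v: "v \<in> cusps" and w: "w \<in> cusps" and vw: "lor S v w = 1"
  shows "\<exists>g\<in>carrier G. \<exists>i\<in>S. \<exists>j\<in>S. i \<noteq> j \<and> v = act g (unit_vec i) \<and> w = act g (unit_vec j)"
proof -
  define x where "x = (\<lambda>i. 1 * v i + 1 * w i)"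
  have wv: "lor S w v = 1" using vw by (simp add: lor_commute)
  have xx: "lor S x x = 2" unfolding x_def lor_lin1 lor_lin2 using cusp_null v w vw wv by simp
  have "future S x" using cusp_future[OF v] cusp_future[OF w] xx unfolding future_def by (simp add: x_def tau_def sum.distrib)
  then obtain g where g: "g \<in> carrier G" "\<forall>s\<in>S. act (inv g) x s \<ge> 0" using chamber_covering[of x] xx by auto
  let ?y = "act (inv g) x"
  have yint: "?y i \<in> \<int>" for i using g cusp_integral[OF v] cusp_integral[OF w] by (intro integral_act) (auto simp: x_def)
  have yy: "lor S ?y ?y = 2" using g xx by (simp add: lor_act)
  have *: "\<exists>i\<in>S. u = act g (unit_vec i)" if u: "u \<in> cusps" "lor S u x = 1" for u
  proof -
    let ?u = "act (inv g) u"
    have uc: "?u \<in> cusps" using g u act_cusp by simp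
    have a: "lor S ?u (unit_vec k) \<in> \<int>" "lor S ?u (unit_vec k) \<ge> 0" if "k \<in> S" for k
      using uc that cusp_integral cusp_future future_unit[OF finite_S that]
      by (auto intro!: lor_integral lor_nonneg simp: unit_vec_def)
    have sum1: "(\<Sum>k\<in>S. ?y k * lor S ?u (unit_vec k)) = 1"
    proof -
      have "(\<Sum>k\<in>S. ?y k * lor S ?u (unit_vec k)) = (\<Sum>k\<in>S. ?y k * (tau S ?u - ?u k))"
        using finite_S by (intro sum.cong) (auto simp: lor_unit)
      also have "\<dots> = lor S ?u ?y"
        by (simp add: lor_def right_diff_distrib sum_subtractf sum_distrib_right[symmetric] mult.commute)
          (simp add: tau_def mult.commute)
      also have "\<dots> = 1" using u g by (simp add: lor_act)
      finally show ?thesis .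
    qed
    have "\<exists>i\<in>S. lor S ?u (unit_vec i) = 0"
    proof (rule ccontr)
      assume no: "\<not> ?thesis"
      have "tau S ?y \<le> (\<Sum>k\<in>S. ?y k * lor S ?u (unit_vec k))"
        unfolding tau_def
      proof (intro sum_mono)
        fix k assume k: "k \<in> S"
        then have "lor S ?u (unit_vec k) \<ge> 1"
          using a[OF k] no by (auto elim!: Ints_cases)
        then show "?y k \<le> ?y k * lor S ?u (unit_vec k)" using g k mult_left_mono[of 1 _ "?y k"] by simp
      qed
      then have "tau S ?y \<le> 1" using sum1 by simp
      moreover have "tau S ?y \<ge> 0" using g by (auto simp: tau_def intro: sum_nonneg)
      ultimately have "tau S ?y * tau S ?y \<le> 1" by (simp add: mult_le_one)
      moreover have "(\<Sum>i\<in>S. ?y i * ?y i) \<ge> 0" by (intro sum_nonneg) auto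
      ultimately show False using yy by (simp add: lor_def)
    qed
    then obtain i where i: "i \<in> S" "lor S ?u (unit_vec i) = 0" by blast
    then have "?u = unit_vec i" using uc cusp_eq_unit by blast
    then show ?thesis using i g act_inv(2)[of g u] by metis
  qed
  obtain i where i: "i \<in> S" "v = act g (unit_vec i)"
    using *[OF v] cusp_null[OF v] vw unfolding x_def lor_lin2 by auto
  obtain j where j: "j \<in> S" "w = act g (unit_vec j)"
    using *[OF w] cusp_null[OF w] wv unfolding x_def lor_lin2 by auto
  have "i \<noteq> j" using i j vw cusp_null[OF v] by auto
  then show ?thesis using i j g by blast
qed

text \<open>Integrality does the work: \<open>lor_null_pair\<close> gives a product below 2, and
  distinct cusps have a positive one.\<close>

lemma cusp_adjacent:
  assumes "v \<in> cusps" "w \<in> cusps" "lor S x x = 1" "lor S x v * lor S x w < 1" "v \<noteq> w"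
  shows "lor S v w = 1"
proof -
  have i: "lor S v w \<in> \<int>" using assms cusp_integral by (intro lor_integral) auto
  have "lor S v w \<ge> 0" using assms cusp_future by (intro lor_nonneg) auto
  moreover have "lor S v w \<noteq> 0" using assms cusp_eqI by blast
  ultimately have pos: "lor S v w > 0" by simp
  then have "lor S v w < 2"
    using lor_null_pair[OF cusp_null[OF assms(1)] cusp_null[OF assms(2)] pos, of x] assms by simp
  then show ?thesis using i pos by (elim Ints_cases) auto
qed

end

section \<open>The potential on the cusps\<close>

context ideal_tetrahedron
begin

context
  fixes B a b c d
  assumes B: "l2_circulation B" and S: "S = {a, b, c, d}"
    and distinct: "a \<noteq> b" "a \<noteq> c" "a \<noteq> d" "b \<noteq> c" "b \<noteq> d" "c \<noteq> d"
begin

text \<open>The link of a vertex is the planar graph \<open>K\<^sub>4\<close>, so \<open>B g\<close> is the coboundary of a function on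
  its four faces; \<open>face_val g k\<close> is its value on the face opposite to \<open>k\<close>, normalised at \<open>d\<close>.\<close>
definition face_val :: "'a \<Rightarrow> 'a \<Rightarrow> real" where
  "face_val g k = (if k = a then B g b c else if k = b then B g c a else if k = c then B g a b else 0)"

lemma mem [simp]: "a \<in> S" "b \<in> S" "c \<in> S" "d \<in> S"
  using S by auto

lemma rows:
  assumes "g \<in> carrier G"
  shows "B g a b + B g a c + B g a d = 0" "B g b a + B g b c + B g b d = 0" "B g c a + B g c b + B g c d = 0"
    "B g d a + B g d b + B g d c = 0"
proof -
  have s: "(\<Sum>i\<in>S. f i) = f a + f b + f c + f d" for f :: "'a \<Rightarrow> real"
    using distinct by (subst S) simp
  show "B g a b + B g a c + B g a d = 0" "B g b a + B g b c + B g b d = 0" "B g c a + B g c b + B g c d = 0"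
    "B g d a + B g d b + B g d c = 0"
    using circ_row[OF B assms, of a] circ_row[OF B assms, of b] circ_row[OF B assms, of c] circ_row[OF B assms, of d]
      circ_diag[OF B assms]
    by (simp_all add: s)
qed

text \<open>The edge \<open>{c, d}\<close> of the link lies on exactly two faces, those opposite to
  \<open>a\<close> and \<open>b\<close>; the same holds for the other edges.\<close>

lemma face_diff:
  assumes "g \<in> carrier G"
  shows "face_val g a - face_val g b = B g c d" "face_val g b - face_val g c = B g a d" "face_val g c - face_val g a = B g b d"
    "face_val g a - face_val g d = B g b c" "face_val g b - face_val g d = B g c a" "face_val g c - face_val g d = B g a b"
  using rows[OF assms] distinct circ_anti[OF B assms, of b a] circ_anti[OF B assms, of c a] circ_anti[OF B assms, of c b]
  by (simp_all add: face_val_def)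

lemma face_val_step:
  assumes "g \<in> carrier G" "s \<in> S" "k \<in> S" "s \<noteq> k" "s \<noteq> d"
  shows "face_val (g \<otimes> s) k = face_val g k"
  using assms distinct circ_step[OF B assms(1), of b c s] circ_step[OF B assms(1), of c a s] circ_step[OF B assms(1), of a b s]
  by (auto simp: face_val_def S)

lemma face_val_step_d:
  assumes "g \<in> carrier G" "k \<in> {a, b, c}"
  shows "face_val g k - face_val (g \<otimes> d) k = face_val g a - face_val (g \<otimes> d) a"
proof -
  have "g \<otimes> d \<in> carrier G" using assms by simp
  then show ?thesis
    using assms face_diff(1,3)[OF assms(1)] face_diff(1,3)[of "g \<otimes> d"]
      circ_step[OF B assms(1), of c d d] circ_step[OF B assms(1), of b d d] by auto
qed

text \<open>Passing from \<open>g\<close> to \<open>g \<otimes> d\<close> shifts the values on the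
  three faces at \<open>d\<close> by a common amount, as the fourth face is normalised to 0 on both
  sides. \<open>pot\<close> collects these shifts along a word.\<close>

primrec pot :: "'a \<Rightarrow> 'a list \<Rightarrow> real" where
  "pot g [] = 0"
| "pot g (s # ws) = (if s = d then face_val g a - face_val (g \<otimes> s) a else 0) + pot (g \<otimes> s) ws"

lemma pot_append: "g \<in> carrier G \<Longrightarrow> u \<in> lists S \<Longrightarrow> pot g (u @ v) = pot g u + pot (g \<otimes> pw u) v"
  by (induction u arbitrary: g rule: list.induct) (auto simp: m_assoc)

text \<open>A face \<open>k\<close> meeting both letters turns \<open>pot\<close> into a telescoping
  sum, which vanishes around a relator. Two letters exclude at most two of \<open>a\<close>,
  \<open>b\<close>, \<open>c\<close>, so such a face always exists.\<close>

lemma pot_pair: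
  assumes "g \<in> carrier G" "ws \<in> lists {s, t}" "s \<in> S" "t \<in> S" "k \<in> {a, b, c}" "k \<noteq> s" "k \<noteq> t"
  shows "pot g ws = face_val g k - face_val (g \<otimes> pw ws) k"
  using assms(1,2)
proof (induction ws arbitrary: g rule: list.induct)
  case (Cons r ws)
  have r: "r \<in> S" "r \<in> {s, t}" and ws: "ws \<in> lists {s, t}" "ws \<in> lists S" using Cons.prems assms by auto
  have "pot (g \<otimes> r) ws = face_val (g \<otimes> r) k - face_val (g \<otimes> r \<otimes> pw ws) k"
    using Cons.IH[of "g \<otimes> r"] Cons.prems r ws by simp
  moreover have "(if r = d then face_val g a - face_val (g \<otimes> r) a else 0) = face_val g k - face_val (g \<otimes> r) k"
    using face_val_step[OF Cons.prems(1) r(1), of k] face_val_step_d[OF Cons.prems(1) assms(5)] r assms by auto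
  ultimately show ?case using Cons.prems r ws by (simp add: m_assoc)
qed auto

lemma pot_eq:
  assumes "u \<in> lists S" "v \<in> lists S" "pw u = pw v" shows "pot \<one> u = pot \<one> v"
proof (rule word_function_eqI[where F = "pot \<one>", OF assms])
  fix x y s assume "x \<in> lists S" "y \<in> lists S" "s \<in> S"
  then show "pot \<one> (x @ [s, s] @ y) = pot \<one> (x @ y)" by (simp add: pot_append)
next
  fix x y s t assume *: "x \<in> lists S" "y \<in> lists S" "s \<in> S" "t \<in> S" "s \<noteq> t"
  define z where "z = concat (replicate 3 [s, t])"
  have z: "z \<in> lists S" "z \<in> lists {s, t}" using * by (auto simp: z_def split: if_splits)
  have pz: "pw z = \<one>" using * by (simp add: z_def pw_replicate pow_m)
  have "\<exists>k\<in>{a, b, c}. k \<noteq> s \<and> k \<noteq> t" using distinct by (cases "s = a"; cases "t = a"; cases "s = b"; cases "t = b") auto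
  then obtain k where k: "k \<in> {a, b, c}" "k \<noteq> s" "k \<noteq> t" by blast
  have "pot (pw x) z = 0" using pot_pair[of "pw x" z s t k] * z k pz by simp
  then show "pot \<one> (x @ concat (replicate 3 [s, t]) @ y) = pot \<one> (x @ y)"
    unfolding z_def[symmetric] using * z pz by (simp add: pot_append)
qed

definition potential :: "'a \<Rightarrow> 'a \<Rightarrow> real" where
  "potential g k = pot \<one> (SOME ws. ws \<in> lists S \<and> pw ws = g) + face_val g k"

lemma potential_pw: assumes "ws \<in> lists S" shows "potential (pw ws) k = pot \<one> ws + face_val (pw ws) k"
proof -
  have *: "(SOME vs. vs \<in> lists S \<and> pw vs = pw ws) \<in> lists S \<and> pw (SOME vs. vs \<in> lists S \<and> pw vs = pw ws) = pw ws"
    by (rule someI[of _ ws]) (use assms in auto)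
  have "pot \<one> (SOME vs. vs \<in> lists S \<and> pw vs = pw ws) = pot \<one> ws"
    by (rule pot_eq[OF conjunct1[OF *] assms conjunct2[OF *]])
  then show ?thesis unfolding potential_def by (rule arg_cong)
qed

text \<open>The generators other than \<open>k\<close> fix \<open>unit_vec k\<close>; this is the
  invariance that \<open>cusp_stabilizer\<close> needs to turn \<open>potential\<close> into a
  function on cusps.\<close>

lemma potential_step:
  assumes "g \<in> carrier G" "s \<in> S" "k \<in> S" "s \<noteq> k"
  shows "potential (g \<otimes> s) k = potential g k"
proof -
  obtain ws where ws: "ws \<in> lists S" "pw ws = g" using ex_word[OF assms(1)] by (elim bexE)
  have "potential (g \<otimes> s) k = pot \<one> (ws @ [s]) + face_val (g \<otimes> s) k"
    using potential_pw[of "ws @ [s]" k] ws assms by (simp add: pw_append)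
  moreover have "potential g k = pot \<one> ws + face_val g k" using potential_pw[of ws k] ws by simp
  moreover have "s = d \<Longrightarrow> k \<in> {a, b, c}" using assms S by auto
  ultimately show ?thesis
    using ws assms face_val_step[OF assms] face_val_step_d[OF assms(1), of k] by (auto simp: pot_append)
qed

lemma potential_diff: "potential g i - potential g j = face_val g i - face_val g j"
  by (simp add: potential_def)

definition energy_at :: "'a \<Rightarrow> real" where "energy_at g = (\<Sum>s\<in>S. \<Sum>t\<in>S. (B g s t)\<^sup>2)"

lemma energy_at_summable: "energy_at summable_on carrier G"
  unfolding energy_at_def using circ_summable[OF B] finite_S by (intro summable_on_finite_sum) auto

lemma potential_diff_le:
  assumes g: "g \<in> carrier G" and ij: "i \<in> S" "j \<in> S"
  shows "(potential g i - potential g j)\<^sup>2 \<le> energy_at g"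
proof -
  have le: "(B g s t)\<^sup>2 \<le> energy_at g" if "s \<in> S" "t \<in> S" for s t
  proof -
    have "(B g s t)\<^sup>2 \<le> (\<Sum>t\<in>S. (B g s t)\<^sup>2)" using finite_S that by (intro member_le_sum) auto
    also have "\<dots> \<le> energy_at g" unfolding energy_at_def
      using finite_S that by (intro member_le_sum) (auto intro: sum_nonneg)
    finally show ?thesis .
  qed
  have P: "(face_val g i - face_val g j)\<^sup>2 \<le> energy_at g"
    if "(i, j) \<in> {(a, b), (b, c), (c, a), (a, d), (b, d), (c, d)}" for i j
    using that face_diff[OF g] le[OF mem(3,4)] le[OF mem(1,4)] le[OF mem(2,4)] le[OF mem(2,3)] le[OF mem(3,1)] le[OF mem(1,2)]
    by (elim insertE emptyE) simp_all
  have "i = j \<or> (i, j) \<in> {(a, b), (b, c), (c, a), (a, d), (b, d), (c, d)} \<or>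
      (j, i) \<in> {(a, b), (b, c), (c, a), (a, d), (b, d), (c, d)}"
    using ij unfolding S by auto
  moreover have "0 \<le> energy_at g" by (auto simp: energy_at_def intro!: sum_nonneg)
  ultimately show ?thesis
    unfolding potential_diff using P[of i j] P[of j i] power2_commute[of "face_val g i" "face_val g j"] by auto
qed

definition cusp_val :: "('a \<Rightarrow> real) \<Rightarrow> real" where
  "cusp_val v = (SOME y. \<exists>g\<in>carrier G. \<exists>k\<in>S. v = act g (unit_vec k) \<and> y = potential g k)"

lemma cusp_val_act:
  assumes "g \<in> carrier G" "k \<in> S" shows "cusp_val (act g (unit_vec k)) = potential g k"
proof -
  have "\<exists>g'\<in>carrier G. \<exists>k'\<in>S. act g (unit_vec k) = act g' (unit_vec k') \<and> cusp_val (act g (unit_vec k)) = potential g' k'"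
    unfolding cusp_val_def
    by (rule someI_ex[of "\<lambda>y. \<exists>g'\<in>carrier G. \<exists>k'\<in>S. act g (unit_vec k) = act g' (unit_vec k') \<and> y = potential g' k'"])
      (intro exI[of _ "potential g k"] bexI[OF _ assms(1)] bexI[OF _ assms(2)] conjI refl)
  then obtain g' k' where *: "g' \<in> carrier G" "k' \<in> S" "act g (unit_vec k) = act g' (unit_vec k')"
    "cusp_val (act g (unit_vec k)) = potential g' k'" by blast
  have e: "act (inv g \<otimes> g') (unit_vec k') = unit_vec k"
    using * assms by (simp add: act_mult *(3)[symmetric])
  have "inv g \<otimes> g' \<in> carrier G" using * assms by simp
  then have "potential (g \<otimes> (inv g \<otimes> g')) k' = potential g k"
    using cusp_stabilizer[where Phi = potential, OF _ *(2) assms(2) e assms(1) potential_step] by simp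
  then show ?thesis using * assms by simp
qed

text \<open>Each adjacent pair is an edge of some chamber by \<open>cusp_edge\<close>. The chamber
  and the two vertices recover the pair, so a chamber is chosen by at most \<open>4 * 4 = 16\<close>
  ordered pairs.\<close>

lemma cusp_val_energy:
  assumes E: "finite E" "\<And>v w. (v, w) \<in> E \<Longrightarrow> v \<in> cusps \<and> w \<in> cusps \<and> lor S v w = 1"
  shows "(\<Sum>(v, w)\<in>E. (cusp_val v - cusp_val w)\<^sup>2) \<le> 16 * infsum energy_at (carrier G)"
proof -
  have "\<forall>p\<in>E. \<exists>h. fst h \<in> carrier G \<and> fst (snd h) \<in> S \<and> snd (snd h) \<in> S \<and>
      p = (act (fst h) (unit_vec (fst (snd h))), act (fst h) (unit_vec (snd (snd h))))"
  proof
    fix p assume "p \<in> E"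
    moreover obtain v w where p: "p = (v, w)" by fastforce
    ultimately obtain g i j where "g \<in> carrier G" "i \<in> S" "j \<in> S" "v = act g (unit_vec i)" "w = act g (unit_vec j)"
      using cusp_edge[of v w] E(2)[of v w] by blast
    then show "\<exists>h. fst h \<in> carrier G \<and> fst (snd h) \<in> S \<and> snd (snd h) \<in> S \<and>
      p = (act (fst h) (unit_vec (fst (snd h))), act (fst h) (unit_vec (snd (snd h))))"
      using p by (intro exI[of _ "(g, i, j)"]) simp
  qed
  then obtain h where h: "\<And>p. p \<in> E \<Longrightarrow> fst (h p) \<in> carrier G \<and> fst (snd (h p)) \<in> S \<and> snd (snd (h p)) \<in> S \<and>
      p = (act (fst (h p)) (unit_vec (fst (snd (h p)))), act (fst (h p)) (unit_vec (snd (snd (h p)))))"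
    by metis
  have inj: "inj_on h E"
  proof (rule inj_onI)
    fix p p' assume "p \<in> E" "p' \<in> E" "h p = h p'"
    then show "p = p'" using h[of p] h[of p'] by simp
  qed
  define X where "X = fst ` h ` E"
  have X: "finite X" "X \<subseteq> carrier G" using E h by (auto simp: X_def)
  have en0: "energy_at x \<ge> 0" for x by (auto simp: energy_at_def intro!: sum_nonneg)
  have "(\<Sum>(v, w)\<in>E. (cusp_val v - cusp_val w)\<^sup>2) \<le> (\<Sum>p\<in>E. energy_at (fst (h p)))"
  proof (intro sum_mono)
    fix p assume p: "p \<in> E"
    obtain g i j where hp: "h p = (g, i, j)" by (metis prod_cases3)
    then have *: "g \<in> carrier G" "i \<in> S" "j \<in> S" "p = (act g (unit_vec i), act g (unit_vec j))" using h[OF p] by simp_all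
    have "fst (h p) = g" using hp by simp
    with *(4) show "(case p of (v, w) \<Rightarrow> (cusp_val v - cusp_val w)\<^sup>2) \<le> energy_at (fst (h p))"
      using potential_diff_le[OF *(1-3)] *(1-3) by (simp only: prod.case cusp_val_act)
  qed
  also have "\<dots> = (\<Sum>q\<in>h ` E. energy_at (fst q))" using inj by (simp add: sum.reindex)
  also have "\<dots> \<le> (\<Sum>q\<in>X \<times> S \<times> S. energy_at (fst q))"
  proof (rule sum_mono2)
    show "h ` E \<subseteq> X \<times> S \<times> S"
    proof
      fix q assume "q \<in> h ` E"
      then obtain p where p: "p \<in> E" "q = h p" by blast
      then have "fst q \<in> X" by (auto simp: X_def)
      then show "q \<in> X \<times> S \<times> S" using h[OF p(1)] p(2) by (simp add: mem_Times_iff)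
    qed
  qed (use X finite_S en0 in auto)
  also have "\<dots> = (\<Sum>x\<in>X. \<Sum>q\<in>S \<times> S. energy_at x)"
    using sum.cartesian_product[of "\<lambda>x q. energy_at x" "S \<times> S" X] by (simp add: split_def)
  also have "\<dots> = 16 * (\<Sum>x\<in>X. energy_at x)" by (simp add: card_cartesian_product card_S sum_distrib_left)
  also have "\<dots> \<le> 16 * infsum energy_at (carrier G)"
    using finite_sum_le_infsum[OF energy_at_summable X] en0 by simp
  finally show ?thesis .
qed

end
end

section \<open>Equidistant curves\<close>

text \<open>The \<open>i\<close>-th sample point on the \<open>j\<close>-th curve of the tube of index \<open>k\<close> is \<open>lam e\<^sub>a + mu e\<^sub>b + u\<close>, where
  \<open>u = (-(R + j), -(R + j), R, j)\<close> with \<open>R = rad k\<close> is orthogonal to both cusps \<open>e\<^sub>a\<close>, \<open>e\<^sub>b\<close> and has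
  square \<open>- usq k j\<close>.  The form takes the value \<open>rayform\<close> on two sample points.\<close>

definition rad :: "nat \<Rightarrow> real" where "rad k = 32 ^ k"
definition usq :: "nat \<Rightarrow> nat \<Rightarrow> real" where "usq k j = (rad k + j)\<^sup>2 + (rad k)\<^sup>2 + (real j)\<^sup>2"
definition udot :: "nat \<Rightarrow> nat \<Rightarrow> nat \<Rightarrow> nat \<Rightarrow> real" where
  "udot k j k' j' = (rad k + j) * (rad k' + j') + rad k * rad k' + real j * real j'"
text \<open>\<open>lam\<close> climbs from 1/2 to \<open>usq + 1\<close> while \<open>mu\<close>
  falls from \<open>usq + 1\<close> to 1/2, with \<open>2 lam mu = usq + 1\<close> throughout, so a
  curve leads from a horoball at \<open>unit_vec b\<close> to one at \<open>unit_vec a\<close>. The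
  factor 200 makes consecutive sample points about equally and sufficiently close.\<close>

definition steps :: "nat \<Rightarrow> nat" where "steps k = 200 * k * 32 ^ k"
definition incr :: "nat \<Rightarrow> nat \<Rightarrow> real" where "incr k j = ln (2 * (usq k j + 1)) / steps k"
definition lam :: "nat \<Rightarrow> nat \<Rightarrow> nat \<Rightarrow> real" where "lam k j i = exp (i * incr k j) / 2"
definition mu :: "nat \<Rightarrow> nat \<Rightarrow> nat \<Rightarrow> real" where "mu k j i = (usq k j + 1) * exp (- (i * incr k j))"
definition rayform :: "nat \<Rightarrow> nat \<Rightarrow> nat \<Rightarrow> nat \<Rightarrow> nat \<Rightarrow> nat \<Rightarrow> real" where
  "rayform k j i k' j' i' = lam k j i * mu k' j' i' + lam k' j' i' * mu k j i - udot k j k' j'"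

lemma rad_ge: "k \<ge> 1 \<Longrightarrow> rad k \<ge> 32"
  unfolding rad_def using power_increasing[of 1 k "32::real"] by simp

lemma rad_sq_ge: "k \<ge> 1 \<Longrightarrow> (rad k)\<^sup>2 \<ge> 1024"
  using power_mono[of 32 "rad k" 2] rad_ge[of k] by simp

lemma usq_bounds:
  assumes "k \<ge> 1" "real j \<le> rad k"
  shows "2 * (rad k)\<^sup>2 \<le> usq k j" "usq k j \<le> 6 * (rad k)\<^sup>2" "usq k j + 1 \<le> 7 * (rad k)\<^sup>2"
    "usq k j \<ge> 2048"
proof -
  have R: "rad k \<ge> 32" using rad_ge assms by simp
  have "(rad k)\<^sup>2 \<le> (rad k + j)\<^sup>2" using R by (intro power_mono) auto
  then show 1: "2 * (rad k)\<^sup>2 \<le> usq k j" unfolding usq_def using zero_le_power2[of "real j"] by linarith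
  have "(rad k + j)\<^sup>2 \<le> (2 * rad k)\<^sup>2" using R assms by (intro power_mono) auto
  moreover have "(real j)\<^sup>2 \<le> (rad k)\<^sup>2" using assms by (intro power_mono) auto
  ultimately show 2: "usq k j \<le> 6 * (rad k)\<^sup>2" by (simp add: usq_def)
  have "32\<^sup>2 \<le> (rad k)\<^sup>2" using R by (intro power_mono) auto
  then show "usq k j + 1 \<le> 7 * (rad k)\<^sup>2" "usq k j \<ge> 2048" using 1 2 by simp_all
qed

lemma steps_pos: "k \<ge> 1 \<Longrightarrow> steps k > 0"
  by (simp add: steps_def)

text \<open>As \<open>ln (rad k) = 5 k ln 2\<close>, the logarithm in \<open>incr\<close> lies
  between \<open>6 k\<close> and \<open>10 k\<close>; division by \<open>200 k\<close> gives both
  bounds. Since \<open>usq\<close> is of order \<open>rad\<close> squared, \<open>incr * rad\<close>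
  measures the hyperbolic length of a step.\<close>

lemma incr_bounds:
  assumes "k \<ge> 1" "real j \<le> rad k"
  shows "3 / 100 \<le> incr k j * rad k" "incr k j * rad k \<le> 1 / 20"
proof -
  let ?P = "usq k j + 1"
  have R: "rad k \<ge> 32" using rad_ge assms by simp
  have lnR: "ln (rad k) = 5 * k * ln 2"
  proof -
    have "rad k = 2 ^ (5 * k)" by (simp add: rad_def power_mult)
    then show ?thesis by (simp add: ln_realpow)
  qed
  have l2: "2/3 \<le> ln (2::real)" "ln (2::real) \<le> 25/36" using ln2_ge_two_thirds ln2_le_25_over_36 by auto
  have "2 * ln (rad k) = ln ((rad k)\<^sup>2)" using R by (simp add: ln_realpow)
  also have "\<dots> \<le> ln (2 * ?P)"
  proof -
    have "0 < (rad k)\<^sup>2" using R by simp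
    have "(rad k)\<^sup>2 \<le> 2 * (rad k)\<^sup>2" by simp
    also have "\<dots> \<le> usq k j" by (rule usq_bounds(1)[OF assms])
    also have "\<dots> \<le> 2 * ?P" using usq_bounds(4)[OF assms] by simp
    finally show ?thesis using \<open>0 < (rad k)\<^sup>2\<close> by (intro ln_mono) auto
  qed
  finally have lower: "ln (2 * ?P) \<ge> 6 * k" using lnR l2 mult_left_mono[of "2/3" "ln 2" "10 * real k"] by simp
  have "ln (2 * ?P) \<le> ln (2 ^ 4 * (rad k)\<^sup>2)"
    using usq_bounds[OF assms] R by (intro ln_mono) auto
  also have "\<dots> = 4 * ln 2 + 2 * ln (rad k)" using R by (simp add: ln_mult ln_realpow del: power_numeral)
  finally have "ln (2 * ?P) \<le> (4 + 10 * k) * ln 2" using lnR by (simp add: algebra_simps)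
  also have "\<dots> \<le> (4 + 10 * k) * (25/36)" using l2 by (intro mult_left_mono) auto
  also have "\<dots> \<le> 10 * k" using assms by simp
  finally have upper: "ln (2 * ?P) \<le> 10 * k" .
  have e: "incr k j * rad k = ln (2 * ?P) / (200 * k)"
    using assms by (simp add: incr_def steps_def rad_def)
  show "3 / 100 \<le> incr k j * rad k" "incr k j * rad k \<le> 1 / 20"
    unfolding e using lower upper assms by (simp_all add: field_simps)
qed

lemma lam_mu: "2 * (lam k j i * mu k j i) = usq k j + 1"
proof -
  have "2 * (lam k j i * mu k j i) = (usq k j + 1) * (exp (i * incr k j) * exp (- (i * incr k j)))"
    by (simp add: lam_def mu_def)
  then show ?thesis by (simp only: exp_minus_inverse) simp
qed

lemma lam_pos: "lam k j i > 0"
  by (simp add: lam_def)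

lemma mu_pos: "mu k j i > 0"
  by (simp add: mu_def usq_def add_nonneg_pos)

lemma rayform_self: "rayform k j i k j i = 1"
  using lam_mu[of k j i] by (simp add: rayform_def usq_def udot_def power2_eq_square)

lemma rayform_same:
  "rayform k j i k j i' = (usq k j + 1) / 2 * (exp ((real i - real i') * incr k j) + exp (- ((real i - real i') * incr k j)) - 2) + 1"
proof -
  have "lam k j i * mu k j i' = (usq k j + 1) / 2 * exp ((real i - real i') * incr k j)"
    by (simp add: lam_def mu_def exp_add[symmetric] left_diff_distrib exp_diff exp_minus field_simps)
  moreover have "lam k j i' * mu k j i = (usq k j + 1) / 2 * exp (- ((real i - real i') * incr k j))"
    by (simp add: lam_def mu_def exp_add[symmetric] left_diff_distrib exp_diff exp_minus field_simps)
  moreover have "udot k j k j = usq k j" by (simp add: usq_def udot_def power2_eq_square)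
  ultimately show ?thesis by (simp add: rayform_def algebra_simps add_divide_distrib)
qed

text \<open>The estimates give \<open>1 + 7 / 400\<close>, which is below the threshold 41/40 of
  \<open>lor_step\<close>.\<close>

lemma rayform_step:
  assumes "k \<ge> 1" "real j \<le> rad k"
  shows "rayform k j i k j (Suc i) \<le> 41 / 40"
proof -
  define t where "t = incr k j"
  have R: "rad k \<ge> 32" using rad_ge assms by simp
  have "0 < t * rad k" using incr_bounds(1)[OF assms] by (simp add: t_def)
  then have t: "0 < t" "t * rad k \<le> 1/20" using incr_bounds(2)[OF assms] R zero_less_mult_pos2[of t "rad k"]
    by (simp_all add: t_def)
  have "t * 32 \<le> t * rad k" using R t by (intro mult_left_mono) auto
  then have t1: "t \<le> 1" using t by linarith
  have e1: "exp t \<le> 1 + t + t\<^sup>2" using exp_bound[of t] t t1 by simp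
  have "1 + t \<le> exp t" by (rule exp_ge_add_one_self)
  then have "exp (- t) \<le> 1 / (1 + t)" using t by (simp add: exp_minus field_simps)
  also have "\<dots> \<le> 1 - t + t\<^sup>2"
  proof -
    have "(1 - t + t\<^sup>2) * (1 + t) = 1 + t ^ 3" by (simp add: algebra_simps power2_eq_square power3_eq_cube)
    then show ?thesis using t by (simp add: pos_divide_le_eq)
  qed
  finally have "exp t + exp (- t) - 2 \<le> 2 * t\<^sup>2" using e1 by simp
  then have "rayform k j i k j (Suc i) \<le> (usq k j + 1) / 2 * (2 * t\<^sup>2) + 1"
    unfolding rayform_same using usq_bounds(4)[OF assms] mult_left_mono[of _ "2 * t\<^sup>2" "(usq k j + 1) / 2"]
    by (simp add: t_def add.commute)
  also have "\<dots> \<le> 7 * (rad k)\<^sup>2 * t\<^sup>2 + 1"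
    using usq_bounds(3)[OF assms] by (simp add: mult_right_mono)
  also have "\<dots> = 7 * (t * rad k)\<^sup>2 + 1" by (simp add: power_mult_distrib)
  also have "\<dots> \<le> 7 * (1/20)\<^sup>2 + 1"
    using t R power_mono[of "t * rad k" "1/20" 2] by simp
  finally show ?thesis by (simp add: power2_eq_square)
qed

text \<open>Beyond 100 steps \<open>s * rad\<close> is at least \<open>100 * 3/100 = 3\<close>, and
  its square 9 exceeds the 8 allowed by the form.\<close>

lemma rayform_sparse_i:
  assumes "k \<ge> 1" "real j \<le> rad k" "rayform k j i k j i' \<le> 5" "i' \<le> i"
  shows "i - i' \<le> 100"
proof (rule ccontr)
  assume "\<not> ?thesis"
  define s where "s = (real i - real i') * incr k j"
  have R: "rad k \<ge> 32" using rad_ge assms by simp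
  have t: "3/100 \<le> incr k j * rad k" using incr_bounds[OF assms(1,2)] by simp
  have "real i - real i' \<ge> 100" using \<open>\<not> _\<close> by linarith
  then have "100 * (3/100) \<le> (real i - real i') * (incr k j * rad k)" using t by (intro mult_mono) auto
  then have s3: "3 \<le> s * rad k" by (simp add: s_def mult.assoc)
  then have s0: "s \<ge> 0" using R by (smt (verit) mult_nonpos_nonneg)
  have "exp s + exp (- s) \<ge> 2 + s\<^sup>2 / 2"
    using exp_lower_Taylor_quadratic[OF s0] exp_ge_add_one_self[of "- s"] by simp
  then have "(usq k j + 1) / 2 * (s\<^sup>2 / 2) \<le> (usq k j + 1) / 2 * (exp s + exp (- s) - 2)"
    using usq_bounds(4)[OF assms(1,2)] by (intro mult_left_mono) auto
  also have "\<dots> \<le> 4" using assms(3) unfolding rayform_same s_def[symmetric] by simp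
  finally have "(usq k j + 1) * s\<^sup>2 \<le> 16" by simp
  moreover have "2 * (rad k)\<^sup>2 * s\<^sup>2 \<le> (usq k j + 1) * s\<^sup>2"
    using usq_bounds(1)[OF assms(1,2)] by (intro mult_right_mono) auto
  ultimately have "(s * rad k)\<^sup>2 \<le> 8" by (simp add: power_mult_distrib mult.commute)
  moreover have "3\<^sup>2 \<le> (s * rad k)\<^sup>2" using s3 by (intro power_mono) auto
  ultimately show False by simp
qed

text \<open>The positions \<open>i\<close>, \<open>i'\<close> along the curves are eliminated by the
  inequality of arithmetic and geometric means for the two mixed products \<open>A\<close>,
  \<open>A'\<close>, whose product depends on the curves only.\<close>

lemma rayform_bound:
  assumes "rayform k j i k' j' i' \<le> 5"
  shows "usq k j * usq k' j' + usq k j + usq k' j' \<le> (udot k j k' j')\<^sup>2 + 10 * udot k j k' j' + 24"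
proof -
  define A where "A = lam k j i * mu k' j' i'"
  define A' where "A' = lam k' j' i' * mu k j i"
  have pos: "A > 0" "A' > 0" using lam_pos mu_pos by (simp_all add: A_def A'_def)
  have "(usq k j + 1) * (usq k' j' + 1) = 4 * (A * A')"
    using lam_mu[of k j i, symmetric] lam_mu[of k' j' i', symmetric] by (simp add: A_def A'_def)
  also have "\<dots> \<le> (A + A')\<^sup>2" using zero_le_power2[of "A - A'"] by (simp add: power2_eq_square algebra_simps)
  also have "\<dots> \<le> (5 + udot k j k' j')\<^sup>2"
    using assms pos by (intro power_mono) (auto simp: rayform_def A_def A'_def)
  finally show ?thesis by (simp add: power2_eq_square algebra_simps)
qed

text \<open>The Gram determinant of the two vectors \<open>u\<close> is
  \<open>3 R^2 (j - j')^2\<close>, whereas \<open>rayform_bound\<close> allows it at most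
  \<open>49 R^2\<close>; a gap of 5 would give 75.\<close>

lemma rayform_sparse_j:
  assumes "k \<ge> 1" "real j \<le> rad k" "real j' \<le> rad k" "rayform k j i k j' i' \<le> 5"
  shows "\<bar>real j - real j'\<bar> \<le> 4"
proof -
  let ?U = "usq k j" and ?U' = "usq k j'" and ?w = "udot k j k j'" and ?R = "rad k"
  have R: "?R \<ge> 32" using rad_ge assms by simp
  have gram: "?U * ?U' - ?w\<^sup>2 = 3 * ?R\<^sup>2 * (real j - real j')\<^sup>2"
    by (simp add: usq_def udot_def power2_eq_square algebra_simps)
  have "?U + ?U' - 2 * ?w = ((?R + j) - (?R + j'))\<^sup>2 + (real j - real j')\<^sup>2"
    by (simp add: usq_def udot_def power2_eq_square algebra_simps)
  then have "2 * ?w \<le> ?U + ?U'" by (smt (verit) zero_le_power2)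
  then have "3 * ?R\<^sup>2 * (real j - real j')\<^sup>2 \<le> 4 * (?U + ?U') + 24"
    using rayform_bound[OF assms(4)] gram by simp
  also have "\<dots> \<le> 48 * ?R\<^sup>2 + 24" using usq_bounds(2)[OF assms(1,2)] usq_bounds(2)[OF assms(1,3)] by simp
  also have "\<dots> \<le> 49 * ?R\<^sup>2" using power_mono[of 32 ?R 2] R by simp
  finally have "?R\<^sup>2 * (3 * (real j - real j')\<^sup>2) \<le> ?R\<^sup>2 * 49" by (simp add: algebra_simps)
  then have "3 * (real j - real j')\<^sup>2 \<le> 49"
  proof (rule mult_left_le_imp_le)
    show "0 < ?R\<^sup>2" using R by simp
  qed
  then have "\<not> (5::real)\<^sup>2 \<le> (real j - real j')\<^sup>2" by simp
  then have "\<bar>real j - real j'\<bar> < 5" using abs_le_square_iff[of 5 "real j - real j'"] by simp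
  then have "j < j' + 5" "j' < j + 5" by linarith+
  then show ?thesis by linarith
qed

text \<open>The ratio 32 makes \<open>usq\<close> grow at least by the factor 256, so
  \<open>udot\<close> is at most a sixteenth of the larger \<open>usq\<close>. That is too small for
  \<open>rayform_bound\<close>.\<close>

lemma rayform_sparse_k:
  assumes "1 \<le> k" "k < k'" "real j \<le> rad k" "real j' \<le> rad k'" "rayform k j i k' j' i' \<le> 5"
  shows False
proof -
  let ?U = "usq k j" and ?U' = "usq k' j'" and ?w = "udot k j k' j'"
  have k': "1 \<le> k'" using assms by simp
  have "rad (Suc k) \<le> rad k'" unfolding rad_def using assms by (intro power_increasing) auto
  then have RR: "32 * rad k \<le> rad k'" by (simp add: rad_def)
  have R: "rad k \<ge> 32" using rad_ge assms by simp
  have "(32 * rad k)\<^sup>2 \<le> (rad k')\<^sup>2" using RR R by (intro power_mono) auto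
  then have UU: "256 * ?U \<le> ?U'"
    using usq_bounds(2)[OF assms(1,3)] usq_bounds(1)[OF k' assms(4)] rad_sq_ge[OF assms(1)]
    by (simp add: power_mult_distrib)
  have cs: "?w\<^sup>2 \<le> ?U * ?U'"
  proof -
    have "?U * ?U' - ?w\<^sup>2 = 3 * (rad k * j' - rad k' * j)\<^sup>2"
      by (simp add: usq_def udot_def power2_eq_square algebra_simps)
    then show ?thesis by (smt (verit) zero_le_power2)
  qed
  also have "\<dots> \<le> (?U' / 256) * ?U'" using UU usq_bounds(4)[OF k' assms(4)] by (intro mult_right_mono) auto
  also have "\<dots> = (?U' / 16)\<^sup>2" by (simp add: power2_eq_square)
  finally have "?w \<le> ?U' / 16" using usq_bounds(4)[OF k' assms(4)] by (elim power2_le_imp_le) simp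
  moreover have "?U + ?U' \<le> 10 * ?w + 24" using rayform_bound[OF assms(5)] cs by simp
  ultimately show False using usq_bounds(4)[OF k' assms(4)] usq_bounds(4)[OF assms(1,3)] by simp
qed

lemma card_le_diameter:
  fixes A :: "nat set"
  assumes "\<And>i i'. i \<in> A \<Longrightarrow> i' \<in> A \<Longrightarrow> i' \<le> i \<Longrightarrow> i - i' \<le> n"
  shows "card A \<le> Suc n"
proof (cases "A = {}")
  case False
  define i0 where "i0 = (LEAST i. i \<in> A)"
  have i0: "i0 \<in> A" unfolding i0_def using False by (auto intro: LeastI)
  have "A \<subseteq> {i0..i0 + n}"
  proof
    fix i assume i: "i \<in> A"
    then have "i0 \<le> i" unfolding i0_def by (rule Least_le)
    then show "i \<in> {i0..i0 + n}" using assms[OF i i0] by auto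
  qed
  then have "card A \<le> card {i0..i0 + n}" by (intro card_mono) auto
  then show ?thesis by simp
qed auto

text \<open>One value of \<open>k\<close>, at most 5 values of \<open>j\<close>, and for each of
  them at most 101 values of \<open>i\<close>.\<close>

lemma sparse_card:
  assumes "finite X"
    and X: "\<And>k j i. (k, j, i) \<in> X \<Longrightarrow> 1 \<le> k \<and> real j \<le> rad k"
    and close: "\<And>k j i k' j' i'. (k, j, i) \<in> X \<Longrightarrow> (k', j', i') \<in> X \<Longrightarrow> rayform k j i k' j' i' \<le> 5"
  shows "card X \<le> 505"
proof (cases "X = {}")
  case False
  then obtain k0 where k0: "k0 \<in> fst ` X" by blast
  have k: "k = k0" if "(k, j, i) \<in> X" for k j i
  proof -
    obtain j' i' where "(k0, j', i') \<in> X" using k0 by auto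
    note * = X[OF that] X[OF this] close[OF that this] close[OF this that]
    show ?thesis
    proof (rule linorder_cases[of k k0])
      show "k = k0" if "k < k0" using rayform_sparse_k[of k k0 j j' i i'] that * by blast
      show "k = k0" if "k0 < k" using rayform_sparse_k[of k0 k j' j i' i] that * by blast
    qed
  qed
  define J where "J = (\<lambda>(k, j, i). j) ` X"
  have "card J \<le> Suc 4"
  proof (rule card_le_diameter)
    have ex: "\<exists>i. (k0, j, i) \<in> X" if j: "j \<in> J" for j
    proof -
      obtain k i where "(k, j, i) \<in> X" using j unfolding J_def by (elim imageE) (auto split: prod.splits)
      then show ?thesis using k by blast
    qed
    fix j j' assume "j \<in> J" "j' \<in> J" "j' \<le> j"
    then obtain i i' where *: "(k0, j, i) \<in> X" "(k0, j', i') \<in> X" using ex by blast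
    have "\<bar>real j - real j'\<bar> \<le> 4"
      using rayform_sparse_j[of k0 j j' i i'] X[OF *(1)] X[OF *(2)] close[OF *] by blast
    then show "j - j' \<le> 4" using \<open>j' \<le> j\<close> by linarith
  qed
  have "card {i. (k0, j, i) \<in> X} \<le> Suc 100" for j
  proof (rule card_le_diameter)
    fix i i' assume "i \<in> {i. (k0, j, i) \<in> X}" "i' \<in> {i. (k0, j, i) \<in> X}" "i' \<le> i"
    then show "i - i' \<le> 100" using rayform_sparse_i[of k0 j i i'] X[of k0 j i] close[of k0 j i k0 j i'] by auto
  qed
  note cardI = this
  have finI: "finite {i. (k0, j, i) \<in> X}" for j
    using finite_vimageI[OF assms(1), of "\<lambda>i. (k0, j, i)"] by (simp add: vimage_def inj_on_def)
  have finJ: "finite J" using assms by (simp add: J_def)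
  have sub: "X \<subseteq> (\<lambda>(j, i). (k0, j, i)) ` (SIGMA j:J. {i. (k0, j, i) \<in> X})"
  proof
    fix p assume p: "p \<in> X"
    obtain k j i where e: "p = (k, j, i)" by (metis prod_cases3)
    have "k = k0" using k p e by blast
    moreover have "j \<in> J" using p e by (force simp: J_def)
    ultimately show "p \<in> (\<lambda>(j, i). (k0, j, i)) ` (SIGMA j:J. {i. (k0, j, i) \<in> X})" using p e by force
  qed
  have finS: "finite (SIGMA j:J. {i. (k0, j, i) \<in> X})" using finJ finI by (intro finite_SigmaI)
  have "card X \<le> card ((\<lambda>(j, i). (k0, j, i)) ` (SIGMA j:J. {i. (k0, j, i) \<in> X}))"
    using finS by (intro card_mono[OF _ sub] finite_imageI)
  also have "\<dots> \<le> card (SIGMA j:J. {i. (k0, j, i) \<in> X})" using finS by (rule card_image_le)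
  also have "\<dots> = (\<Sum>j\<in>J. card {i. (k0, j, i) \<in> X})" using finJ finI by (intro card_SigmaI) auto
  also have "\<dots> \<le> card J * Suc 100"
    using sum_bounded_above[of J "\<lambda>j. card {i. (k0, j, i) \<in> X}" "Suc 100"] cardI by simp
  also have "\<dots> \<le> 5 * 101" using \<open>card J \<le> Suc 4\<close> by simp
  finally show ?thesis by simp
qed auto

lemma mult_le_three_quarters:
  fixes p q :: real
  assumes "4 * p\<^sup>2 \<le> 3" "4 * q\<^sup>2 \<le> 3" shows "p * q \<le> 3/4"
proof -
  have "0 \<le> (p - q)\<^sup>2" by simp
  then have "2 * (p * q) \<le> p\<^sup>2 + q\<^sup>2" by (simp add: power2_diff)
  then show ?thesis using assms by simp
qed

section \<open>Chains of adjacent cusps along the curves\<close>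

context ideal_tetrahedron
begin

context
  fixes B a b c d
  assumes B: "l2_circulation B" and S: "S = {a, b, c, d}"
    and distinct: "a \<noteq> b" "a \<noteq> c" "a \<noteq> d" "b \<noteq> c" "b \<noteq> d" "c \<noteq> d"
begin

definition ray :: "nat \<Rightarrow> nat \<Rightarrow> nat \<Rightarrow> 'a \<Rightarrow> real" where
  "ray k j i x = (if x = a then lam k j i - (rad k + j) else if x = b then mu k j i - (rad k + j)
     else if x = c then rad k else if x = d then real j else 0)"

lemma sum_S: "(\<Sum>i\<in>S. f i) = f a + f b + f c + f d" for f :: "'a \<Rightarrow> real"
  using distinct by (subst S) simp

lemma tau_ray: "tau S (ray k j i) = lam k j i + mu k j i - (rad k + j)"
  using distinct by (simp add: tau_def sum_S ray_def)

lemma lor_ray: "lor S (ray k j i) (ray k' j' i') = rayform k j i k' j' i'"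
  using distinct by (simp add: lor_def tau_ray sum_S rayform_def udot_def ray_def algebra_simps)

lemma lor_ray_unit: "lor S (ray k j i) (unit_vec a) = mu k j i" "lor S (ray k j i) (unit_vec b) = lam k j i"
proof -
  have "a \<in> S" "b \<in> S" using S by auto
  then show "lor S (ray k j i) (unit_vec a) = mu k j i" "lor S (ray k j i) (unit_vec b) = lam k j i"
    using distinct by (simp_all add: lor_unit tau_ray finite_S) (simp_all add: ray_def)
qed

lemma ray_future: "future S (ray k j i)"
proof -
  have "(rad k + j)\<^sup>2 \<le> usq k j" by (simp add: usq_def)
  also have "\<dots> \<le> 4 * (lam k j i * mu k j i)" using lam_mu[of k j i] lam_pos[of k j i] mu_pos[of k j i] mult_pos_pos[of "lam k j i" "mu k j i"] by linarith
  also have "\<dots> \<le> (lam k j i + mu k j i)\<^sup>2"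
    using zero_le_power2[of "lam k j i - mu k j i"] by (simp add: power2_eq_square algebra_simps)
  finally have "rad k + j \<le> lam k j i + mu k j i"
    using lam_pos[of k j i] mu_pos[of k j i] by (elim power2_le_imp_le) simp
  then show ?thesis by (simp add: future_def tau_ray lor_ray rayform_self)
qed

text \<open>Inside, any cusp near the sample point will do; at both ends the cusp is prescribed, so
  that differences along every curve telescope to the same number.\<close>

definition ray_cusp :: "nat \<Rightarrow> nat \<Rightarrow> nat \<Rightarrow> 'a \<Rightarrow> real" where
  "ray_cusp k j i = (if i = 0 then unit_vec b else if i = steps k then unit_vec a
     else (SOME v. v \<in> cusps \<and> 4 * (lor S (ray k j i) v)\<^sup>2 \<le> 3))"

lemma ray_cusp:
  assumes "k \<ge> 1"
  shows "ray_cusp k j i \<in> cusps" "4 * (lor S (ray k j i) (ray_cusp k j i))\<^sup>2 \<le> 3"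
proof -
  have ab: "a \<in> S" "b \<in> S" using S by auto
  have "ray_cusp k j i \<in> cusps \<and> 4 * (lor S (ray k j i) (ray_cusp k j i))\<^sup>2 \<le> 3"
  proof -
    consider "i = 0" | "i \<noteq> 0" "i = steps k" | "i \<noteq> 0" "i \<noteq> steps k" by blast
    then show ?thesis
    proof cases
      case 1
      then show ?thesis using unit_cusp ab by (simp add: ray_cusp_def lor_ray_unit lam_def power2_eq_square)
    next
      case 2
      have P: "usq k j + 1 > 0" by (simp add: usq_def add_nonneg_pos)
      have "i * incr k j = ln (2 * (usq k j + 1))" using 2 steps_pos[OF assms] by (simp add: incr_def)
      then have "mu k j i = (usq k j + 1) * inverse (2 * (usq k j + 1))" using P by (simp add: mu_def exp_minus)
      also have "\<dots> = 1/2" using P by (simp add: field_simps del: distrib_left_numeral)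
      finally have "4 * (mu k j i)\<^sup>2 \<le> 3" by (simp only: power_divide) simp
      then show ?thesis using 2 unit_cusp ab by (simp add: ray_cusp_def lor_ray_unit)
    next
      case 3
      have "\<exists>v. v \<in> cusps \<and> 4 * (lor S (ray k j i) v)\<^sup>2 \<le> 3"
        using cusp_near[of "ray k j i"] ray_future by (auto simp: lor_ray rayform_self)
      from someI_ex[OF this] show ?thesis using 3 by (simp add: ray_cusp_def)
    qed
  qed
  then show "ray_cusp k j i \<in> cusps" "4 * (lor S (ray k j i) (ray_cusp k j i))\<^sup>2 \<le> 3" by auto
qed

lemma ray_cusp_near:
  assumes "k \<ge> 1" "real j \<le> rad k"
  shows "\<exists>p. 0 \<le> p \<and> 4 * p\<^sup>2 \<le> 3 \<and> lor S (ray k j (Suc i)) (ray_cusp k j i) \<le> 5/4 * p"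
proof (intro exI conjI)
  let ?p = "lor S (ray k j i) (ray_cusp k j i)"
  have f: "future S (ray_cusp k j i)" using ray_cusp(1)[OF assms(1)] by (rule cusp_future)
  show "0 \<le> ?p" using ray_future f by (rule lor_nonneg)
  show "4 * ?p\<^sup>2 \<le> 3" by (rule ray_cusp(2)[OF assms(1)])
  show "lor S (ray k j (Suc i)) (ray_cusp k j i) \<le> 5/4 * ?p"
    using rayform_step[OF assms] ray_future f by (intro lor_step) (auto simp: lor_ray rayform_self)
qed

lemma ray_cusp_nonneg:
  "k \<ge> 1 \<Longrightarrow> k' \<ge> 1 \<Longrightarrow> 0 \<le> lor S (ray k j i) (ray_cusp k' j' i')"
  using ray_future cusp_future[OF ray_cusp(1)] by (intro lor_nonneg) auto

text \<open>Two levels \<open>sqrt 3 / 2\<close> multiply to 3/4, which leaves room below 1 for the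
  loss 5/4 of a step: \<open>5/4 * 3/4 = 15/16\<close>.\<close>

lemma ray_cusp_cross:
  assumes "k \<ge> 1" "real j \<le> rad k" "4 * q\<^sup>2 \<le> 3" "0 \<le> q"
  shows "lor S (ray k j (Suc i)) (ray_cusp k j i) * q \<le> 15/16"
proof -
  obtain p where p: "0 \<le> p" "4 * p\<^sup>2 \<le> 3" "lor S (ray k j (Suc i)) (ray_cusp k j i) \<le> 5/4 * p"
    using ray_cusp_near[OF assms(1,2)] by blast
  have "lor S (ray k j (Suc i)) (ray_cusp k j i) * q \<le> (5/4 * p) * q" using p assms by (intro mult_right_mono) auto
  then show ?thesis using mult_le_three_quarters[OF p(2) assms(3)] by simp
qed

lemma ray_cusp_adjacent:
  assumes "k \<ge> 1" "real j \<le> rad k" "ray_cusp k j i \<noteq> ray_cusp k j (Suc i)"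
  shows "lor S (ray_cusp k j i) (ray_cusp k j (Suc i)) = 1"
proof (rule cusp_adjacent[where x = "ray k j (Suc i)"])
  show "lor S (ray k j (Suc i)) (ray_cusp k j i) * lor S (ray k j (Suc i)) (ray_cusp k j (Suc i)) < 1"
    using ray_cusp_cross[OF assms(1,2) ray_cusp(2)[OF assms(1)] ray_cusp_nonneg[OF assms(1,1)], of i j "Suc i"]
    by simp
qed (use assms ray_cusp(1) in \<open>auto simp: lor_ray rayform_self\<close>)

text \<open>Steps that use the same ordered pair of cusps end near the same place: each of the four
  products in \<open>lor_near_pair\<close> is at most 15/16. So an edge is used only boundedly
  often.\<close>

lemma ray_cusp_close:
  assumes "k \<ge> 1" "real j \<le> rad k" "k' \<ge> 1" "real j' \<le> rad k'"
    and adj: "ray_cusp k j i \<noteq> ray_cusp k j (Suc i)"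
    and eq: "ray_cusp k j i = ray_cusp k' j' i'" "ray_cusp k j (Suc i) = ray_cusp k' j' (Suc i')"
  shows "rayform k j (Suc i) k' j' (Suc i') \<le> 5"
proof -
  define v w x y where "v = ray_cusp k j i" and "w = ray_cusp k j (Suc i)"
    and "x = ray k j (Suc i)" and "y = ray k' j' (Suc i')"
  have xw: "4 * (lor S x w)\<^sup>2 \<le> 3" "0 \<le> lor S x w" and yw: "4 * (lor S y w)\<^sup>2 \<le> 3" "0 \<le> lor S y w"
    using ray_cusp(2)[OF assms(1), of j "Suc i"] ray_cusp(2)[OF assms(3), of j' "Suc i'"]
      ray_cusp_nonneg[OF assms(1,1)] ray_cusp_nonneg[OF assms(3,1)]
    by (simp_all add: x_def w_def y_def eq[symmetric])
  have c: "lor S x v * q \<le> 15/16" "lor S y v * q \<le> 15/16" if "4 * q\<^sup>2 \<le> 3" "0 \<le> q" for q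
    using ray_cusp_cross[OF assms(1,2) that, of i] ray_cusp_cross[OF assms(3,4) that, of i'] eq
    by (simp_all add: x_def y_def v_def)
  have "lor S x y \<le> lor S x v * lor S y w + lor S x w * lor S y v + lor S x v * lor S x w + lor S y v * lor S y w - 1"
    using cusp_null[OF ray_cusp(1)[OF assms(1)]] ray_cusp_adjacent[OF assms(1,2) adj]
    by (intro lor_near_pair) (auto simp: v_def w_def x_def y_def lor_ray rayform_self)
  also have "\<dots> \<le> 5"
    using c[OF xw] c[OF yw] by (simp add: mult.commute)
  finally show ?thesis by (simp add: x_def y_def lor_ray)
qed

text \<open>\<open>B \<one> c d\<close> is the difference of the potential between the cusps
  \<open>unit_vec a\<close> and \<open>unit_vec b\<close>, the ends of all the curves. If it is
  nonzero, the energies of the tubes sum like the harmonic series.\<close>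

lemma circulation_zero_rank4: "B \<one> c d = 0"
proof (rule ccontr)
  assume nz: "B \<one> c d \<noteq> 0"
  let ?psi = "cusp_val B a b c d"
  note ctx = B S distinct
  have abS: "a \<in> S" "b \<in> S" using S by auto
  have psi_unit: "?psi (unit_vec k) = potential B a b c d \<one> k" if "k \<in> S" for k
    using cusp_val_act[OF ctx one_closed that] by simp
  define del where "del = ?psi (unit_vec b) - ?psi (unit_vec a)"
  have "?psi (unit_vec a) - ?psi (unit_vec b) = B \<one> c d"
    using psi_unit abS potential_diff[OF ctx] face_diff(1)[OF ctx one_closed] by simp
  then have del: "del\<^sup>2 > 0" using nz by (auto simp: del_def)
  define f where "f = (\<lambda>(k, j, i). (?psi (ray_cusp k j i) - ?psi (ray_cusp k j (Suc i)))\<^sup>2)"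
  define M where "M = 505 * (16 * infsum (energy_at B) (carrier G))"
  have level: "del\<^sup>2 / (200 * real k) \<le> (\<Sum>j\<le>32^k. \<Sum>i<steps k. f (k, j, i))" if k: "k \<ge> 1" for k
  proof -
    have N: "steps k > 0" using steps_pos k by simp
    have "del\<^sup>2 / steps k \<le> (\<Sum>i<steps k. f (k, j, i))" for j
    proof -
      have "(\<Sum>i<steps k. ?psi (ray_cusp k j i) - ?psi (ray_cusp k j (Suc i))) = ?psi (ray_cusp k j 0) - ?psi (ray_cusp k j (steps k))"
        by (rule sum_lessThan_telescope')
      also have "\<dots> = del" using N by (simp add: ray_cusp_def del_def)
      \<comment> \<open>Cauchy-Schwarz along a single curve; the number of its steps is lost, and
        the \<open>32 ^ k + 1\<close> curves of the tube make up for it except for the factor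
        \<open>200 k\<close>.\<close>
      finally have "del\<^sup>2 \<le> (\<Sum>i<steps k. f (k, j, i)) * steps k"
        using sum_squared_le_sum_of_squares[of "\<lambda>i. ?psi (ray_cusp k j i) - ?psi (ray_cusp k j (Suc i))" "{..<steps k}"]
        by (simp add: f_def)
      then show ?thesis using N by (simp add: pos_divide_le_eq)
    qed
    then have "(\<Sum>j\<le>(32::nat)^k. del\<^sup>2 / steps k) \<le> (\<Sum>j\<le>32^k. \<Sum>i<steps k. f (k, j, i))" by (intro sum_mono)
    moreover have "(\<Sum>j\<le>(32::nat)^k. del\<^sup>2 / steps k) = (32 ^ k + 1) * del\<^sup>2 / (200 * real k * 32 ^ k)"
      by (simp add: steps_def algebra_simps)
    moreover have "del\<^sup>2 / (200 * real k) = 32 ^ k * del\<^sup>2 / (200 * real k * 32 ^ k)" by simp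
    moreover have "32 ^ k * del\<^sup>2 / (200 * real k * 32 ^ k) \<le> (32 ^ k + 1) * del\<^sup>2 / (200 * real k * 32 ^ k)"
      by (intro divide_right_mono mult_right_mono) auto
    ultimately show ?thesis by linarith
  qed
  have bound: "del\<^sup>2 / 200 * harm K \<le> M" for K
  proof -
    define X where "X = (SIGMA k:{1..K}. SIGMA j:{..(32::nat)^k}. {..<steps k})"
    have finX: "finite X" unfolding X_def by (intro finite_SigmaI finite_atLeastAtMost finite_atMost finite_lessThan)
    have Xr: "1 \<le> k \<and> real j \<le> rad k" if "(k, j, i) \<in> X" for k j i
    proof -
      have "1 \<le> k" "j \<le> 32 ^ k" using that by (auto simp: X_def)
      then have "real j \<le> real (32 ^ k)" by (simp only: of_nat_le_iff)
      then show ?thesis using \<open>1 \<le> k\<close> by (simp add: rad_def)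
    qed
    \<comment> \<open>Steps that stay at one cusp cost nothing; the remaining ones join adjacent
      cusps.\<close>
    define Y where "Y = {(k, j, i) \<in> X. ray_cusp k j i \<noteq> ray_cusp k j (Suc i)}"
    have YX: "Y \<subseteq> X" by (auto simp: Y_def)
    then have finY: "finite Y" using finX finite_subset by blast
    define pr where "pr = (\<lambda>(k, j, i). (ray_cusp k j i, ray_cusp k j (Suc i)))"
    have "del\<^sup>2 / 200 * harm K = (\<Sum>k=1..K. del\<^sup>2 / (200 * real k))"
    proof -
      have "x / 200 * inverse (of_nat k) = x / (200 * real k)" for x :: real and k by (simp add: field_simps)
      then show ?thesis unfolding harm_def sum_distrib_left by (simp only:)
    qed
    also have "\<dots> \<le> (\<Sum>k=1..K. \<Sum>j\<le>32^k. \<Sum>i<steps k. f (k, j, i))" by (intro sum_mono level) auto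
    also have "\<dots> = sum f X"
      unfolding X_def by (simp add: sum.Sigma split_def)
    also have "\<dots> = sum f Y"
      by (rule sum.mono_neutral_right[OF finX YX]) (auto simp: Y_def f_def)
    also have "\<dots> = (\<Sum>e\<in>pr ` Y. sum f {p \<in> Y. pr p = e})" by (rule sum.image_gen[OF finY])
    also have "\<dots> \<le> (\<Sum>e\<in>pr ` Y. 505 * (case e of (v, w) \<Rightarrow> (?psi v - ?psi w)\<^sup>2))"
    proof (rule sum_mono)
      fix e assume "e \<in> pr ` Y"
      obtain v w where e: "e = (v, w)" by fastforce
      have "sum f {p \<in> Y. pr p = e} = (\<Sum>p\<in>{p \<in> Y. pr p = e}. (?psi v - ?psi w)\<^sup>2)"
        by (intro sum.cong refl) (auto simp: f_def pr_def e)
      also have "\<dots> = card {p \<in> Y. pr p = e} * (?psi v - ?psi w)\<^sup>2" by simp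
      also have "\<dots> \<le> 505 * (?psi v - ?psi w)\<^sup>2"
      proof (rule mult_right_mono)
        \<comment> \<open>\<open>ray_cusp_close\<close> compares the end points of the steps, so the
          index is shifted before counting.\<close>
        define h where "h = (\<lambda>(k :: nat, j :: nat, i). (k, j, Suc i))"
        have "inj_on h {p \<in> Y. pr p = e}" by (auto simp: inj_on_def h_def)
        then have "card {p \<in> Y. pr p = e} = card (h ` {p \<in> Y. pr p = e})" by (simp add: card_image)
        also have "\<dots> \<le> 505"
        proof (rule sparse_card)
          show "finite (h ` {p \<in> Y. pr p = e})" using finY by simp
          show "1 \<le> k \<and> real j \<le> rad k" if "(k, j, i) \<in> h ` {p \<in> Y. pr p = e}" for k j i
            using that Xr YX by (auto simp: h_def)
          fix k j i k' j' i'
          assume A: "(k, j, i) \<in> h ` {p \<in> Y. pr p = e}" "(k', j', i') \<in> h ` {p \<in> Y. pr p = e}"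
          then obtain i0 i0' where *: "i = Suc i0" "i' = Suc i0'" "(k, j, i0) \<in> Y" "(k', j', i0') \<in> Y"
            "pr (k, j, i0) = e" "pr (k', j', i0') = e" by (auto simp: h_def)
          have r: "1 \<le> k \<and> real j \<le> rad k" "1 \<le> k' \<and> real j' \<le> rad k'" using Xr YX *(3,4) by blast+
          show "rayform k j i k' j' i' \<le> 5"
            unfolding *(1,2) using r *(3,5,6)
            by (intro ray_cusp_close) (auto simp: Y_def pr_def e)
        qed
        finally show "real (card {p \<in> Y. pr p = e}) \<le> 505" by simp
      qed simp
      finally show "sum f {p \<in> Y. pr p = e} \<le> 505 * (case e of (v, w) \<Rightarrow> (?psi v - ?psi w)\<^sup>2)" by (simp add: e)
    qed
    also have "\<dots> = 505 * (\<Sum>(v, w)\<in>pr ` Y. (?psi v - ?psi w)\<^sup>2)" by (simp add: sum_distrib_left)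
    also have "\<dots> \<le> M"
    proof -
      have "(\<Sum>(v, w)\<in>pr ` Y. (?psi v - ?psi w)\<^sup>2) \<le> 16 * infsum (energy_at B) (carrier G)"
      proof (rule cusp_val_energy[OF ctx])
        fix v w assume "(v, w) \<in> pr ` Y"
        then obtain k j i where *: "(k, j, i) \<in> Y" "v = ray_cusp k j i" "w = ray_cusp k j (Suc i)"
          unfolding pr_def by (elim imageE) (auto split: prod.splits)
        have r: "1 \<le> k \<and> real j \<le> rad k" using Xr YX *(1) by blast
        show "v \<in> cusps \<and> w \<in> cusps \<and> lor S v w = 1"
          using ray_cusp(1) ray_cusp_adjacent[of k j i] r * by (auto simp: Y_def)
      qed (use finY in simp)
      then show ?thesis by (simp add: M_def)
    qed
    finally show ?thesis .
  qed
  \<comment> \<open>The bound is uniform in \<open>K\<close>, whereas the harmonic numbers are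
    unbounded.\<close>
  have "eventually (\<lambda>K. harm K > M / (del\<^sup>2 / 200)) sequentially"
    using harm_at_top filterlim_at_top_dense by blast
  then obtain K where "harm K > M / (del\<^sup>2 / 200)" using eventually_happens sequentially_bot by blast
  then show False using bound[of K] del by (simp add: field_simps)
qed

end
end

section \<open>Cycles as circulations\<close>

text \<open>Used for the map from group elements to cells, whose fibres are cosets of a finite
  dihedral group.\<close>

lemma summable_on_finite_fibers:
  fixes h :: "'c \<Rightarrow> real"
  assumes "h summable_on C" "\<And>y. y \<in> C \<Longrightarrow> h y \<ge> 0" "g ` A \<subseteq> C"
    and fib: "\<And>y. y \<in> C \<Longrightarrow> finite {x \<in> A. g x = y} \<and> card {x \<in> A. g x = y} \<le> N"
  shows "(\<lambda>x. h (g x)) summable_on A"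
proof (rule nonneg_bdd_above_summable_on)
  show "h (g x) \<ge> 0" if "x \<in> A" for x using that assms by blast
  show "bdd_above (sum (\<lambda>x. h (g x)) ` {F. F \<subseteq> A \<and> finite F})"
  proof (rule bdd_aboveI)
    fix y assume "y \<in> sum (\<lambda>x. h (g x)) ` {F. F \<subseteq> A \<and> finite F}"
    then obtain F where F: "F \<subseteq> A" "finite F" "y = (\<Sum>x\<in>F. h (g x))" by auto
    have gF: "g ` F \<subseteq> C" using F assms by blast
    have "y = (\<Sum>z\<in>g ` F. \<Sum>x\<in>{x \<in> F. g x = z}. h (g x))" using sum.image_gen[OF F(2)] F(3) by metis
    also have "\<dots> \<le> (\<Sum>z\<in>g ` F. N * h z)"
    proof (rule sum_mono)
      fix z assume "z \<in> g ` F"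
      then have z: "z \<in> C" using gF by blast
      have "card {x \<in> F. g x = z} \<le> card {x \<in> A. g x = z}" using F fib[OF z] by (intro card_mono) auto
      then have "real (card {x \<in> F. g x = z}) \<le> N" using fib[OF z] by linarith
      moreover have "(\<Sum>x\<in>{x \<in> F. g x = z}. h (g x)) = card {x \<in> F. g x = z} * h z" by simp
      ultimately show "(\<Sum>x\<in>{x \<in> F. g x = z}. h (g x)) \<le> N * h z"
        using assms(2)[OF z] by (simp add: mult_right_mono)
    qed
    also have "\<dots> = N * (\<Sum>z\<in>g ` F. h z)" by (simp add: sum_distrib_left)
    also have "\<dots> \<le> N * infsum h C"
      using F gF assms by (intro mult_left_mono finite_sum_le_infsum) auto
    finally show "y \<le> N * infsum h C" .
  qed
qed

context uniform_coxeter
begin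

section \<open>Two-cells, their edges and incidence signs\<close>

definition face :: "'a \<Rightarrow> 'a \<Rightarrow> 'a \<Rightarrow> 'a set \<times> 'a set" where
  "face x s t = (x <# generate G {s, t}, {s, t})"

lemma face_commute: "face x s t = face x t s"
  by (simp add: face_def insert_commute)

lemma dihedral_subgroup: "s \<in> S \<Longrightarrow> t \<in> S \<Longrightarrow> subgroup (generate G {s, t}) G"
  by (intro generate_is_subgroup) auto

lemma face_mult:
  assumes "x \<in> carrier G" "s \<in> S" "t \<in> S" "v \<in> generate G {s, t}"
  shows "face (x \<otimes> v) s t = face x s t"
proof -
  have "x \<otimes> v \<in> x <# generate G {s, t}" using assms by (auto simp: l_coset_def)
  then show ?thesis
    using l_repr_independence[OF _ assms(1) dihedral_subgroup[OF assms(2,3)]] by (simp add: face_def)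
qed

text \<open>By additivity of lengths the shortest element of the coset is unique, so the choice
  inside \<open>min_elt\<close> is forced.\<close>

lemma min_elt_face:
  assumes "s \<in> S" "t \<in> S" "s \<noteq> t" "min_rep s t u"
  shows "min_elt G S (fst (face u s t)) = u"
proof -
  have uc: "u \<in> carrier G" using min_rep_carrier[OF assms] .
  have len_eq: "len u \<le> len x \<and> (len x \<le> len u \<longrightarrow> x = u)" if x: "x \<in> u <# generate G {s, t}" for x
  proof -
    obtain v where v: "v \<in> generate G {s, t}" "x = u \<otimes> v" using x by (auto simp: l_coset_def)
    then obtain a b k where k: "{a, b} = {s, t}" "k \<le> m" "v = alt a b k"
      using dihedral_elements[OF assms(1-3)] by blast
    have ab: "a \<in> S" "b \<in> S" "a \<noteq> b" "min_rep a b u"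
      using pair_mem[OF k(1) assms(1-3)] min_rep_cong[OF k(1) assms(4)] by auto
    show ?thesis using min_rep_len[OF ab k(2)] v k uc by (cases k) auto
  qed
  have "\<one> \<in> generate G {s, t}" by (rule generate.one)
  then have "u \<in> u <# generate G {s, t}" using uc by (force simp: l_coset_def)
  then show ?thesis unfolding min_elt_def face_def fst_conv using len_eq by (intro some_equality) auto
qed

lemma generate_single: "s \<in> S \<Longrightarrow> generate G {s} = {\<one>, s}"
proof
  assume s: "s \<in> S"
  show "generate G {s} \<subseteq> {\<one>, s}"
  proof
    fix x assume "x \<in> generate G {s}"
    then show "x \<in> {\<one>, s}" by (induction rule: generate.induct) (use s in auto)
  qed
  show "{\<one>, s} \<subseteq> generate G {s}" by (auto intro: generate.one generate.incl)
qed

lemma edge_eq: "x \<in> carrier G \<Longrightarrow> r \<in> S \<Longrightarrow> x <# generate G {r} = {x, x \<otimes> r}"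
  by (auto simp: generate_single l_coset_def)

lemma gen_in_dihedral:
  assumes "s \<in> S" "t \<in> S" "s \<noteq> t" "r \<in> S" "r \<in> generate G {s, t}"
  shows "r \<in> {s, t}"
proof -
  obtain a b k where k: "{a, b} = {s, t}" "k \<le> m" "r = alt a b k"
    using dihedral_elements[OF assms(1-3)] assms(5) by blast
  have one: "min_rep s t \<one>" by (rule min_repI) (use assms in auto)
  have ab: "a \<in> S" "b \<in> S" "a \<noteq> b" "min_rep a b \<one>"
    using pair_mem[OF k(1) assms(1-3)] min_rep_cong[OF k(1) one] by auto
  have "len r = 1" using len_mult_gen(1)[of \<one> r] assms by simp
  then have "k = 1" using min_rep_len[OF ab k(2)] k ab by simp
  then have "r = a" using k ab by (simp add: alt_Suc letter_def)
  then show ?thesis using k by auto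
qed

text \<open>The edge from \<open>y\<close> to \<open>y \<otimes> r\<close> climbs one side of the
  polygon, and \<open>a\<close> tells which. The top vertex has no ascending edge, hence
  \<open>k < m\<close>; at the bottom the side starting with \<open>r\<close> is taken.\<close>

lemma corner_obtain:
  assumes "r \<in> S" "t \<in> S" "r \<noteq> t" "y \<in> carrier G" "\<not> inversion y r"
  obtains u a b k where "min_rep r t u" "{a, b} = {r, t}" "k < m" "y = u \<otimes> alt a b k" "letter a b k = r"
proof -
  obtain u a b k where *: "min_rep r t u" "{a, b} = {r, t}" "k \<le> m" "y = u \<otimes> alt a b k"
    using min_rep_cases[OF assms(1-4)] by metis
  have ab: "a \<in> S" "b \<in> S" "a \<noteq> b" "min_rep a b u"
    using pair_mem[OF *(2) assms(1-3)] min_rep_cong[OF *(2,1)] by auto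
  show thesis
  proof (cases k)
    case 0
    then have "y = u \<otimes> alt r t 0" using * by simp
    then show thesis using that[of u r t 0] * m_ge_2 by (simp add: letter_def)
  next
    case (Suc j)
    have j: "Suc j \<le> m" using Suc * by simp
    have "letter a b j \<noteq> r" using min_rep_last(1)[OF ab j] Suc * assms(5) by auto
    then have lr: "letter a b (Suc j) = r" using *(2) by (auto simp: letter_def doubleton_eq_iff split: if_splits)
    then have "k \<noteq> m" using min_rep_last(2)[OF ab j] Suc * assms(5) by auto
    then show thesis using that[OF *(1,2) _ *(4)] Suc * lr by simp
  qed
qed

text \<open>The \<open>SOME\<close> term is the generator at which \<open>incidence\<close> starts
  the boundary of the polygon.\<close>

definition orient :: "'a \<Rightarrow> 'a \<Rightarrow> real" where
  "orient r t = (if r = (SOME s. s \<in> {r, t}) then 1 else -1)"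

lemma orient_anti: assumes "r \<noteq> t" shows "orient r t = - orient t r"
proof -
  have "(SOME s. s \<in> {r, t}) \<in> {r, t}" by (rule someI[of _ r]) simp
  then show ?thesis using assms by (auto simp: orient_def insert_commute)
qed

text \<open>The sign is 1 on one side of the polygon and -1 on the other. As \<open>r\<close> is
  letter number \<open>k\<close> of the side, the side is known from the parity of
  \<open>k = len y - len u\<close> and from \<open>orient\<close>. The factor depending on
  \<open>y\<close> is common to all cells at the edge and cancels in the cycle condition.\<close>

lemma incidence_face:
  assumes "r \<in> S" "t \<in> S" "r \<noteq> t" "y \<in> carrier G" "\<not> inversion y r"
  shows "incidence G S (\<lambda>s t. if s = t then 1 else enat m) (face y r t) (y <# generate G {r}, {r}) =
    (-1) ^ len y * orient r t * (-1) ^ len (min_elt G S (fst (face y r t)))"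
proof -
  obtain u a b k where *: "min_rep r t u" "{a, b} = {r, t}" "k < m" "y = u \<otimes> alt a b k" "letter a b k = r"
    using corner_obtain[OF assms] by metis
  have ab: "a \<in> S" "b \<in> S" "a \<noteq> b" "min_rep a b u"
    using pair_mem[OF *(2) assms(1-3)] min_rep_cong[OF *(2,1)] by auto
  have uc: "u \<in> carrier G" using min_rep_carrier[OF ab] .
  have altH: "alt a b k \<in> generate G {r, t}"
    using alt_in_dihedral[OF ab(1-3), of k] *(2,3) by simp
  have fu: "face y r t = face u r t" unfolding *(4) using uc assms altH by (intro face_mult) auto
  have mu: "min_elt G S (fst (face y r t)) = u" unfolding fu using min_elt_face[OF assms(1-3) *(1)] .
  have yr: "y \<otimes> r = u \<otimes> alt a b (Suc k)" using * ab uc assms(1) by (simp add: alt_Suc m_assoc)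
  have E: "y <# generate G {r} = {u \<otimes> alt a b k, u \<otimes> alt a b (Suc k)}"
    using edge_eq[OF assms(4,1)] yr *(4) by simp
  have sub: "y <# generate G {r} \<subseteq> fst (face y r t)"
    unfolding E fu unfolding face_def using alt_in_dihedral[OF ab(1-3), of k] alt_in_dihedral[OF ab(1-3), of "Suc k"] *(2,3)
    by (auto simp: l_coset_def)
  have leny: "len y = len u + k" using min_rep_len[OF ab, of k] * by simp
  define s0 where "s0 = (SOME s. s \<in> {r, t})"
  have s0: "s0 \<in> {a, b}" unfolding s0_def *(2) by (rule someI[of _ r]) simp
  define t0 where "t0 = (SOME t'. t' \<in> {r, t} \<and> t' \<noteq> s0)"
  have t0: "t0 \<in> {r, t} \<and> t0 \<noteq> s0"
    unfolding t0_def by (rule someI_ex) (use assms(3) in auto)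
  have t0': "t0 \<in> {a, b}" "t0 \<noteq> s0" using t0 *(2) by auto
  let ?Q = "\<exists>j<m. y <# generate G {r} = {u \<otimes> alt s0 t0 j, u \<otimes> alt s0 t0 (Suc j)}"
  have inc: "incidence G S (\<lambda>s t. if s = t then 1 else enat m) (face y r t) (y <# generate G {r}, {r}) = (if ?Q then 1 else -1)"
    using sub mu t0'(2)
    unfolding incidence_def Let_def face_def fst_conv snd_conv s0_def[symmetric] t0_def[symmetric] alt_def[symmetric]
    by simp
  have orr: "orient r t = (if r = s0 then 1 else -1)" by (simp add: orient_def s0_def)
  consider "a = s0" "b = t0" | "a = t0" "b = s0" using s0 t0' by auto
  then show ?thesis
  proof cases
    case 1
    then have "?Q" using E *(3) by auto
    moreover have "orient r t = (-1) ^ k" using orr *(5) 1 ab(3) by (cases "even k") (auto simp: letter_def)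
    ultimately show ?thesis using inc mu leny by (cases "even k"; cases "even (len u)") simp_all
  next
    case 2
    have "\<not> ?Q"
    proof
      assume ?Q
      then obtain i where i: "i < m" "{u \<otimes> alt t0 s0 k, u \<otimes> alt t0 s0 (Suc k)} = {u \<otimes> alt s0 t0 i, u \<otimes> alt s0 t0 (Suc i)}"
        using E 2 by auto
      \<comment> \<open>\<open>Suc j\<close> is \<open>k\<close>, or 1 if \<open>k = 0\<close>: a
        vertex of the edge that is neither bottom nor top, so it lies on one side only.\<close>
      define j where "j = (if k = 0 then 0 else k - 1)"
      have j: "Suc j < m" "u \<otimes> alt t0 s0 (Suc j) \<in> {u \<otimes> alt t0 s0 k, u \<otimes> alt t0 s0 (Suc k)}"
        using *(3) m_ge_2 by (auto simp: j_def)
      then obtain i' where i': "i' \<le> m" "u \<otimes> alt t0 s0 (Suc j) = u \<otimes> alt s0 t0 i'"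
        using i by (metis Suc_leI insert_iff less_imp_le_nat singletonD)
      note ts = ab[unfolded 2]
      have st: "s0 \<in> S" "t0 \<in> S" "s0 \<noteq> t0" "min_rep s0 t0 u" using ts min_rep_sym by auto
      have "len u + Suc j = len u + i'"
        using min_rep_len[OF ts, of "Suc j"] min_rep_len[OF st i'(1)] i' j by simp
      then have "i' = Suc j" by simp
      then have "inversion (u \<otimes> alt s0 t0 (Suc j)) (letter t0 s0 j)"
        using min_rep_last(1)[OF ts, of j] i' j by simp
      then show False using min_rep_last(2)[OF st, of j] j by (simp add: letter_Suc)
    qed
    moreover have "orient r t = - ((-1) ^ k)" using orr *(5) 2 ab(3) by (cases "even k") (auto simp: letter_def)
    ultimately show ?thesis using inc mu leny by (cases "even k"; cases "even (len u)") simp_all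
  qed
qed

lemma qw_bounds:
  assumes q: "\<forall>s\<in>S. 0 < q s \<and> q s \<le> 1" and x: "x \<in> carrier G"
  shows "0 < qw G S q x" "qw G S q x \<le> 1"
proof -
  have "reduced_word G S x (SOME ws. reduced_word G S x ws)" using ex_reduced[OF x] by (rule someI_ex)
  then have "(SOME ws. reduced_word G S x ws) \<in> lists S" by (simp add: reduced_word_def)
  moreover have "0 < prod_list (map q ws) \<and> prod_list (map q ws) \<le> 1" if "ws \<in> lists S" for ws
    using that q by (induction ws rule: list.induct) (auto intro: mult_le_one)
  ultimately show "0 < qw G S q x" "qw G S q x \<le> 1" unfolding qw_def by blast+
qed

lemma min_elt_mem: assumes "C \<noteq> {}" shows "min_elt G S C \<in> C"
proof -
  obtain u where "u \<in> C" "\<forall>x\<in>C. len u \<le> len x"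
    using assms ex_has_least_nat[of "\<lambda>x. x \<in> C" _ len] by blast
  then show ?thesis unfolding min_elt_def
    using someI_ex[of "\<lambda>u. u \<in> C \<and> (\<forall>x\<in>C. len u \<le> len x)"] by blast
qed

lemma cell_measure_bounds:
  assumes q: "\<forall>s\<in>S. 0 < q s \<and> q s \<le> 1" and x: "x \<in> carrier G" and T: "T \<subseteq> S"
  shows "0 < cell_measure G S q (x <# generate G T, T)" "cell_measure G S q (x <# generate G T, T) \<le> 1"
proof -
  have sub: "generate G T \<subseteq> carrier G" using T by (intro generate_incl) auto
  have "x \<otimes> \<one> \<in> x <# generate G T" using generate.one by (force simp: l_coset_def)
  then have "min_elt G S (x <# generate G T) \<in> x <# generate G T" by (intro min_elt_mem) blast
  then have "min_elt G S (x <# generate G T) \<in> carrier G" using sub x by (auto simp: l_coset_def)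
  then show "0 < cell_measure G S q (x <# generate G T, T)" "cell_measure G S q (x <# generate G T, T) \<le> 1"
    using qw_bounds[OF q] by (simp_all add: cell_measure_def)
qed

section \<open>The circulation of a weighted cycle\<close>

context
  fixes q :: "'a \<Rightarrow> real" and f :: "'a set \<times> 'a set \<Rightarrow> real"
  assumes q: "\<forall>s\<in>S. 0 < q s \<and> q s \<le> 1"
    and pairs: "\<And>s t. s \<in> S \<Longrightarrow> t \<in> S \<Longrightarrow> spherical G {s, t}"
    and f: "f \<in> l2_chains2 G S q"
    and cyc: "\<forall>e\<in>cells G S 1. bdry2 G S (\<lambda>s t. if s = t then 1 else enat m) q f e = 0"
begin

text \<open>The weighted coefficient with the part of the incidence sign that depends on the cell.
  Apart from the order of \<open>s\<close> and \<open>t\<close>, everything is a function of the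
  coset.\<close>

definition cycle_circ :: "'a \<Rightarrow> 'a \<Rightarrow> 'a \<Rightarrow> real" where
  "cycle_circ x s t = (if s = t then 0 else orient s t * (-1) ^ len (min_elt G S (fst (face x s t)))
     * f (face x s t) * cell_measure G S q (face x s t))"

lemma face_cell: "x \<in> carrier G \<Longrightarrow> s \<in> S \<Longrightarrow> t \<in> S \<Longrightarrow> s \<noteq> t \<Longrightarrow> face x s t \<in> cells G S 2"
  unfolding cells_def face_def using pairs by auto

lemma faces_of_edge:
  assumes "x \<in> carrier G" "r \<in> S"
  shows "{\<sigma> \<in> cells G S 2. x <# generate G {r} \<subseteq> fst \<sigma>} = face x r ` (S - {r})"
proof (intro equalityI subsetI)
  fix \<sigma> assume "\<sigma> \<in> face x r ` (S - {r})"
  then obtain t where t: "t \<in> S" "t \<noteq> r" "\<sigma> = face x r t" by auto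
  have "{\<one>, r} \<subseteq> generate G {r, t}" by (auto intro: generate.one generate.incl)
  then have "x <# generate G {r} \<subseteq> fst \<sigma>" using generate_single[OF assms(2)] t by (auto simp: face_def l_coset_def)
  then show "\<sigma> \<in> {\<sigma> \<in> cells G S 2. x <# generate G {r} \<subseteq> fst \<sigma>}" using face_cell[of x r t] assms t by simp
next
  fix \<sigma> assume "\<sigma> \<in> {\<sigma> \<in> cells G S 2. x <# generate G {r} \<subseteq> fst \<sigma>}"
  then obtain w T where T: "w \<in> carrier G" "T \<subseteq> S" "card T = 2" "\<sigma> = (w <# generate G T, T)"
    and sub: "x <# generate G {r} \<subseteq> w <# generate G T" by (auto simp: cells_def)
  obtain s t where st: "T = {s, t}" "s \<noteq> t" using T(3) by (auto simp: card_2_iff)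
  have stS: "s \<in> S" "t \<in> S" using T st by auto
  note H = dihedral_subgroup[OF stS]
  have "x \<in> w <# generate G {s, t}" "x \<otimes> r \<in> w <# generate G {s, t}" using sub edge_eq[OF assms] st by auto
  then have wx: "w <# generate G {s, t} = x <# generate G {s, t}" and "x \<otimes> r \<in> x <# generate G {s, t}"
    using l_repr_independence[OF _ T(1) H] by auto
  then obtain v where v: "v \<in> generate G {s, t}" "x \<otimes> r = x \<otimes> v" by (auto simp: l_coset_def)
  have "v \<in> carrier G" using v dihedral_subset stS by blast
  then have "r = v" using v(2) assms by simp
  then have "r \<in> {s, t}" using gen_in_dihedral[OF stS st(2) assms(2)] v by simp
  then show "\<sigma> \<in> face x r ` (S - {r})" using T st stS wx by (auto simp: face_def insert_commute)
qed

lemma cycle_circ_row: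
  assumes x: "x \<in> carrier G" and r: "r \<in> S"
  shows "(\<Sum>t\<in>S. cycle_circ x r t) = 0"
proof -
  have *: "(\<Sum>t\<in>S. cycle_circ y r t) = 0" if y: "y \<in> carrier G" "\<not> inversion y r" for y
  proof -
    let ?e = "(y <# generate G {r}, {r})" and ?M = "\<lambda>s t. if s = t then 1 else enat m"
    have "spherical G {r}" using pairs[OF r r] by simp
    then have e: "?e \<in> cells G S 1" unfolding cells_def using y r by force
    have inj: "inj_on (face y r) (S - {r})" by (auto simp: inj_on_def face_def doubleton_eq_iff)
    have "cell_measure G S q ?e > 0" using cell_measure_bounds(1)[OF q y(1), of "{r}"] r by simp
    moreover have "bdry2 G S ?M q f ?e = 0" using cyc e by blast
    ultimately have "(\<Sum>\<sigma>\<in>face y r ` (S - {r}). incidence G S ?M \<sigma> ?e * f \<sigma> * cell_measure G S q \<sigma>) = 0"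
      unfolding bdry2_def fst_conv faces_of_edge[OF y(1) r] by simp
    then have "0 = (\<Sum>t\<in>S - {r}. incidence G S ?M (face y r t) ?e * f (face y r t) * cell_measure G S q (face y r t))"
      using inj by (simp add: sum.reindex)
    also have "\<dots> = (\<Sum>t\<in>S - {r}. (-1) ^ len y * cycle_circ y r t)"
    proof (intro sum.cong refl)
      fix t assume "t \<in> S - {r}"
      then have t: "t \<in> S" "r \<noteq> t" by auto
      show "incidence G S ?M (face y r t) ?e * f (face y r t) * cell_measure G S q (face y r t) = (-1) ^ len y * cycle_circ y r t"
        unfolding incidence_face[OF r t y] using t by (simp add: cycle_circ_def)
    qed
    also have "\<dots> = (-1) ^ len y * (\<Sum>t\<in>S - {r}. cycle_circ y r t)" by (simp add: sum_distrib_left)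
    finally have "(\<Sum>t\<in>S - {r}. cycle_circ y r t) = 0" by simp
    then show ?thesis using finite_S r by (simp add: sum.remove[of S r] cycle_circ_def)
  qed
  show ?thesis
  \<comment> \<open>\<open>incidence_face\<close> speaks about the lower end of the edge. The upper
    end has the same cells through this edge, hence the same row.\<close>
  proof (cases "inversion x r")
    case True
    have xr: "x \<otimes> r \<in> carrier G" "\<not> inversion (x \<otimes> r) r" using x r True by (auto simp: inversion_mult_gen)
    have "face (x \<otimes> r) r t = face x r t" if "t \<in> S" for t
      by (rule face_mult[OF x r that]) (simp add: generate.incl)
    then have "cycle_circ (x \<otimes> r) r t = cycle_circ x r t" if "t \<in> S" for t using that by (simp add: cycle_circ_def)
    then show ?thesis using *[OF xr] by simp
  qed (use * x in blast)
qed

lemma cycle_circ_sq: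
  assumes "x \<in> carrier G" "s \<in> S" "t \<in> S"
  shows "(cycle_circ x s t)\<^sup>2 \<le> (f (face x s t))\<^sup>2 * cell_measure G S q (face x s t)"
proof -
  let ?mu = "cell_measure G S q (face x s t)"
  have mu: "0 < ?mu" "?mu \<le> 1" using cell_measure_bounds[OF q assms(1), of "{s, t}"] assms by (auto simp: face_def)
  have o2: "(orient s t)\<^sup>2 = 1" by (simp add: orient_def)
  have "(cycle_circ x s t)\<^sup>2 \<le> (f (face x s t))\<^sup>2 * ?mu\<^sup>2"
    by (simp add: cycle_circ_def power_mult_distrib o2 power_mult[symmetric] mult.commute[of _ "2::nat"])
  also have "\<dots> \<le> (f (face x s t))\<^sup>2 * ?mu"
    using mu by (intro mult_left_mono) (auto simp: power2_eq_square mult_left_le)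
  finally show ?thesis .
qed

lemma cycle_circ_summable:
  assumes st: "s \<in> S" "t \<in> S"
  shows "(\<lambda>x. (cycle_circ x s t)\<^sup>2) summable_on carrier G"
proof (cases "s = t")
  case True
  then show ?thesis by (simp add: cycle_circ_def)
next
  case False
  let ?h = "\<lambda>\<sigma>. (f \<sigma>)\<^sup>2 * cell_measure G S q \<sigma>"
  have fin: "finite (generate G {s, t})" using pairs[OF st] by (simp add: spherical_def)
  have pos: "?h \<sigma> \<ge> 0" if \<sigma>: "\<sigma> \<in> cells G S 2" for \<sigma>
  proof -
    obtain w T where "w \<in> carrier G" "T \<subseteq> S" "\<sigma> = (w <# generate G T, T)" using \<sigma> by (auto simp: cells_def)
    then have "cell_measure G S q \<sigma> > 0" using cell_measure_bounds(1)[OF q] by simp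
    then show ?thesis by simp
  qed
  have "(\<lambda>x. ?h (face x s t)) summable_on carrier G"
  proof (rule summable_on_finite_fibers[where C = "cells G S 2" and N = "card (generate G {s, t})"])
    show "?h summable_on cells G S 2" using f by (simp add: l2_chains2_def)
    show "(\<lambda>x. face x s t) ` carrier G \<subseteq> cells G S 2" using face_cell st False by blast
    fix \<sigma> assume "\<sigma> \<in> cells G S 2"
    show "finite {x \<in> carrier G. face x s t = \<sigma>} \<and> card {x \<in> carrier G. face x s t = \<sigma>} \<le> card (generate G {s, t})"
    proof (cases "\<exists>x0\<in>carrier G. face x0 s t = \<sigma>")
      case True
      then obtain x0 where x0: "x0 \<in> carrier G" "face x0 s t = \<sigma>" by blast
      have "{x \<in> carrier G. face x s t = \<sigma>} \<subseteq> (\<lambda>v. x0 \<otimes> v) ` generate G {s, t}"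
      proof
        fix x assume "x \<in> {x \<in> carrier G. face x s t = \<sigma>}"
        then have x: "x \<in> carrier G" "x <# generate G {s, t} = x0 <# generate G {s, t}" using x0 by (auto simp: face_def)
        have "x \<otimes> \<one> \<in> x <# generate G {s, t}" using generate.one by (force simp: l_coset_def)
        then have "x \<in> x0 <# generate G {s, t}" using x by simp
        then show "x \<in> (\<lambda>v. x0 \<otimes> v) ` generate G {s, t}" by (auto simp: l_coset_def)
      qed
      then show ?thesis using fin by (meson card_image_le card_mono finite_imageI finite_subset le_trans)
    next
      case False
      then have "{x \<in> carrier G. face x s t = \<sigma>} = {}" by blast
      then show ?thesis by (simp only: finite.emptyI card.empty) simp
    qed
  qed (rule pos)
  then show ?thesis by (rule summable_on_comparison_test) (use cycle_circ_sq st in auto)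
qed

lemma cycle_circulation: "l2_circulation cycle_circ"
  unfolding l2_circulation_def
proof (intro conjI ballI impI)
  fix x s t assume x: "x \<in> carrier G" and st: "s \<in> S" "t \<in> S"
  show "cycle_circ x s t = - cycle_circ x t s"
  proof (cases "s = t")
    case False
    have "face x t s = face x s t" by (rule face_commute)
    then show ?thesis using False orient_anti[OF False] by (simp add: cycle_circ_def)
  qed (simp add: cycle_circ_def)
  show "cycle_circ (x \<otimes> s) s t = cycle_circ x s t" if "s \<noteq> t"
  proof -
    have "face (x \<otimes> s) s t = face x s t" by (rule face_mult[OF x st]) (simp add: generate.incl)
    then show ?thesis by (simp add: cycle_circ_def)
  qed
qed (auto intro: cycle_circ_row cycle_circ_summable)

lemma cycle_zero:
  assumes zero: "\<And>w s t. w \<in> carrier G \<Longrightarrow> s \<in> S \<Longrightarrow> t \<in> S \<Longrightarrow> s \<noteq> t \<Longrightarrow> cycle_circ w s t = 0"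
    and \<sigma>: "\<sigma> \<in> cells G S 2"
  shows "f \<sigma> = 0"
proof -
  obtain w T where T: "w \<in> carrier G" "T \<subseteq> S" "card T = 2" "\<sigma> = (w <# generate G T, T)"
    using \<sigma> by (auto simp: cells_def)
  obtain s t where st: "T = {s, t}" "s \<noteq> t" using T(3) by (auto simp: card_2_iff)
  have "cycle_circ w s t = 0" using zero T st by auto
  moreover have "\<sigma> = face w s t" using T st by (simp add: face_def)
  moreover have "cell_measure G S q \<sigma> > 0" using cell_measure_bounds(1)[OF q T(1,2)] T by simp
  ultimately show ?thesis using st by (simp add: cycle_circ_def orient_def split: if_splits)
qed

end

section \<open>Combination of the three cases\<close>

lemma l2_circulation_zero:
  assumes B: "l2_circulation B" and m: "3 \<le> card S" "card S - 1 \<le> m"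
    and inf: "infinite (carrier G)" and w: "w \<in> carrier G" and st: "s \<in> S" "t \<in> S" "s \<noteq> t"
  shows "B w s t = 0"
proof -
  define B' where "B' = (\<lambda>x. B (w \<otimes> x))"
  have B': "l2_circulation B'" unfolding B'_def using B w by (rule l2_circulation_translate)
  have "B' \<one> s t = 0"
  proof -
    \<comment> \<open>If \<open>card S \<ge> 4\<close>, then \<open>m \<ge> 3\<close>. For
      \<open>m \<ge> 4\<close> one has \<open>2 * (m - 2) \<ge> m \<ge> card S - 1\<close>, and
      \<open>m = 3\<close> leaves only \<open>card S = 4\<close>.\<close>
    consider "card S = 3" | "card S = 4" "m = 3" | "m \<ge> 3" "card S - 1 \<le> 2 * (m - 2)" using m by linarith
    then show ?thesis
    proof cases
      case 1
      have "card (S - {s, t}) = 1" using 1 st finite_S by (simp add: card_Diff_subset)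
      then obtain c where c: "S - {s, t} = {c}" by (auto simp: card_1_singleton_iff)
      then have "S = {s, t, c}" "t \<noteq> c" "s \<noteq> c" using st by auto
      then show ?thesis using circulation_zero_rank3[OF B' _ st(3) _ _ inf] by blast
    next
      case 2
      interpret T: ideal_tetrahedron G S
        by (intro ideal_tetrahedron.intro ideal_tetrahedron_axioms.intro)
          (use uniform_coxeter_axioms 2 in auto)
      have "card (S - {s, t}) = 2" using 2 st finite_S by (simp add: card_Diff_subset)
      then obtain a b where ab: "S - {s, t} = {a, b}" "a \<noteq> b" by (auto simp: card_2_iff)
      then have "S = {a, b, s, t}" "a \<noteq> s" "a \<noteq> t" "b \<noteq> s" "b \<noteq> t" using st by auto
      then show ?thesis using T.circulation_zero_rank4[of B' a b s t] B' ab(2) st(3) by simp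
    next
      case 3
      then show ?thesis using circulation_zero_energy[OF B' 3 st(1,2)] by simp
    qed
  qed
  then show ?thesis using w by (simp add: B'_def)
qed

end

theorem theorem7p6:
  fixes G :: "('a, 'b) monoid_scheme" and S :: "'a set" and n m :: nat and q :: "'a \<Rightarrow> real"
  assumes "n \<ge> 3"
    and "card S = n"
    and "coxeter_system G S (\<lambda>s t. if s = t then 1 else enat m)"
    and "m \<ge> n - 1"
    and nerve: "\<forall>T. T \<subseteq> S \<and> T \<noteq> {} \<longrightarrow> (spherical G T \<longleftrightarrow> card T \<le> 2)"
    and "multiparameter G S q"
    and "\<forall>s\<in>S. q s \<le> 1"
  shows "\<forall>f \<in> l2_chains2 G S q.
           (\<forall>e\<in>cells G S 1. bdry2 G S (\<lambda>s t. if s = t then 1 else enat m) q f e = 0)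
           \<longrightarrow> (\<forall>\<sigma>\<in>cells G S 2. f \<sigma> = 0)"
proof (intro ballI impI)
  fix f \<sigma>
  assume f: "f \<in> l2_chains2 G S q"
    and cyc: "\<forall>e\<in>cells G S 1. bdry2 G S (\<lambda>s t. if s = t then 1 else enat m) q f e = 0"
    and \<sigma>: "\<sigma> \<in> cells G S 2"
  have "finite S" using assms(1,2) card.infinite by fastforce
  moreover have "group G" using assms(3) by (simp add: coxeter_system_def)
  ultimately interpret uniform_coxeter G S m
    by (intro uniform_coxeter.intro uniform_coxeter_axioms.intro) (use assms in auto)
  have "\<not> spherical G S" using nerve[rule_format, of S] assms(1,2) by (cases "S = {}") auto
  then have inf: "infinite (carrier G)" using generate_S by (simp add: spherical_def)
  have pairs: "spherical G {s, t}" if "s \<in> S" "t \<in> S" for s t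
    using nerve[rule_format, of "{s, t}"] that by (simp add: card_insert_if)
  have q: "\<forall>s\<in>S. 0 < q s \<and> q s \<le> 1" using assms(6,7) by (simp add: multiparameter_def)
  note ctx = q pairs f cyc
  show "f \<sigma> = 0"
  proof (rule cycle_zero[OF ctx _ \<sigma>])
    fix w s t assume "w \<in> carrier G" "s \<in> S" "t \<in> S" "s \<noteq> t"
    then show "cycle_circ q f w s t = 0"
      using l2_circulation_zero[OF cycle_circulation[OF ctx]] inf assms(1,2,4) by simp
  qed
qed

end
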